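(* For every $p\in(2,6)$, let $N_p\ge2$ be the critical number of half-lines, i.e. the integer such that, with $q=\frac p2+1$, ground states of $F_{p,q}$ on $S_N$ at mass $\mu$ exist for every $\mu>0$ if $N\le N_p$, and exist for no $\mu>0$ if $N>N_p$. Then: (i) $\lim_{p\to2^+}N_p=+\infty$; (ii) if $p\in[4,6)$, then $N_p\in\{2,3,4\}$. Furthermore, there exists $\delta>0$ such that $N_p=3$ for every $p\in(4-\delta,4+\delta)\cup(6-\delta,6)$.
   Context: $S_N$ is the star graph made of $N$ half-lines $\mathcal{H}_1,\dots,\mathcal{H}_N$, each with a coordinate $x_i\in[0,+\infty)$, glued together at their common origin (the vertex), denoted by $0$. A (complex-valued) function $u$ on $S_N$ is a collection $(u_i)_{i=1}^N$ of functions on $\mathcal{H}_i\cong[0,+\infty)$; integrals and $L^p$ norms on $S_N$ are sums over the half-lines. $H^1(S_N)$ is the space of functions $u$ continuous on $S_N$ (in particular at the vertex, $u_i(0)=u_j(0)=:u(0)$) with $u_i\in H^1(0,\infty)$ for every $i$. For $\mu>0$, $H^1_\mu(S_N)=\{u\in H^1(S_N):\|u\|_{L^2(S_N)}^2=\mu\}$. The energy is $$F_{p,q}(u)=\frac12\int_{S_N}|u'|^2\,dx-\frac1p\int_{S_N}|u|^p\,dx-\frac1q|u(0)|^q .$$ A ground state of $F_{p,q}$ at mass $\mu$ is a function $u\in H^1_\mu(S_N)$ with $F_{p,q}(u)=\inf_{v\in H^1_\mu(S_N)}F_{p,q}(v)$. The paper proves that for every $p\in(2,6)$ and $q=\frac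 p2+1$ an integer $N_p\ge2$ with the property in the claim exists (it is clearly unique), and it depends only on $p$. *)

theory Defs
  imports "HOL-Analysis.Analysis"
begin

(* A function on S_N is u :: nat => real => complex, where u i (i < N) is its
   restriction to the half-line number i + 1.  Only the values u i x with
   i < N and x >= 0 are relevant. *)

abbreviation half_line :: "real measure" where
  "half_line \<equiv> lebesgue_on {0<..}"

definition L2_half_line :: "(real \<Rightarrow> complex) \<Rightarrow> bool" where
  "L2_half_line f \<longleftrightarrow>
     f \<in> borel_measurable half_line \<and> integrable half_line (\<lambda>x. (norm (f x))\<^sup>2)"

(* As usual for Sobolev spaces on intervals, the test functions are taken in
   C_c^1(0,oo); real-valued ones suffice also for complex-valued u. *)
definition test_function :: "(real \<Rightarrow> real) \<Rightarrow> bool" where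
  "test_function \<phi> \<longleftrightarrow>
     \<phi> C1_differentiable_on UNIV \<and>
     (\<exists>K. compact K \<and> K \<subseteq> {0<..} \<and> (\<forall>x. x \<notin> K \<longrightarrow> \<phi> x = 0))"

definition has_L2_weak_deriv :: "(real \<Rightarrow> complex) \<Rightarrow> (real \<Rightarrow> complex) \<Rightarrow> bool" where
  "has_L2_weak_deriv u g \<longleftrightarrow>
     L2_half_line g \<and>
     (\<forall>\<phi>. test_function \<phi> \<longrightarrow>
        (LINT x|half_line. deriv \<phi> x *\<^sub>R u x) = - (LINT x|half_line. \<phi> x *\<^sub>R g x))"

definition H1_half_line :: "(real \<Rightarrow> complex) \<Rightarrow> bool" where
  "H1_half_line u \<longleftrightarrow> L2_half_line u \<and> (\<exists>g. has_L2_weak_deriv u g)"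

(* Determined only up to null sets, which do not affect the energy. *)
definition weak_deriv :: "(real \<Rightarrow> complex) \<Rightarrow> real \<Rightarrow> complex" where
  "weak_deriv u = (SOME g. has_L2_weak_deriv u g)"

definition H1_star :: "nat \<Rightarrow> (nat \<Rightarrow> real \<Rightarrow> complex) set" where
  "H1_star N = {u. (\<forall>i<N. continuous_on {0..} (u i) \<and> H1_half_line (u i)) \<and>
                   (\<forall>i<N. \<forall>j<N. u i 0 = u j 0)}"

definition star_integral :: "nat \<Rightarrow> (nat \<Rightarrow> real \<Rightarrow> real) \<Rightarrow> real" where
  "star_integral N f = (\<Sum>i<N. LINT x|half_line. f i x)"

definition H1_mass :: "nat \<Rightarrow> real \<Rightarrow> (nat \<Rightarrow> real \<Rightarrow> complex) set" where
  "H1_mass N \<mu> = {u \<in> H1_star N. star_integral N (\<lambda>i x. (norm (u i x))\<^sup>2) = \<mu>}"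

(* The value at the vertex is read off on the first half-line, u 0 0, so N >= 1 is intended. *)
definition energy :: "nat \<Rightarrow> real \<Rightarrow> real \<Rightarrow> (nat \<Rightarrow> real \<Rightarrow> complex) \<Rightarrow> real" where
  "energy N p q u =
     1 / 2 * star_integral N (\<lambda>i x. (norm (weak_deriv (u i) x))\<^sup>2)
     - 1 / p * star_integral N (\<lambda>i x. norm (u i x) powr p)
     - 1 / q * norm (u 0 0) powr q"

(* The infimum is taken in the extended reals, so that it is meaningful without
   knowing that the energy is bounded below. *)
definition ground_state ::
  "nat \<Rightarrow> real \<Rightarrow> real \<Rightarrow> real \<Rightarrow> (nat \<Rightarrow> real \<Rightarrow> complex) \<Rightarrow> bool" where
  "ground_state N p q \<mu> u \<longleftrightarrow>
     u \<in> H1_mass N \<mu> \<and>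
     ereal (energy N p q u) = (INF v\<in>H1_mass N \<mu>. ereal (energy N p q v))"

definition critical_number :: "real \<Rightarrow> nat \<Rightarrow> bool" where
  "critical_number p n \<longleftrightarrow>
     n \<ge> 2 \<and>
     (\<forall>N\<ge>1. \<forall>\<mu>>0.
        (N \<le> n \<longrightarrow> (\<exists>u. ground_state N p (p / 2 + 1) \<mu> u)) \<and>
        (N > n \<longrightarrow> \<not> (\<exists>u. ground_state N p (p / 2 + 1) \<mu> u)))"

end

theory Submission
  imports Defs "HOL-Real_Asymp.Real_Asymp"
begin

text \<open>
Write q = p / 2 + 1. For this exponent the three terms of the energy scale alike, so the mass can
be normalised and everything depends on p and N only. Two states compete for the infimum: a full
soliton that escapes to infinity along one half-line, and the symmetric state, which on every
half-line is the same decreasing piece of a soliton, cut at the amplitude (relative to the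
maximum of the soliton) for which the derivatives and the nonlinear vertex term balance. That
amplitude is the vertex amplitude below.

The infimum is exactly the smaller of the two energies. The lower bound is a calibration. If S
solves the first integral of the soliton equation with maximal amplitude c, then for
\<bar>u\<bar> \<le> c the energy density plus a multiple of \<bar>u\<bar>^2 equals
\<bar>u'\<bar> S'(\<bar>u\<bar>) plus a square, and the first term integrates to at least the
variation of S along \<bar>u\<bar>. So the energy is bounded below in terms of the modulus a at the
vertex, the maximal modulus A and the free parameter c \<ge> A. The choice of c is the heart of the
matter: depending on whether a / A is above or below the vertex amplitude, c is chosen such that the
bound compares with the symmetric state or with the full soliton. Since the bound holds for every
competitor, a state that attains it is a ground state. The lemmas
half_line_lower_bound, energy_level_scale_choice and energy_lower_bound carry this part.

Each of the two states has a level, which is proportional to its mass when both are scaled to the same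
frequency; at equal mass the smaller level has the smaller energy. So the symmetric state is a ground
state if N * tail_mass p s \<le> 2 * tail_mass p 1, where s is the vertex amplitude
(ground_state_exists). Otherwise the infimum is the energy of the escaping soliton, which competitors approach and none
attains (ground_state_not_exists): equality in the calibration would make u vanish at the vertex,
and then \<bar>u'\<bar> \<le> L \<bar>u\<bar> makes u vanish altogether.

What remains is an inequality between two incomplete integrals. For N = 3 it holds and for N = 4 it
fails, for all p in the interval from 3 to 6 with 6 excluded (three_half_lines_small,
three_half_lines_large, four_half_lines_exceed), so N_p = 3 there, which covers all claims except the
limit. At p = 6 and N = 3 both sides agree, hence the extra care for N = 3 and p \<ge> 4. As p tends to
2, the truncated mass tends to 0 for each fixed N while the full mass does not, so every N is
eventually admissible (eventually_many_half_lines).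
\<close>

section \<open>The soliton profile as a function of its amplitude\<close>

lemma increment_le_increment:
  fixes f g :: "real \<Rightarrow> real"
  assumes "a \<le> b" "continuous_on {a..b} f" "continuous_on {a..b} g"
    and f: "\<And>x. a < x \<Longrightarrow> x < b \<Longrightarrow> (f has_real_derivative f' x) (at x)"
    and g: "\<And>x. a < x \<Longrightarrow> x < b \<Longrightarrow> (g has_real_derivative g' x) (at x)"
    and le: "\<And>x. a < x \<Longrightarrow> x < b \<Longrightarrow> f' x \<le> g' x"
  shows "f b - f a \<le> g b - g a"
proof (cases "a < b")
  case True
  have "(\<lambda>x. g x - f x) a \<le> (\<lambda>x. g x - f x) b"
  proof (rule DERIV_nonneg_imp_increasing_open[where f="\<lambda>x. g x - f x"])
    show "\<exists>y. ((\<lambda>x. g x - f x) has_real_derivative y) (at x) \<and> 0 \<le> y" if "a < x" "x < b" for x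
      using f[OF that] g[OF that] le[OF that] by (intro exI[of _ "g' x - f' x"]) (auto intro: DERIV_diff)
  qed (use assms in \<open>auto intro!: continuous_intros\<close>)
  then show ?thesis by simp
qed (use assms in auto)

text \<open>With unit amplitude, the soliton \<phi> satisfies
\<bar>\<phi>'\<bar> = sqrt (2 / p) * \<phi> * root_factor p \<phi>; this is the first integral of the soliton
equation.\<close>
definition root_factor :: "real \<Rightarrow> real \<Rightarrow> real" where
  "root_factor p t = sqrt (1 - t powr (p - 2))"

definition slope :: "real \<Rightarrow> real \<Rightarrow> real" where
  "slope p t = t * root_factor p t"

text \<open>The kinetic integral of a decreasing piece of the soliton that starts at amplitude a, up to
the factor sqrt (2 / p); the primitive used by the calibration.\<close>
definition action :: "real \<Rightarrow> real \<Rightarrow> real" where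
  "action p a = integral {0..a} (slope p)"

text \<open>The integral of t / root_factor p t from 0 to a, that is, the mass of the part of the soliton
below amplitude a on one side of its maximum, up to the factor sqrt (p / 2). The integrand is
unbounded at 1; the formula below comes from the scaling identity between action and mass and avoids
the improper integral.\<close>
definition tail_mass :: "real \<Rightarrow> real \<Rightarrow> real" where
  "tail_mass p a = ((p + 2) * action p a - 2 * a * slope p a) / (p - 2)"

text \<open>The amplitude, relative to the maximum of the soliton, at which N decreasing pieces satisfy
the nonlinear Kirchhoff condition at the vertex, see slope_vertex_amplitude.\<close>
definition vertex_amplitude :: "real \<Rightarrow> real \<Rightarrow> real" where
  "vertex_amplitude p N = (2 * N\<^sup>2 / (2 * N\<^sup>2 + p)) powr (1 / (p - 2))"

context
  fixes p :: real
  assumes p: "2 < p"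
begin

lemma powr_le_1_unit: "0 \<le> t \<Longrightarrow> t \<le> 1 \<Longrightarrow> t powr (p - 2) \<le> 1"
  using p by (intro powr_le1) auto

lemma powr_less_1_unit: "0 \<le> t \<Longrightarrow> t < 1 \<Longrightarrow> t powr (p - 2) < 1"
  using p by (metis diff_gt_0_iff_gt powr_less_mono2 powr_one_eq_one)

lemma root_factor_sq: "0 \<le> t \<Longrightarrow> t \<le> 1 \<Longrightarrow> (root_factor p t)\<^sup>2 = 1 - t powr (p - 2)"
  using powr_le_1_unit by (simp add: root_factor_def)

lemma root_factor_nonneg: "0 \<le> t \<Longrightarrow> t \<le> 1 \<Longrightarrow> 0 \<le> root_factor p t"
  using powr_le_1_unit by (simp add: root_factor_def)

lemma root_factor_pos: "0 \<le> t \<Longrightarrow> t < 1 \<Longrightarrow> 0 < root_factor p t"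
  using powr_less_1_unit by (simp add: root_factor_def)

lemma root_factor_le_1: "0 \<le> t \<Longrightarrow> root_factor p t \<le> 1"
  by (simp add: root_factor_def)

lemma root_factor_1 [simp]: "root_factor p 1 = 0" by (simp add: root_factor_def)
lemma root_factor_0 [simp]: "root_factor p 0 = 1" by (simp add: root_factor_def)

lemma continuous_on_root_factor: "continuous_on {0..1} (root_factor p)"
  unfolding root_factor_def using p by (intro continuous_intros continuous_on_powr') auto

lemma continuous_on_slope: "continuous_on {0..1} (slope p)"
  unfolding slope_def[abs_def] by (intro continuous_intros continuous_on_root_factor)

lemma slope_nonneg: "0 \<le> t \<Longrightarrow> t \<le> 1 \<Longrightarrow> 0 \<le> slope p t"
  by (simp add: slope_def root_factor_nonneg)

lemma slope_pos: "0 < t \<Longrightarrow> t < 1 \<Longrightarrow> 0 < slope p t"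
  by (simp add: slope_def root_factor_pos)

lemma slope_le: "0 \<le> t \<Longrightarrow> slope p t \<le> t"
  using root_factor_le_1[of t] by (simp add: slope_def mult_left_le)

lemma action_0 [simp]: "action p 0 = 0" by (simp add: action_def)

lemma action_deriv_within:
  assumes "0 \<le> a" "a \<le> 1"
  shows "(action p has_real_derivative slope p a) (at a within {0..1})"
  using integral_has_real_derivative[OF continuous_on_slope, of a] assms
  by (simp add: action_def[abs_def])

lemma action_deriv:
  assumes "0 < a" "a < 1"
  shows "(action p has_real_derivative slope p a) (at a)"
  using action_deriv_within[of a] assms at_within_Icc_at[of 0 a 1] by simp

lemma continuous_on_action: "continuous_on {0..1} (action p)"
  using action_deriv_within by (meson DERIV_continuous_on atLeastAtMost_iff)

lemma action_mono:
  assumes "0 \<le> a" "a \<le> b" "b \<le> 1"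
  shows "action p a \<le> action p b"
proof -
  have "(0::real) - 0 \<le> action p b - action p a"
    by (rule increment_le_increment[where f'="\<lambda>_. 0" and g'="slope p" and f="\<lambda>_. 0"])
       (use assms in \<open>auto intro!: continuous_on_subset[OF continuous_on_action] action_deriv slope_nonneg\<close>)
  then show ?thesis by simp
qed

lemma action_pos: 
  assumes "0 < a" "a \<le> 1"
  shows "0 < action p a"
proof -
  have "action p 0 < action p a"
    by (rule DERIV_pos_imp_increasing_open) (use assms in \<open>auto intro!: action_deriv slope_pos continuous_on_subset[OF continuous_on_action] exI\<close>)
  then show ?thesis by simp
qed

lemma root_factor_deriv:
  assumes "0 < t" "t < 1"
  shows "(root_factor p has_real_derivative - ((p - 2) * t powr (p - 3) / (2 * root_factor p t))) (at t)"
proof -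
  have "1 - t powr (p-2) > 0" using powr_less_1_unit assms by auto
  moreover have "t powr (p - 2 - 1) = t powr (p - 3)" by (simp add: algebra_simps)
  ultimately show ?thesis unfolding root_factor_def[abs_def] using assms
    by (auto intro!: derivative_eq_intros simp: divide_simps algebra_simps)
qed

text \<open>This is what identifies tail_mass with the mass integral.\<close>
lemma tail_mass_deriv:
  assumes "0 < t" "t < 1"
  shows "(tail_mass p has_real_derivative t / root_factor p t) (at t)"
proof -
  let ?r = "root_factor p t"
  have rp: "?r > 0" using assms root_factor_pos by auto
  have e: "t powr (p - 3) * t = t powr (p - 2)"
    using assms powr_mult_base[of t "p - 3"] by (simp add: mult.commute)
  have sq: "t powr (p - 2) = 1 - ?r\<^sup>2" using root_factor_sq assms by simp
  have "(p - 2) * t powr (p - 3) / (2 * ?r) * t = (p - 2) * (1 - ?r\<^sup>2) / (2 * ?r)"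
    unfolding sq[symmetric] e[symmetric] by simp
  then have "((p + 2) * slope p t - 2 * (1 * (t * ?r) + (1 * ?r + - ((p - 2) * t powr (p - 3) / (2 * ?r)) * t) * t))
      = (p + 2) * (t * ?r) - 2 * (t * ?r + (?r - (p - 2) * (1 - ?r\<^sup>2) / (2 * ?r)) * t)"
    by (simp add: slope_def)
  also have "\<dots> = (p - 2) * (t / ?r)"
    using rp by (simp add: field_simps power2_eq_square)
  finally have "((p + 2) * slope p t - 2 * (1 * (t * ?r) + (1 * ?r + - ((p - 2) * t powr (p - 3) / (2 * ?r)) * t) * t)) / (p - 2) = t / ?r"
    using p by simp
  moreover have "((\<lambda>t. ((p + 2) * action p t - 2 * (t * (t * root_factor p t))) / (p - 2)) has_real_derivative
     ((p + 2) * slope p t - 2 * (1 * (t * ?r) + (1 * ?r + - ((p - 2) * t powr (p - 3) / (2 * ?r)) * t) * t)) / (p - 2)) (at t)"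
    using assms p
    by (intro DERIV_cdivide DERIV_diff DERIV_cmult DERIV_mult DERIV_ident action_deriv root_factor_deriv)
  ultimately show ?thesis unfolding tail_mass_def[abs_def] slope_def[of p] by (simp only: mult.assoc)
qed

lemma continuous_on_tail_mass: "continuous_on {0..1} (tail_mass p)"
  unfolding tail_mass_def[abs_def] using p
  by (intro continuous_intros continuous_on_action continuous_on_slope) auto

lemma tail_mass_0 [simp]: "tail_mass p 0 = 0"
  by (simp add: tail_mass_def)

lemma tail_mass_diff_le:
  assumes "0 \<le> a" "a \<le> b" "b \<le> 1" "continuous_on {a..b} g"
    and "\<And>x. a < x \<Longrightarrow> x < b \<Longrightarrow> (g has_real_derivative g' x) (at x)"
    and "\<And>x. a < x \<Longrightarrow> x < b \<Longrightarrow> x / root_factor p x \<le> g' x"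
  shows "tail_mass p b - tail_mass p a \<le> g b - g a"
  by (rule increment_le_increment[where f'="\<lambda>x. x / root_factor p x" and g'=g'])
     (use assms in \<open>auto intro!: tail_mass_deriv intro: continuous_on_subset[OF continuous_on_tail_mass]\<close>)

lemma tail_mass_diff_ge:
  assumes "0 \<le> a" "a \<le> b" "b \<le> 1" "continuous_on {a..b} g"
    and "\<And>x. a < x \<Longrightarrow> x < b \<Longrightarrow> (g has_real_derivative g' x) (at x)"
    and "\<And>x. a < x \<Longrightarrow> x < b \<Longrightarrow> g' x \<le> x / root_factor p x"
  shows "g b - g a \<le> tail_mass p b - tail_mass p a"
  by (rule increment_le_increment[where g'="\<lambda>x. x / root_factor p x" and f'=g'])
     (use assms in \<open>auto intro!: tail_mass_deriv intro: continuous_on_subset[OF continuous_on_tail_mass]\<close>)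

text \<open>The second factor is the derivative of a multiple of root_factor, so all estimates of the
mass reduce to estimates of t powr (4 - p), a power that is monotone and trivial at p = 4.\<close>
lemma tail_mass_integrand:
  assumes "0 < t" "t < 1"
  shows "t / root_factor p t = t powr (4 - p) * (t powr (p - 3) / root_factor p t)"
proof -
  have "t powr (4 - p) * t powr (p - 3) = t" using assms by (simp add: powr_add[symmetric])
  then show ?thesis by simp
qed

context
  fixes N :: real
  assumes N: "N > 0"
begin

lemma vertex_amplitude_powr: "vertex_amplitude p N powr (p - 2) = 2 * N\<^sup>2 / (2 * N\<^sup>2 + p)"
  using p N by (simp add: vertex_amplitude_def powr_powr)

lemma vertex_amplitude_pos: "0 < vertex_amplitude p N"
  proof -
  have "2 * N\<^sup>2 / (2 * N\<^sup>2 + p) > 0" using p N by (intro divide_pos_pos add_pos_pos) auto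
  then show ?thesis unfolding vertex_amplitude_def by (subst powr_gt_zero) linarith
qed

lemma vertex_amplitude_less_1: "vertex_amplitude p N < 1"
proof -
  have "2 * N\<^sup>2 / (2 * N\<^sup>2 + p) < 1" using p N by (simp add: divide_less_eq_1 add_pos_pos)
  then have "vertex_amplitude p N < 1 powr (1 / (p - 2))" unfolding vertex_amplitude_def
    using p N by (intro powr_less_mono2) auto
  then show ?thesis by simp
qed

lemma root_factor_vertex: "root_factor p (vertex_amplitude p N) = sqrt (p / (2 * N\<^sup>2 + p))"
proof -
  have "1 - 2 * N\<^sup>2 / (2 * N\<^sup>2 + p) = p / (2 * N\<^sup>2 + p)"
    using p N by (simp add: field_simps add_pos_pos less_imp_neq[THEN not_sym])
  then show ?thesis unfolding root_factor_def vertex_amplitude_powr by simp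
qed

end
end

section \<open>Comparing the masses of truncated solitons\<close>

text \<open>Bernoulli's inequality for exponents in the unit interval.\<close>
lemma powr_le_chord:
  fixes x y :: real
  assumes "0 \<le> a" "a \<le> 1" "0 < y"
  shows "y powr a \<le> 1 - a * (1 - y)"
  using Youngs_inequality_0[of a "1 - a" y 1] assms by (simp add: algebra_simps)

text \<open>For p = 6 the mass integral becomes elementary in this angle, see angle_deriv.\<close>
definition angle :: "real \<Rightarrow> real \<Rightarrow> real" where
  "angle p t = arccos (root_factor p t)"

context
  fixes p :: real
  assumes p: "2 < p"
begin

lemma scaled_root_factor_deriv:
  assumes "0 < t" "t < 1"
  shows "((\<lambda>t. - (2 / (p - 2)) * root_factor p t) has_real_derivative t powr (p - 3) / root_factor p t) (at t)"
proof -
  have "- (2 / (p - 2)) * - ((p - 2) * t powr (p - 3) / (2 * root_factor p t)) = t powr (p - 3) / root_factor p t"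
    using p by simp
  then show ?thesis using DERIV_cmult[OF root_factor_deriv[OF p assms], of "- (2 / (p - 2))"] by simp
qed

text \<open>For p \<ge> 4 the power t powr (4 - p) decreases, so replacing it by its value at s
is a lower bound below s and an upper bound above s.\<close>
lemma tail_mass_bounds_large:
  assumes "4 \<le> p" and s: "0 < s" "s < 1"
  defines "K \<equiv> s powr (4 - p) * (2 / (p - 2))"
  shows "K * (1 - root_factor p s) \<le> tail_mass p s"
    and "tail_mass p 1 - tail_mass p s \<le> K * root_factor p s"
proof -
  define g where "g t = s powr (4 - p) * (- (2 / (p - 2)) * root_factor p t)" for t
  have cont: "continuous_on {0..1} g"
    unfolding g_def by (intro continuous_intros continuous_on_root_factor p)
  have g: "(g has_real_derivative s powr (4 - p) * (t powr (p - 3) / root_factor p t)) (at t)"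
    if "0 < t" "t < 1" for t
    unfolding g_def by (intro DERIV_cmult scaled_root_factor_deriv that)
  have "g s - g 0 \<le> tail_mass p s - tail_mass p 0"
  proof (rule tail_mass_diff_ge[OF p, where g'="\<lambda>t. s powr (4 - p) * (t powr (p - 3) / root_factor p t)"])
    show "s powr (4 - p) * (x powr (p - 3) / root_factor p x) \<le> x / root_factor p x"
      if "0 < x" "x < s" for x
      unfolding tail_mass_integrand[OF p that(1) less_trans[OF that(2) s(2)]]
      using that assms root_factor_pos[OF p, of x] by (intro mult_right_mono powr_mono2') auto
  qed (use s in \<open>auto intro: g[simplified] g continuous_on_subset[OF cont]\<close>)
  then show "K * (1 - root_factor p s) \<le> tail_mass p s"
    by (simp add: g_def K_def p algebra_simps diff_divide_distrib)
  have "tail_mass p 1 - tail_mass p s \<le> g 1 - g s"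
  proof (rule tail_mass_diff_le[OF p, where g'="\<lambda>t. s powr (4 - p) * (t powr (p - 3) / root_factor p t)"])
    show "x / root_factor p x \<le> s powr (4 - p) * (x powr (p - 3) / root_factor p x)"
      if "s < x" "x < 1" for x
      unfolding tail_mass_integrand[OF p less_trans[OF s(1) that(1)] that(2)]
      using that assms root_factor_pos[OF p, of x] by (intro mult_right_mono powr_mono2') auto
  qed (use s in \<open>auto intro: g[simplified] continuous_on_subset[OF cont]\<close>)
  then show "tail_mass p 1 - tail_mass p s \<le> K * root_factor p s"
    by (simp add: g_def K_def p)
qed

lemma tail_mass_upper_small:
  assumes "p \<le> 4" "0 \<le> a" "a \<le> b" "b \<le> 1"
  shows "tail_mass p b - tail_mass p a \<le> 2 / (p - 2) * (root_factor p a - root_factor p b)"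
proof -
  have "tail_mass p b - tail_mass p a \<le> (- (2 / (p - 2)) * root_factor p b) - (- (2 / (p - 2)) * root_factor p a)"
  proof (rule tail_mass_diff_le[OF p, where g'="\<lambda>t. t powr (p - 3) / root_factor p t"])
    show "continuous_on {a..b} (\<lambda>t. - (2 / (p - 2)) * root_factor p t)"
      using assms by (intro continuous_intros continuous_on_subset[OF continuous_on_root_factor[OF p]]) auto
    show "x / root_factor p x \<le> x powr (p - 3) / root_factor p x" if "a < x" "x < b" for x
    proof -
      have "x / root_factor p x = x powr (4 - p) * (x powr (p - 3) / root_factor p x)"
        using that assms by (intro tail_mass_integrand[OF p]) auto
      also have "\<dots> \<le> 1 * (x powr (p - 3) / root_factor p x)"
        using that assms root_factor_pos[OF p, of x] by (intro mult_right_mono powr_le1) auto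
      finally show ?thesis by simp
    qed
  qed (use assms in \<open>auto intro!: scaled_root_factor_deriv[simplified]\<close>)
  also have "\<dots> = 2 / (p - 2) * (root_factor p a - root_factor p b)" by (simp add: algebra_simps diff_divide_distrib)
  finally show ?thesis .
qed

text \<open>Here t powr (4 - p) is at least t powr (p - 2) = 1 - (root_factor p t)^2, which leaves
a polynomial in root_factor to integrate.\<close>
lemma tail_mass_lower_small:
  assumes "3 \<le> p" "0 \<le> a" "a \<le> b" "b \<le> 1"
  defines "P \<equiv> \<lambda>t. root_factor p t - root_factor p t ^ 3 / 3"
  shows "2 / (p - 2) * (P a - P b) \<le> tail_mass p b - tail_mass p a"
proof -
  define g where "g t = - (2 / (p - 2)) * root_factor p t + 2 / (p - 2) * (root_factor p t ^ 3 / 3)" for t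
  have cont: "continuous_on {a..b} g"
    unfolding g_def using assms
    by (intro continuous_intros continuous_on_subset[OF continuous_on_root_factor[OF p]]) auto
  have "g b - g a \<le> tail_mass p b - tail_mass p a"
  proof (rule tail_mass_diff_ge[OF p _ _ _ cont, where g'="\<lambda>t. t powr (p - 2) * (t powr (p - 3) / root_factor p t)"])
    fix x assume x: "a < x" "x < b"
    then have x01: "0 < x" "x < 1" using assms by auto
    let ?d = "x powr (p - 3) / root_factor p x"
    have r: "root_factor p x > 0" using root_factor_pos[OF p] x01 by auto
    have *: "((\<lambda>t. root_factor p t ^ 3 / 3) has_real_derivative 
         (root_factor p x)\<^sup>2 * - ((p - 2) * x powr (p - 3) / (2 * root_factor p x))) (at x)"
      by (rule DERIV_cong[OF DERIV_cdivide[OF DERIV_power[OF root_factor_deriv[OF p x01], of 3], of 3]]) (simp add: mult_ac)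
    have "(g has_real_derivative ?d + 2 / (p - 2) * ((root_factor p x)\<^sup>2 * - ((p - 2) * x powr (p - 3) / (2 * root_factor p x)))) (at x)"
      unfolding g_def by (intro DERIV_add scaled_root_factor_deriv x01 DERIV_cmult[OF *])
    also have "?d + 2 / (p - 2) * ((root_factor p x)\<^sup>2 * - ((p - 2) * x powr (p - 3) / (2 * root_factor p x)))
      = (1 - (root_factor p x)\<^sup>2) * ?d"
      using p r by (simp add: field_simps)
    also have "\<dots> = x powr (p - 2) * ?d"
      using root_factor_sq[OF p, of x] x01 by simp
    finally show "(g has_real_derivative x powr (p - 2) * ?d) (at x)" .
    show "x powr (p - 2) * ?d \<le> x / root_factor p x"
      unfolding tail_mass_integrand[OF p x01] using assms x01 r
      by (intro mult_right_mono powr_mono') auto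
  qed (use assms in auto)
  then show ?thesis unfolding g_def P_def by (simp add: algebra_simps diff_divide_distrib)
qed

lemma tail_mass_lower_near_1:
  assumes "3 \<le> p" "p \<le> 4" "0 < s" "s < 1"
  shows "s powr (p - 2) * (2 / (p - 2)) * root_factor p s \<le> tail_mass p 1 - tail_mass p s"
proof -
  define g where "g t = s powr (p - 2) * (- (2 / (p - 2)) * root_factor p t)" for t
  have cont: "continuous_on {s..1} g"
    unfolding g_def using assms by (intro continuous_intros continuous_on_subset[OF continuous_on_root_factor[OF p]]) auto
  have "g 1 - g s \<le> tail_mass p 1 - tail_mass p s"
  proof (rule tail_mass_diff_ge[OF p _ _ _ cont, where g'="\<lambda>t. s powr (p - 2) * (t powr (p - 3) / root_factor p t)"])
    fix x assume x: "s < x" "x < 1"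
    then have x01: "0 < x" "x < 1" using assms by auto
    show "(g has_real_derivative s powr (p - 2) * (x powr (p - 3) / root_factor p x)) (at x)"
      unfolding g_def by (intro DERIV_cmult scaled_root_factor_deriv x01)
    have "s powr (p - 2) \<le> x powr (p - 2)" using x assms by (intro powr_mono2) auto
    also have "\<dots> \<le> x powr (4 - p)" using x01 assms by (intro powr_mono') auto
    finally show "s powr (p - 2) * (x powr (p - 3) / root_factor p x) \<le> x / root_factor p x"
      unfolding tail_mass_integrand[OF p x01] using root_factor_pos[OF p, of x] x01 by (intro mult_right_mono) auto
  qed (use assms in auto)
  then show ?thesis by (simp add: g_def p)
qed

text \<open>The claim is that less mass lies between the vertex amplitude and 1 than below the vertex
amplitude. The two estimates reduce this to an explicit bound for
root_factor p s = sqrt (p / (32 + p)).\<close>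
lemma four_half_lines_exceed:
  assumes "3 \<le> p" "p < 6"
  shows "2 * tail_mass p 1 < 4 * tail_mass p (vertex_amplitude p 4)"
proof -
  define s where "s = vertex_amplitude p 4"
  have s: "0 < s" "s < 1" using vertex_amplitude_pos[OF p, of 4] vertex_amplitude_less_1[OF p, of 4] by (auto simp: s_def)
  define W where "W = root_factor p s"
  have W: "W = sqrt (p / (32 + p))" using root_factor_vertex[OF p, of 4] by (simp add: W_def s_def)
  have W0: "W > 0" using p by (simp add: W)
  have "tail_mass p 1 - tail_mass p s < tail_mass p s"
  proof (cases "4 \<le> p")
    case True
    have "sqrt (p / (32 + p)) < sqrt ((1 / 2)\<^sup>2)"
      using assms by (intro real_sqrt_less_mono) (simp add: field_simps power2_eq_square)
    then have "W < 1 / 2" unfolding W by (simp only: real_sqrt_abs)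
    then have "W < 1 - W" by simp
    then have "s powr (4 - p) * (2 / (p - 2)) * W < s powr (4 - p) * (2 / (p - 2)) * (1 - W)"
      using p s by (intro mult_strict_left_mono) auto
    then show ?thesis using tail_mass_bounds_large[OF True s] unfolding W_def by linarith
  next
    case False
    have "sqrt (p / (32 + p)) \<le> sqrt ((1 / 3)\<^sup>2)"
      using assms False by (intro real_sqrt_le_mono) (simp add: field_simps power2_eq_square)
    then have W3: "W \<le> 1 / 3" by (simp add: W real_sqrt_divide)
    have "W < 2 / 3 - (W - W ^ 3 / 3)" using W3 zero_less_power[OF W0, of 3] by linarith
    then have "2 / (p - 2) * W < 2 / (p - 2) * (2 / 3 - (W - W ^ 3 / 3))"
      using p by (intro mult_strict_left_mono) auto
    moreover have "tail_mass p 1 - tail_mass p s \<le> 2 / (p - 2) * W"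
      using tail_mass_upper_small[of s 1] False s p by (simp add: W_def)
    moreover have "2 / (p - 2) * (2 / 3 - (W - W ^ 3 / 3)) \<le> tail_mass p s"
      using tail_mass_lower_small[of 0 s] assms s p by (simp add: W_def)
    ultimately show ?thesis by linarith
  qed
  then show ?thesis by (simp add: s_def)
qed

text \<open>The bounds for the two parts of the mass reduce the claim to
1 \<le> 2 * W * (1 + W) for W = root_factor p s = sqrt (p / (18 + p)), which is at least 3 / 8.\<close>
lemma three_half_lines_small:
  assumes "3 \<le> p" "p \<le> 4"
  shows "3 * tail_mass p (vertex_amplitude p 3) \<le> 2 * tail_mass p 1"
proof -
  define s where "s = vertex_amplitude p 3"
  have s: "0 < s" "s < 1" using vertex_amplitude_pos[OF p, of 3] vertex_amplitude_less_1[OF p, of 3] by (auto simp: s_def)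
  define W where "W = root_factor p s"
  have W: "W = sqrt (p / (18 + p))" using root_factor_vertex[OF p, of 3] by (simp add: W_def s_def)
  have W1: "W \<le> 1" using root_factor_le_1[OF p] s by (simp add: W_def)
  have "sqrt ((3 / 8)\<^sup>2) \<le> sqrt (p / (18 + p))"
    using assms by (intro real_sqrt_le_mono) (simp add: field_simps power2_eq_square)
  then have "3 / 8 \<le> W" by (simp add: W real_sqrt_divide)
  then have "3 / 8 * (11 / 8) \<le> W * (1 + W)" by (intro mult_mono) auto
  then have "1 * (1 - W) \<le> 2 * (W * (1 + W)) * (1 - W)" using W1 by (intro mult_right_mono) auto
  also have "\<dots> = 2 * ((1 - W\<^sup>2) * W)" by (simp add: algebra_simps power2_eq_square)
  finally have "2 / (p - 2) * (1 - W) \<le> 2 / (p - 2) * (2 * ((1 - W\<^sup>2) * W))"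
    using p by (intro mult_left_mono) auto
  moreover have "tail_mass p s \<le> 2 / (p - 2) * (1 - W)"
    using tail_mass_upper_small[of 0 s] s assms p by (simp add: W_def)
  moreover have "s powr (p - 2) = 1 - W\<^sup>2" using root_factor_sq[OF p, of s] s by (simp add: W_def)
  then have "(1 - W\<^sup>2) * (2 / (p - 2)) * W \<le> tail_mass p 1 - tail_mass p s"
    using tail_mass_lower_near_1[of s] s assms by (simp add: W_def)
  moreover have "2 / (p - 2) * (2 * ((1 - W\<^sup>2) * W)) = 2 * ((1 - W\<^sup>2) * (2 / (p - 2)) * W)"
    by simp
  ultimately have "tail_mass p s \<le> 2 * (tail_mass p 1 - tail_mass p s)"
    by (metis (no_types) order_trans mult_left_mono zero_le_numeral)
  then show ?thesis by (simp add: s_def)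
qed


lemma angle_deriv:
  assumes t: "0 < t" "t < 1"
  shows "(angle p has_real_derivative (p - 2) / 2 * (t powr (p / 2 - 2) / root_factor p t)) (at t)"
proof -
  let ?r = "root_factor p t"
  have r: "0 < ?r" "?r < 1"
  proof -
    show "0 < ?r" using root_factor_pos[OF p] t by auto
    have "?r\<^sup>2 < 1" using root_factor_sq[OF p, of t] t by simp
    then show "?r < 1" using \<open>0 < ?r\<close> power2_less_imp_less[of ?r 1] by simp
  qed
  have "sqrt (1 - ?r\<^sup>2) = t powr (p / 2 - 1)"
    using root_factor_sq[OF p, of t] t by (simp add: powr_half_sqrt_powr[symmetric] diff_divide_distrib)
  moreover have "(angle p has_real_derivative inverse (- sqrt (1 - ?r\<^sup>2)) * - ((p - 2) * t powr (p - 3) / (2 * ?r))) (at t)"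
    unfolding angle_def[abs_def] using r by (intro DERIV_chain2[OF DERIV_arccos root_factor_deriv[OF p t]]) auto
  moreover have "t powr (p - 3) = t powr (p / 2 - 1) * t powr (p / 2 - 2)"
    by (simp add: powr_add[symmetric])
  moreover have "inverse (- a) * - ((p - 2) * (a * b) / (2 * ?r)) = (p - 2) / 2 * (b / ?r)" if "a \<noteq> 0" for a b
    using that r by (simp add: field_simps)
  from this[of "t powr (p / 2 - 1)"] t have "inverse (- (t powr (p / 2 - 1))) * - ((p - 2) * (t powr (p / 2 - 1) * t powr (p / 2 - 2)) / (2 * ?r))
      = (p - 2) / 2 * (t powr (p / 2 - 2) / ?r)" by simp
  ultimately show ?thesis by (simp only:)
qed

lemma continuous_on_angle: "continuous_on {0..1} (angle p)"
proof -
  have "continuous_on {0..1} (\<lambda>t. arccos (root_factor p t))"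
    using root_factor_nonneg[OF p] root_factor_le_1[OF p]
    by (intro continuous_on_arccos continuous_on_root_factor[OF p]) (auto intro: order_trans[of _ 0])
  then show ?thesis by (simp add: angle_def[abs_def])
qed

text \<open>In the variable angle, the mass integrand is a constant times the power
t powr (3 - p / 2), which is 1 at p = 6. Above s this power is at least its value at s. Below s this
would lose the first-order gain in 6 - p that is needed for N = 3; there the power is bounded by its
chord as a function of sin (angle p t) = t powr (p / 2 - 1), which can still be integrated.\<close>
lemma tail_mass_bounds_angle:
  assumes "4 \<le> p" "p < 6" and s: "0 < s" "s < 1"
  defines "K \<equiv> 2 / (p - 2) * s powr (3 - p / 2)" and "\<sigma> \<equiv> (6 - p) / (p - 2)"
  shows "tail_mass p s \<le> K * ((1 - \<sigma>) * angle p s + \<sigma> * ((1 - root_factor p s) / s powr (p / 2 - 1)))"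
    and "K * (pi / 2 - angle p s) \<le> tail_mass p 1 - tail_mass p s"
proof -
  have \<sigma>: "0 \<le> \<sigma>" "\<sigma> \<le> 1" using assms by (auto simp: \<sigma>_def field_simps)
  have integrand: "x / root_factor p x = 2 / (p - 2) * x powr (3 - p / 2) * ((p - 2) / 2 * (x powr (p / 2 - 2) / root_factor p x))"
    if "0 < x" for x
  proof -
    have "x powr (3 - p / 2) * x powr (p / 2 - 2) = x" using that by (simp add: powr_add[symmetric])
    then show ?thesis using p by simp
  qed
  define h where "h = s powr (p / 2 - 1)"
  have h: "h > 0" using s by (simp add: h_def)
  define g where "g t = K * ((1 - \<sigma>) * angle p t + \<sigma> / h * - root_factor p t)" for t
  define g' where "g' t = K * ((1 - \<sigma>) * ((p - 2) / 2 * (t powr (p / 2 - 2) / root_factor p t))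
       + \<sigma> / h * ((p - 2) * t powr (p - 3) / (2 * root_factor p t)))" for t
  have "tail_mass p s - tail_mass p 0 \<le> g s - g 0"
  proof (rule tail_mass_diff_le[OF p, where g'=g'])
    show "continuous_on {0..s} g" unfolding g_def using s
      by (intro continuous_intros continuous_on_subset[OF continuous_on_root_factor[OF p]] continuous_on_subset[OF continuous_on_angle]) auto
    fix x assume x: "0 < x" "x < s"
    then have x1: "x < 1" using s by simp
    have "((\<lambda>t. - root_factor p t) has_real_derivative (p - 2) * x powr (p - 3) / (2 * root_factor p x)) (at x)"
      using DERIV_minus[OF root_factor_deriv[OF p x(1) x1]] by simp
    then show "(g has_real_derivative g' x) (at x)"
      unfolding g_def g'_def by (intro DERIV_cmult DERIV_add angle_deriv x x1)
    let ?D = "(p - 2) / 2 * (x powr (p / 2 - 2) / root_factor p x)"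
    have D: "?D \<ge> 0" using root_factor_nonneg[OF p, of x] x x1 p by simp
    define y where "y = x powr (p / 2 - 1) / h"
    have y: "0 < y" using x h by (simp add: y_def)
    have "x powr (3 - p / 2) = s powr (3 - p / 2) * y powr \<sigma>"
    proof -
      have "(p / 2 - 1) * \<sigma> = 3 - p / 2" using p by (simp add: \<sigma>_def field_simps)
      then show ?thesis using x s by (simp add: y_def h_def powr_divide powr_powr)
    qed
    also have "\<dots> \<le> s powr (3 - p / 2) * (1 - \<sigma> * (1 - y))"
      by (intro mult_left_mono powr_le_chord \<sigma> y) auto
    finally have "2 / (p - 2) * x powr (3 - p / 2) * ?D \<le> K * (1 - \<sigma> * (1 - y)) * ?D"
      unfolding K_def mult.assoc[of "2 / (p - 2)"] using p by (intro mult_right_mono[OF _ D] mult_left_mono) auto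
    also have "\<dots> = K * ((1 - \<sigma>) * ?D + \<sigma> / h * (x powr (p / 2 - 1) * ?D))"
    proof -
      have "K * (1 - \<sigma> * (1 - y)) * d = K * ((1 - \<sigma>) * d + \<sigma> / h * (x powr (p / 2 - 1) * d))" for d
        by (simp add: y_def algebra_simps)
      then show ?thesis .
    qed
    also have "x powr (p / 2 - 1) * ?D = (p - 2) * x powr (p - 3) / (2 * root_factor p x)"
    proof -
      have "x powr (p / 2 - 1) * x powr (p / 2 - 2) = x powr (p - 3)" by (simp add: powr_add[symmetric])
      then show ?thesis by simp
    qed
    finally show "x / root_factor p x \<le> g' x" unfolding integrand[OF x(1)] g'_def .
  qed (use s in auto)
  also have "g s - g 0 = K * ((1 - \<sigma>) * angle p s + \<sigma> * ((1 - root_factor p s) / h))"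
    by (simp add: g_def p angle_def algebra_simps diff_divide_distrib)
  finally show "tail_mass p s \<le> K * ((1 - \<sigma>) * angle p s + \<sigma> * ((1 - root_factor p s) / s powr (p / 2 - 1)))"
    by (simp add: h_def p)
  have "K * angle p 1 - K * angle p s \<le> tail_mass p 1 - tail_mass p s"
  proof (rule tail_mass_diff_ge[OF p, where g'="\<lambda>x. K * ((p - 2) / 2 * (x powr (p / 2 - 2) / root_factor p x))"])
    show "continuous_on {s..1} (\<lambda>x. K * angle p x)" using s
      by (intro continuous_intros continuous_on_subset[OF continuous_on_angle]) auto
    fix x assume x: "s < x" "x < 1"
    then have x0: "0 < x" using s by simp
    show "((\<lambda>x. K * angle p x) has_real_derivative K * ((p - 2) / 2 * (x powr (p / 2 - 2) / root_factor p x))) (at x)"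
      by (intro DERIV_cmult angle_deriv x x0)
    have "s powr (3 - p / 2) \<le> x powr (3 - p / 2)" using x s assms by (intro powr_mono2) auto
    then show "K * ((p - 2) / 2 * (x powr (p / 2 - 2) / root_factor p x)) \<le> x / root_factor p x"
      unfolding integrand[OF x0] K_def using p root_factor_nonneg[OF p, of x] x x0
      by (intro mult_right_mono mult_left_mono) auto
  qed (use s in auto)
  then show "K * (pi / 2 - angle p s) \<le> tail_mass p 1 - tail_mass p s"
    by (simp add: angle_def p right_diff_distrib)
qed

end

lemma arctan_minus_pi_third_le:
  assumes "sqrt 3 \<le> T"
  shows "arctan T - pi / 3 \<le> (T - sqrt 3) / 4"
proof -
  have "arctan T - arctan (sqrt 3) \<le> T / 4 - sqrt 3 / 4"
  proof (rule increment_le_increment[where f'="\<lambda>x. inverse (1 + x\<^sup>2)" and g'="\<lambda>x. 1 / 4"])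
    fix x assume "sqrt 3 < x"
    then have "(sqrt 3)\<^sup>2 \<le> x\<^sup>2" by (intro power_mono) auto
    then show "inverse (1 + x\<^sup>2) \<le> 1 / 4" by (simp add: field_simps add_pos_nonneg)
    show "((\<lambda>x. x / 4) has_real_derivative 1 / 4) (at x)" by (auto intro!: derivative_eq_intros)
  qed (use assms in \<open>auto intro!: continuous_intros DERIV_arctan\<close>)
  moreover have "arctan (sqrt 3) = pi / 3"
    by (rule arctan_unique) (auto simp: tan_60 intro: less_trans[of _ 0])
  ultimately show ?thesis by simp
qed

text \<open>The quotient is tan (\<theta> / 2), which grows more slowly than \<theta>.\<close>
lemma angle_minus_tan_half_mono:
  assumes "pi / 3 \<le> \<theta>" "\<theta> \<le> pi / 2"
  shows "pi / 3 - 1 / sqrt 3 \<le> \<theta> - (1 - cos \<theta>) / sin \<theta>"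
proof -
  have sin: "0 < sin x" if "pi / 3 \<le> x" "x \<le> pi / 2" for x
    using that pi_gt_zero by (intro sin_gt_zero) linarith+
  have "(1 - cos \<theta>) / sin \<theta> - (1 - cos (pi / 3)) / sin (pi / 3) \<le> \<theta> - pi / 3"
  proof (rule increment_le_increment[where f'="\<lambda>x. (1 - cos x) / (sin x)\<^sup>2" and g'="\<lambda>x. 1"])
    show "continuous_on {pi / 3..\<theta>} (\<lambda>x. (1 - cos x) / sin x)"
      using sin assms by (intro continuous_intros) force
    fix x assume x: "pi / 3 < x" "x < \<theta>"
    then have s: "sin x > 0" using sin[of x] assms by auto
    have c: "cos x \<ge> 0" "cos x \<le> 1" using x assms by (auto intro!: cos_ge_zero)
    have "((\<lambda>x. (1 - cos x) / sin x) has_real_derivative (sin x * sin x - (1 - cos x) * cos x) / (sin x * sin x)) (at x)"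
      using s by (auto intro!: derivative_eq_intros)
    also have "sin x * sin x - (1 - cos x) * cos x = 1 - cos x"
      using sin_cos_squared_add[of x] by (simp add: power2_eq_square algebra_simps)
    finally show "((\<lambda>x. (1 - cos x) / sin x) has_real_derivative (1 - cos x) / (sin x)\<^sup>2) (at x)"
      by (simp add: power2_eq_square)
    have "(cos x)\<^sup>2 \<le> cos x" using c by (simp add: power2_eq_square mult_left_le)
    then have "1 - cos x \<le> (sin x)\<^sup>2" by (simp add: sin_squared_eq)
    then show "(1 - cos x) / (sin x)\<^sup>2 \<le> 1" using s by simp
  qed (use assms in \<open>auto intro!: continuous_intros\<close>)
  then show ?thesis by (simp add: cos_60 sin_60)
qed

text \<open>With \<theta> the angle at the vertex amplitude, the bounds reduce the claim to
3 * \<theta> - pi \<le> \<sigma> * (\<theta> - tan (\<theta> / 2)) for \<sigma> = (6 - p) / (p - 2). Both sides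
vanish at p = 6, where \<theta> = pi / 3, and the right-hand side has the larger slope in 6 - p.\<close>
lemma three_half_lines_large:
  assumes p4: "4 \<le> p" and p6: "p < 6"
  shows "3 * tail_mass p (vertex_amplitude p 3) \<le> 2 * tail_mass p 1"
proof -
  have p: "2 < p" using p4 by simp
  define s where "s = vertex_amplitude p 3"
  have s: "0 < s" "s < 1" using vertex_amplitude_pos[OF p, of 3] vertex_amplitude_less_1[OF p, of 3] by (auto simp: s_def)
  define \<theta> where "\<theta> = angle p s"
  define \<sigma> where "\<sigma> = (6 - p) / (p - 2)"
  define T where "T = sqrt (18 / p)"
  have r: "root_factor p s = sqrt (p / (18 + p))" using root_factor_vertex[OF p, of 3] by (simp add: s_def)
  have sp: "s powr (p - 2) = 18 / (18 + p)" using vertex_amplitude_powr[OF p, of 3] by (simp add: s_def)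
  have "s powr (p / 2 - 1) = sqrt (s powr (p - 2))" using s by (simp add: powr_half_sqrt_powr[symmetric] diff_divide_distrib)
  then have h: "s powr (p / 2 - 1) = sqrt (18 / (18 + p))" by (simp add: sp)
  have cos: "cos \<theta> = root_factor p s"
    unfolding \<theta>_def angle_def using root_factor_nonneg[OF p, of s] root_factor_le_1[OF p, of s] s
    by (intro cos_arccos) auto
  have th: "0 \<le> \<theta>" "\<theta> < pi / 2"
    unfolding \<theta>_def angle_def using root_factor_pos[OF p, of s] root_factor_le_1[OF p, of s] s
    by (auto intro!: arccos_lbound arccos_less_arccos[of 0, simplified])
  have "sin \<theta> = sqrt (1 - (root_factor p s)\<^sup>2)"
    unfolding \<theta>_def angle_def using root_factor_nonneg[OF p, of s] root_factor_le_1[OF p, of s] s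
    by (intro sin_arccos) auto
  also have "\<dots> = s powr (p / 2 - 1)" using root_factor_sq[OF p, of s] s by (simp add: h sp)
  finally have sin: "sin \<theta> = s powr (p / 2 - 1)" .
  have "tan \<theta> = T"
  proof -
    have "18 / a / (p / a) = 18 / p" if "a \<noteq> 0" for a using that by simp
    from this[of "18 + p"] p have "18 / (18 + p) / (p / (18 + p)) = 18 / p" by linarith
    then show ?thesis unfolding tan_def sin cos h r T_def real_sqrt_divide[symmetric] by simp
  qed
  then have arc: "arctan T = \<theta>" using th by (intro arctan_unique) auto
  have T3: "sqrt 3 \<le> T" unfolding T_def using assms by (intro real_sqrt_le_mono) (simp add: field_simps)
  have th3: "pi / 3 \<le> \<theta>" 
  proof -
    have "arctan (sqrt 3) = pi / 3" by (rule arctan_unique) (auto simp: tan_60 intro: less_trans[of _ 0])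
    then show ?thesis using arctan_le_iff[of "sqrt 3" T] T3 arc by simp
  qed
  \<comment> \<open>the value at pi / 3 is pi / 3 - sqrt 3 / 3, about 0.470, against sqrt 3 / 4, about 0.433\<close>
  have half: "sqrt 3 / 4 \<le> \<theta> - (1 - cos \<theta>) / sin \<theta>"
  proof -
    have "sqrt 3 \<le> 1.7321" by (rule real_le_lsqrt) (auto simp: power2_eq_square)
    then have "sqrt 3 / 4 \<le> pi / 3 - sqrt 3 / 3" using pi_approx(1) by simp
    also have "sqrt 3 / 3 = 1 / sqrt 3" by (simp add: real_div_sqrt field_simps)
    also have "pi / 3 - 1 / sqrt 3 \<le> \<theta> - (1 - cos \<theta>) / sin \<theta>"
      using th3 th by (intro angle_minus_tan_half_mono) auto
    finally show ?thesis .
  qed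
  have "3 * \<theta> - pi \<le> \<sigma> * (sqrt 3 / 4)"
  proof -
    \<comment> \<open>normalised such that p = 6 corresponds to \<tau> = 1\<close>
    define \<tau> where "\<tau> = T / sqrt 3"
    have \<tau>: "1 \<le> \<tau>" using T3 by (simp add: \<tau>_def)
    have T\<tau>: "T = sqrt 3 * \<tau>" by (simp add: \<tau>_def)
    have "3 * \<tau>\<^sup>2 = 18 / p" using p by (simp add: \<tau>_def T_def power_divide)
    then have p\<tau>: "p * \<tau>\<^sup>2 = 6" using p by (simp add: field_simps)
    have "\<tau> - 1 \<le> \<sigma> / 3"
    proof -
      have "\<tau>\<^sup>2 \<ge> 1" using \<tau> by (simp add: power_mono)
      have "(\<tau> - 1) * (6 - 2 * \<tau>\<^sup>2) \<le> (\<tau> - 1) * (4 * (\<tau> + 1) / 2)"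
      proof (rule mult_left_mono)
        show "6 - 2 * \<tau>\<^sup>2 \<le> 4 * (\<tau> + 1) / 2" using \<tau> \<open>\<tau>\<^sup>2 \<ge> 1\<close> by argo
      qed (use \<tau> in simp)
      also have "\<dots> = 2 * (\<tau>\<^sup>2 - 1)" by (simp add: field_simps power2_eq_square)
      finally have "(\<tau> - 1) * (p * \<tau>\<^sup>2 - 2 * \<tau>\<^sup>2) \<le> (p * \<tau>\<^sup>2 * \<tau>\<^sup>2 - p * \<tau>\<^sup>2) / 3"
        by (simp add: p\<tau>)
      then have "(3 * (\<tau> - 1) * (p - 2)) * \<tau>\<^sup>2 \<le> (p * \<tau>\<^sup>2 - p) * \<tau>\<^sup>2" by (simp add: algebra_simps)
      then have "3 * (\<tau> - 1) * (p - 2) \<le> 6 - p"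
        using \<open>\<tau>\<^sup>2 \<ge> 1\<close> \<tau> by (subst (asm) mult_le_cancel_right) (auto simp: p\<tau>)
      then show ?thesis using p by (simp add: \<sigma>_def field_simps)
    qed
    then have "sqrt 3 * (\<tau> - 1) * 3 / 4 \<le> sqrt 3 * (\<sigma> / 3) * 3 / 4"
      by (intro divide_right_mono mult_right_mono mult_left_mono) auto
    moreover have "3 * \<theta> - pi \<le> sqrt 3 * (\<tau> - 1) * 3 / 4"
      using arctan_minus_pi_third_le[OF T3, unfolded arc] by (simp add: T\<tau> algebra_simps)
    moreover have "sqrt 3 * (\<sigma> / 3) * 3 / 4 = \<sigma> * (sqrt 3 / 4)" by simp
    ultimately show ?thesis by linarith
  qed
  also have "\<dots> \<le> \<sigma> * (\<theta> - (1 - cos \<theta>) / sin \<theta>)"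
    using half p6 p by (intro mult_left_mono) (auto simp: \<sigma>_def)
  finally have key: "(1 - \<sigma>) * \<theta> + \<sigma> * ((1 - cos \<theta>) / sin \<theta>) \<le> 2 * (pi / 2 - \<theta>)"
    by (simp add: algebra_simps)
  define K where "K = 2 / (p - 2) * s powr (3 - p / 2)"
  have "K \<ge> 0" using p by (simp add: K_def)
  have "tail_mass p s \<le> K * ((1 - \<sigma>) * \<theta> + \<sigma> * ((1 - cos \<theta>) / sin \<theta>))"
    using tail_mass_bounds_angle(1)[OF p p4 p6 s] by (simp add: K_def \<sigma>_def \<theta>_def[symmetric] cos sin)
  also have "\<dots> \<le> K * (2 * (pi / 2 - \<theta>))" by (intro mult_left_mono key \<open>K \<ge> 0\<close>)
  also have "\<dots> = 2 * (K * (pi / 2 - \<theta>))" by simp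
  also have "\<dots> \<le> 2 * (tail_mass p 1 - tail_mass p s)"
    using tail_mass_bounds_angle(2)[OF p p4 p6 s] unfolding K_def \<theta>_def by (rule mult_left_mono) simp
  finally show ?thesis by (simp add: s_def)
qed

text \<open>Below s the integrand is at most t / root_factor p s, so the truncated mass is of the order
of s^2 = r powr (2 / (p - 2)) with r bounded away from 1, and this tends to 0.\<close>
lemma eventually_many_half_lines:
  fixes N :: real
  assumes N: "N > 0"
  shows "\<forall>\<^sub>F p in at_right 2. N * tail_mass p (vertex_amplitude p N) \<le> 2 * tail_mass p 1"
proof -
  \<comment> \<open>the formulas for s powr (p - 2) and root_factor p s at p = 2, which bound them for p > 2\<close>
  define \<rho> where "\<rho> = 2 * N\<^sup>2 / (2 * N\<^sup>2 + 2)"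
  have \<rho>: "0 < \<rho>" "\<rho> < 1" using N by (auto simp: \<rho>_def divide_less_eq_1 add_pos_pos intro!: divide_pos_pos)
  define \<omega> where "\<omega> = sqrt (2 / (2 * N\<^sup>2 + 2))"
  have \<omega>: "\<omega> > 0" unfolding \<omega>_def using N by (simp add: add_pos_pos)
  have "((\<lambda>p. \<rho> powr (2 / (p - 2))) \<longlongrightarrow> 0) (at_right 2)" using \<rho> by real_asymp
  then have "\<forall>\<^sub>F p in at_right 2. \<rho> powr (2 / (p - 2)) < 2 * \<omega> / N"
    using \<omega> N by (intro order_tendstoD(2)) auto
  moreover have "\<forall>\<^sub>F p in at_right 2. p \<in> {2<..<(3::real)}"
    by (rule eventually_at_right_real) simp
  ultimately show ?thesis
  proof eventually_elim
    case (elim p)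
    then have p: "2 < p" "p < 3" by auto
    define s where "s = vertex_amplitude p N"
    have s: "0 < s" "s < 1" using vertex_amplitude_pos[OF p(1) N] vertex_amplitude_less_1[OF p(1) N] by (auto simp: s_def)
    define W where "W = root_factor p s"
    have W: "W \<ge> \<omega>" unfolding W_def s_def root_factor_vertex[OF p(1) N] \<omega>_def
      using p N by (intro real_sqrt_le_mono) (simp add: field_simps add_pos_pos)
    have "tail_mass p s - tail_mass p 0 \<le> s\<^sup>2 / 2 / W - 0\<^sup>2 / 2 / W"
    proof (rule tail_mass_diff_le[OF p(1), where g'="\<lambda>t. t / W"])
      fix x assume x: "0 < x" "x < s"
      show "((\<lambda>x. x\<^sup>2 / 2 / W) has_real_derivative x / W) (at x)" 
        using \<omega> W by (auto intro!: derivative_eq_intros)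
      have "W \<le> root_factor p x" unfolding W_def root_factor_def
        using x s p by (intro real_sqrt_le_mono diff_left_mono powr_mono2) auto
      then show "x / root_factor p x \<le> x / W" using x \<omega> W by (intro divide_left_mono) auto
    qed (use s \<omega> W in \<open>auto intro!: continuous_intros\<close>)
    then have "tail_mass p s \<le> s\<^sup>2 / 2 / W" using p by simp
    also have "\<dots> \<le> s\<^sup>2 / 2 / \<omega>" using \<omega> W by (intro divide_left_mono) auto
    also have "s\<^sup>2 = (2 * N\<^sup>2 / (2 * N\<^sup>2 + p)) powr (2 / (p - 2))"
      using s powr_realpow[of s 2] by (simp add: s_def vertex_amplitude_def powr_powr)
    also have "\<dots> / 2 / \<omega> \<le> \<rho> powr (2 / (p - 2)) / 2 / \<omega>"
      unfolding \<rho>_def using \<omega> p N by (intro divide_right_mono powr_mono2 divide_left_mono) (auto intro!: add_pos_pos mult_pos_pos)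
    also have "\<dots> \<le> (2 * \<omega> / N) / 2 / \<omega>" using elim \<omega> by (intro divide_right_mono) auto
    also have "\<dots> = 1 / N" using \<omega> by simp
    finally have "N * tail_mass p s \<le> 1" using N by (simp add: field_simps)
    moreover have "1\<^sup>2 / 2 - 0\<^sup>2 / 2 \<le> tail_mass p 1 - tail_mass p 0"
    proof (rule tail_mass_diff_ge[OF p(1), where g'="\<lambda>t. t"])
      fix x :: real assume x: "0 < x" "x < 1"
      show "((\<lambda>x. x\<^sup>2 / 2) has_real_derivative x) (at x)" by (auto intro!: derivative_eq_intros)
      have "x / 1 \<le> x / root_factor p x" 
        using x root_factor_le_1[OF p(1), of x] root_factor_pos[OF p(1), of x] by (intro divide_left_mono) auto
      then show "x \<le> x / root_factor p x" by simp
    qed (auto intro!: continuous_intros)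
    ultimately show ?case using p by (simp add: s_def)
  qed
qed

section \<open>Functions in the Sobolev space of a half-line\<close>

lemma pos_part_square_deriv:
  "((\<lambda>t::real. (max 0 t)\<^sup>2) has_real_derivative 2 * max 0 t) (at t)"
proof -
  consider "t < 0" | "t > 0" | "t = 0" by linarith
  then show ?thesis
  proof cases
    case 1
    have "((\<lambda>t::real. (max 0 t)\<^sup>2) has_real_derivative 0) (at t)"
      by (rule has_field_derivative_transform_within_open[of "\<lambda>_. 0" _ _ "{..<0}"]) (use 1 in auto)
    then show ?thesis using 1 by simp
  next
    case 2
    have "((\<lambda>t::real. (max 0 t)\<^sup>2) has_real_derivative 2 * t) (at t)"
      by (rule has_field_derivative_transform_within_open[of "\<lambda>t. t\<^sup>2" _ _ "{0<..}"])
         (use 2 in \<open>auto intro!: derivative_eq_intros\<close>)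
    then show ?thesis using 2 by simp
  next
    case 3
    have "(\<lambda>h::real. (max 0 h)\<^sup>2 / h) \<midarrow>0\<rightarrow> 0"
    proof (rule Lim_null_comparison)
      show "\<forall>\<^sub>F h::real in at 0. norm ((max 0 h)\<^sup>2 / h) \<le> \<bar>h\<bar>"
        by (auto simp: max_def power2_eq_square)
      show "(\<lambda>h::real. \<bar>h\<bar>) \<midarrow>0\<rightarrow> 0" by (rule tendsto_rabs_zero) simp
    qed
    then show ?thesis using 3 by (simp add: DERIV_def)
  qed
qed

text \<open>The B-spline of degree 1 with support in the interval from 0 to 2 and integral 1.\<close>
definition hat :: "real \<Rightarrow> real" where
  "hat t = max 0 t - 2 * max 0 (t - 1) + max 0 (t - 2)"

text \<open>The primitive of hat, a C^1 transition from 0 to 1. In this form its derivative follows from that of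
a single truncated square.\<close>
definition smooth_step :: "real \<Rightarrow> real" where
  "smooth_step t = ((max 0 t)\<^sup>2 - 2 * (max 0 (t - 1))\<^sup>2 + (max 0 (t - 2))\<^sup>2) / 2"

lemma smooth_step_deriv: "(smooth_step has_real_derivative hat t) (at t)"
proof -
  have "((\<lambda>t. (max 0 (t - c))\<^sup>2) has_real_derivative 2 * max 0 (t - c)) (at t)" for c
  proof -
    have "((\<lambda>t. t - c) has_real_derivative 1) (at t)" by (auto intro!: derivative_eq_intros)
    from DERIV_chain2[OF pos_part_square_deriv this] show ?thesis by simp
  qed
  note * = this[of 1] this[of 2] pos_part_square_deriv[of t]
  show ?thesis unfolding smooth_step_def[abs_def] hat_def
    by (rule DERIV_cong, (rule DERIV_cdivide DERIV_add DERIV_diff DERIV_cmult *)+) simp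
qed

lemma hat_nonneg: "0 \<le> hat t" by (simp add: hat_def max_def)
lemma hat_eq_0: "t \<le> 0 \<or> 2 \<le> t \<Longrightarrow> hat t = 0" by (auto simp: hat_def max_def)
lemma smooth_step_eq_0: "t \<le> 0 \<Longrightarrow> smooth_step t = 0" by (simp add: smooth_step_def)
lemma smooth_step_eq_1: "2 \<le> t \<Longrightarrow> smooth_step t = 1"
  by (simp add: smooth_step_def max_def power2_eq_square field_simps)
lemma continuous_on_hat [continuous_intros]: "continuous_on S f \<Longrightarrow> continuous_on S (\<lambda>x. hat (f x))"
  unfolding hat_def by (intro continuous_intros)
lemma smooth_step_mono: "s \<le> t \<Longrightarrow> smooth_step s \<le> smooth_step t"
  by (rule DERIV_nonneg_imp_nondecreasing) (use smooth_step_deriv hat_nonneg in blast)+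
lemma smooth_step_bounds: "0 \<le> smooth_step t" "smooth_step t \<le> 1"
  using smooth_step_mono[of "min t 0" t] smooth_step_mono[of t "max t 2"]
  by (auto simp: smooth_step_eq_0 smooth_step_eq_1)

lemma continuous_on_smooth_step [continuous_intros]: "continuous_on S f \<Longrightarrow> continuous_on S (\<lambda>x. smooth_step (f x))"
  unfolding smooth_step_def by (intro continuous_intros) simp_all

lemma half_line_integral_support:
  fixes f :: "real \<Rightarrow> 'b::euclidean_space"
  assumes "f absolutely_integrable_on {\<alpha>..\<beta>}" "0 < \<alpha>" "\<And>z. z \<notin> {\<alpha>..\<beta>} \<Longrightarrow> f z = 0"
  shows "integrable half_line f" "(LINT x|half_line. f x) = integral {\<alpha>..\<beta>} f"
proof -
  have f: "(\<lambda>z. if z \<in> {\<alpha>..\<beta>} then f z else 0) = f" using assms(3) by force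
  have g: "(\<lambda>z. indicator {0<..} z *\<^sub>R f z) = f" "(\<lambda>z. indicator {\<alpha>..\<beta>} z *\<^sub>R f z) = f" 
    using assms(2,3) by (auto simp: indicator_def fun_eq_iff)
  have "integrable lebesgue f" using assms(1) unfolding set_integrable_def g .
  then show *: "integrable half_line f" by (simp add: integrable_restrict_space g)
  have "(LINT x|half_line. f x) = integral {0<..} f"
    by (rule lebesgue_integral_eq_integral[OF *]) auto
  also have "\<dots> = integral {\<alpha>..\<beta>} f"
    using integral_restrict_Int[of "{0<..}" "{\<alpha>..\<beta>}" f] assms(2) unfolding f
    by (simp add: Int_absorb1 Int_absorb2 subset_eq)
  finally show "(LINT x|half_line. f x) = integral {\<alpha>..\<beta>} f" .
qed

lemma half_line_integral_indicator:
  fixes f :: "real \<Rightarrow> 'b::euclidean_space"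
  assumes f: "f absolutely_integrable_on {a..b}" and a: "0 < a"
  shows "(LINT t|half_line. indicator {a..b} t *\<^sub>R f t) = integral {a..b} f"
proof -
  have "(LINT t|half_line. indicator {a..b} t *\<^sub>R f t) = integral {a..b} (\<lambda>t. indicator {a..b} t *\<^sub>R f t)"
  proof (rule half_line_integral_support(2)[OF _ a])
    show "(\<lambda>t. indicator {a..b} t *\<^sub>R f t) absolutely_integrable_on {a..b}"
      by (subst set_integrable_cong[where f'=f]) (use f in auto)
  qed auto
  also have "\<dots> = integral {a..b} f" by (rule integral_cong) auto
  finally show ?thesis .
qed

lemma half_line_integrable_iff:
  fixes f :: "real \<Rightarrow> 'b::euclidean_space"
  shows "integrable half_line f \<longleftrightarrow> f absolutely_integrable_on {0<..}"
  by (simp add: integrable_restrict_space set_integrable_def)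

lemma half_line_integral:
  fixes f :: "real \<Rightarrow> 'b::euclidean_space"
  shows "integrable half_line f \<Longrightarrow> (LINT x|half_line. f x) = integral {0<..} f"
  by (rule lebesgue_integral_eq_integral) auto

lemma half_line_integrable_Icc:
  fixes f :: "real \<Rightarrow> 'b::euclidean_space"
  assumes "integrable half_line f" "0 < x"
  shows "f absolutely_integrable_on {x..y}"
  using assms unfolding half_line_integrable_iff by (rule_tac set_integrable_subset) auto

lemma half_line_integrable_bound:
  fixes f :: "real \<Rightarrow> 'b::euclidean_space"
  assumes "f \<in> borel_measurable half_line" "integrable half_line g" "\<And>x. 0 < x \<Longrightarrow> norm (f x) \<le> g x"
  shows "integrable half_line f"
  by (rule Bochner_Integration.integrable_bound[OF assms(2,1)])
     (use assms(3) in \<open>auto intro!: AE_I2 order_trans[OF _ abs_ge_self]\<close>)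

lemma L2_half_line_Icc:
  assumes "L2_half_line g" "0 < x"
  shows "g absolutely_integrable_on {x..y}"
proof (rule measurable_bounded_by_integrable_imp_absolutely_integrable)
  show "g \<in> borel_measurable (lebesgue_on {x..y})"
    by (rule measurable_restrict_mono[of _ _ "{0<..}"]) (use assms in \<open>auto simp: L2_half_line_def\<close>)
  have "(\<lambda>x. (norm (g x))\<^sup>2) absolutely_integrable_on {x..y}"
    using assms by (intro half_line_integrable_Icc) (auto simp: L2_half_line_def)
  then show "(\<lambda>x. 1 + (norm (g x))\<^sup>2) integrable_on {x..y}"
    by (intro integrable_add) (auto simp: absolutely_integrable_on_def)
  show "norm (g z) \<le> 1 + (norm (g z))\<^sup>2" for z
    using sum_squares_bound[of 1 "norm (g z)"] norm_ge_zero[of "g z"] by (simp del: norm_ge_zero)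
qed auto

lemma L2_half_line_mult:
  assumes "L2_half_line f" "L2_half_line g"
  shows "integrable half_line (\<lambda>x. norm (f x) * norm (g x))"
proof (rule half_line_integrable_bound[where g="\<lambda>x. (norm (f x))\<^sup>2 + (norm (g x))\<^sup>2"])
  show "norm (norm (f x) * norm (g x)) \<le> (norm (f x))\<^sup>2 + (norm (g x))\<^sup>2" for x
    using sum_squares_bound[of "norm (f x)" "norm (g x)"] by (simp add: mult_ac) (smt (verit) mult_nonneg_nonneg norm_ge_zero)
qed (use assms in \<open>auto simp: L2_half_line_def\<close>)

definition smooth_indicator :: "real \<Rightarrow> real \<Rightarrow> real \<Rightarrow> real \<Rightarrow> real" where
  "smooth_indicator x y h z = smooth_step ((z - x) / h) - smooth_step ((z - y) / h)"

lemma smooth_step_scaled_deriv: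
  assumes "h > 0"
  shows "((\<lambda>z. smooth_step ((z - x) / h)) has_real_derivative hat ((z - x) / h) / h) (at z)"
proof -
  have "((\<lambda>z. (z - x) / h) has_real_derivative 1 / h) (at z)"
    by (intro DERIV_cdivide) (auto intro!: derivative_eq_intros)
  from DERIV_chain2[OF smooth_step_deriv this] show ?thesis by simp
qed

lemma smooth_indicator_deriv:
  assumes "h > 0"
  shows "(smooth_indicator x y h has_real_derivative hat ((z - x) / h) / h - hat ((z - y) / h) / h) (at z)"
  unfolding smooth_indicator_def by (intro DERIV_diff smooth_step_scaled_deriv assms)

lemma smooth_indicator_eq_0:
  assumes "h > 0" "x \<le> y" "z \<notin> {x..y + 2 * h}"
  shows "smooth_indicator x y h z = 0"
proof (cases "z < x")
  case True
  then show ?thesis using assms by (simp add: smooth_indicator_def smooth_step_eq_0 divide_nonpos_nonneg)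
next
  case False
  then have "2 \<le> (z - y) / h" "2 \<le> (z - x) / h" using assms by (auto simp: field_simps)
  then show ?thesis by (simp add: smooth_indicator_def smooth_step_eq_1)
qed

lemma test_function_smooth_indicator:
  assumes "h > 0" "0 < x" "x \<le> y"
  shows "test_function (smooth_indicator x y h)"
  unfolding test_function_def
proof (intro conjI exI[of _ "{x..y + 2 * h}"] allI impI)
  show "smooth_indicator x y h C1_differentiable_on UNIV"
    unfolding C1_differentiable_on_def
    by (intro exI[of _ "\<lambda>z. hat ((z - x) / h) / h - hat ((z - y) / h) / h"] conjI ballI continuous_intros)
       (use assms smooth_indicator_deriv in \<open>auto simp: has_real_derivative_iff_has_vector_derivative\<close>)
qed (use assms smooth_indicator_eq_0 in auto)

text \<open>The rescaled hats form an approximate identity concentrating to the right of x.\<close>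
lemma hat_average:
  fixes u :: "real \<Rightarrow> complex"
  assumes "continuous_on {0..} u" "0 < x" "h > 0"
    and close: "\<And>z. x \<le> z \<Longrightarrow> z \<le> x + 2 * h \<Longrightarrow> norm (u z - u x) \<le> e"
  shows "integrable half_line (\<lambda>z. (hat ((z - x) / h) / h) *\<^sub>R u z)"
    and "norm ((LINT z|half_line. (hat ((z - x) / h) / h) *\<^sub>R u z) - u x) \<le> e"
proof -
  let ?k = "\<lambda>z. hat ((z - x) / h) / h"
  let ?I = "{x..x + 2 * h}"
  have k0: "?k z = 0" if "z \<notin> ?I" for z
  proof -
    have "(z - x) / h \<le> 0 \<or> 2 \<le> (z - x) / h" using that assms by (auto simp: field_simps)
    then show ?thesis by (simp add: hat_eq_0)
  qed
  have cont: "continuous_on ?I (\<lambda>z. ?k z *\<^sub>R u z)"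
    using assms by (intro continuous_intros continuous_on_subset[OF assms(1)]) auto
  note * = half_line_integral_support[OF absolutely_integrable_continuous_real[OF cont] assms(2)]
  show "integrable half_line (\<lambda>z. ?k z *\<^sub>R u z)" using * k0 by simp
  have L: "(LINT z|half_line. ?k z *\<^sub>R u z) = integral ?I (\<lambda>z. ?k z *\<^sub>R u z)" using * k0 by simp
  have "(?k has_integral (smooth_step ((x + 2 * h - x) / h) - smooth_step ((x - x) / h))) ?I"
    using assms by (intro fundamental_theorem_of_calculus)
      (auto simp: has_real_derivative_iff_has_vector_derivative[symmetric] intro: smooth_step_scaled_deriv has_field_derivative_at_within)
  then have k1: "(?k has_integral 1) ?I" using assms by (simp add: smooth_step_eq_0 smooth_step_eq_1)
  have "((\<lambda>z. ?k z *\<^sub>R u x) has_integral 1 *\<^sub>R u x) ?I" by (rule has_integral_scaleR_left[OF k1])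
  then have k2: "(\<lambda>z. ?k z *\<^sub>R u x) integrable_on ?I" "integral ?I (\<lambda>z. ?k z *\<^sub>R u x) = u x" by (auto simp: integral_unique)
  have "(LINT z|half_line. ?k z *\<^sub>R u z) - u x = integral ?I (\<lambda>z. ?k z *\<^sub>R u z) - integral ?I (\<lambda>z. ?k z *\<^sub>R u x)"
    using L k2 by simp
  also have "\<dots> = integral ?I (\<lambda>z. ?k z *\<^sub>R u z - ?k z *\<^sub>R u x)"
    by (rule integral_diff[symmetric]) (use integrable_continuous_real[OF cont] k2 in auto)
  also have "norm \<dots> \<le> integral ?I (\<lambda>z. ?k z * e)"
  proof (rule integral_norm_bound_integral)
    show "(\<lambda>z. ?k z *\<^sub>R u z - ?k z *\<^sub>R u x) integrable_on ?I"
      by (rule integrable_diff) (use integrable_continuous_real[OF cont] k2 in auto)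
    show "(\<lambda>z. ?k z * e) integrable_on ?I" using has_integral_mult_left[OF k1] by blast
    fix z assume z: "z \<in> ?I"
    have "norm (?k z *\<^sub>R u z - ?k z *\<^sub>R u x) = ?k z * norm (u z - u x)"
      using hat_nonneg[of "(z - x) / h"] assms by (simp add: scaleR_diff_right[symmetric])
    also have "\<dots> \<le> ?k z * e"
      using close[of z] z hat_nonneg[of "(z - x) / h"] assms by (intro mult_left_mono) auto
    finally show "norm (?k z *\<^sub>R u z - ?k z *\<^sub>R u x) \<le> ?k z * e" .
  qed
  also have "\<dots> = e" using integral_unique[OF has_integral_mult_left[OF k1, of e]] by simp
  finally show "norm ((LINT z|half_line. ?k z *\<^sub>R u z) - u x) \<le> e" .
qed

lemma hat_average_tendsto:
  fixes u :: "real \<Rightarrow> complex"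
  assumes "continuous_on {0..} u" "0 < x"
  shows "(\<lambda>n. LINT z|half_line. (hat ((z - x) / (1 / Suc n)) / (1 / Suc n)) *\<^sub>R u z) \<longlonglongrightarrow> u x"
proof (rule LIMSEQ_I)
  fix e :: real assume "e > 0"
  have "continuous (at x within {0..}) u" using assms by (simp add: continuous_on_eq_continuous_within)
  then obtain d where d: "d > 0" "\<And>z. z \<in> {0..} \<Longrightarrow> dist z x < d \<Longrightarrow> dist (u z) (u x) < e / 2"
    using \<open>e > 0\<close> unfolding continuous_within_eps_delta by (metis half_gt_zero)
  obtain n0 where n0: "2 / d < real n0" using reals_Archimedean2 by blast
  show "\<exists>no. \<forall>n\<ge>no. norm ((LINT z|half_line. (hat ((z - x) / (1 / Suc n)) / (1 / Suc n)) *\<^sub>R u z) - u x) < e"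
  proof (intro exI[of _ n0] allI impI)
    fix n assume "n0 \<le> n"
    then have "2 / d < real (Suc n)" using n0 by linarith
    then have n: "2 * (1 / real (Suc n)) < d" using d by (simp add: field_simps)
    have "norm ((LINT z|half_line. (hat ((z - x) / (1 / Suc n)) / (1 / Suc n)) *\<^sub>R u z) - u x) \<le> e / 2"
    proof (rule hat_average(2)[OF assms])
      fix z assume "x \<le> z" "z \<le> x + 2 * (1 / real (Suc n))"
      then show "norm (u z - u x) \<le> e / 2"
        using d(2)[of z] n assms by (auto simp: dist_norm)
    qed simp
    then show "norm ((LINT z|half_line. (hat ((z - x) / (1 / Suc n)) / (1 / Suc n)) *\<^sub>R u z) - u x) < e"
      using \<open>e > 0\<close> by linarith
  qed
qed

text \<open>A continuous function with a weak derivative obeys the fundamental theorem of calculus. The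
definition of the weak derivative is applied to smooth approximations of the indicator of the
interval: their derivatives are differences of narrowing hats, which average u near the endpoints,
and dominated convergence handles the other side.\<close>
lemma weak_deriv_integral:
  fixes u :: "real \<Rightarrow> complex"
  assumes u: "continuous_on {0..} u" and g: "has_L2_weak_deriv u g" and xy: "0 < x" "x \<le> y"
  shows "integral {x..y} g = u y - u x"
proof -
  define h where "h n = 1 / real (Suc n)" for n
  have h: "h n > 0" "h n \<le> 1" for n by (auto simp: h_def)
  have L2: "L2_half_line g" using g by (simp add: has_L2_weak_deriv_def)
  have gI: "g absolutely_integrable_on {x..y + 2}" using L2 xy by (intro L2_half_line_Icc) auto
  define G where "G z = indicator {x..y + 2} z *\<^sub>R g z" for z
  have G: "integrable half_line G"
    by (rule half_line_integral_support(1)[where \<alpha>=x and \<beta>="y + 2"])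
       (use gI xy in \<open>auto simp: G_def[abs_def] set_integrable_def indicator_inter_arith[symmetric]\<close>)
  have "(\<lambda>n. LINT z|half_line. smooth_indicator x y (h n) z *\<^sub>R g z)
      \<longlonglongrightarrow> (LINT z|half_line. indicator {x<..y} z *\<^sub>R g z)"
  proof (rule integral_dominated_convergence[where w="\<lambda>z. norm (G z)"])
    have gm: "g \<in> borel_measurable half_line" using L2 by (simp add: L2_half_line_def)
    have "smooth_indicator x y (h n) \<in> borel_measurable half_line" for n
      unfolding smooth_indicator_def using h[of n]
      by (intro continuous_imp_measurable_on_sets_lebesgue continuous_intros) auto
    then show "(\<lambda>z. smooth_indicator x y (h n) z *\<^sub>R g z) \<in> borel_measurable half_line" for n
      using gm by (intro borel_measurable_scaleR)
    show "(\<lambda>z. indicator {x<..y} z *\<^sub>R g z) \<in> borel_measurable half_line"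
      using gm xy by (intro borel_measurable_scaleR borel_measurable_indicator) (auto simp: sets_restrict_space_iff)
    show "integrable half_line (\<lambda>z. norm (G z))" using G by (rule integrable_norm)
    have b: "norm (smooth_indicator x y (h n) z *\<^sub>R g z) \<le> norm (G z)" for n z
    proof (cases "z \<in> {x..y + 2 * h n}")
      case True
      have "\<bar>smooth_indicator x y (h n) z\<bar> \<le> 1"
        using smooth_step_bounds[of "(z - x) / h n"] smooth_step_bounds[of "(z - y) / h n"]
        by (auto simp: smooth_indicator_def)
      then show ?thesis using True h[of n] by (auto simp: G_def indicator_def mult_left_le_one_le)
    next
      case False
      then show ?thesis using smooth_indicator_eq_0[OF h(1) xy(2)] by simp
    qed
    then show "AE z in half_line. norm (smooth_indicator x y (h n) z *\<^sub>R g z) \<le> norm (G z)" for n by simp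
    have step: "(\<lambda>n. smooth_step ((z - c) / h n)) \<longlonglongrightarrow> indicator {c<..} z" for z c :: real
    proof (cases "c < z")
      case True
      obtain n0 where n0: "2 / (z - c) < real n0" using reals_Archimedean2 by blast
      have "\<forall>\<^sub>F n in sequentially. smooth_step ((z - c) / h n) = 1"
        using eventually_ge_at_top[of n0]
      proof eventually_elim
        case (elim n)
        then have "2 / (z - c) < real (Suc n)" using n0 by linarith
        then show ?case using True by (intro smooth_step_eq_1) (simp add: h_def field_simps)
      qed
      then show ?thesis using True by (simp add: tendsto_eventually)
    next
      case False
      then have "smooth_step ((z - c) / h n) = 0" for n using h[of n] by (intro smooth_step_eq_0) (simp add: divide_nonpos_pos)
      then show ?thesis using False by simp
    qed
    have "(\<lambda>n. smooth_indicator x y (h n) z *\<^sub>R g z) \<longlonglongrightarrow> (indicator {x<..} z - indicator {y<..} z) *\<^sub>R g z" for z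
      unfolding smooth_indicator_def by (intro tendsto_intros step)
    moreover have "indicator {x<..} z - indicator {y<..} z = (indicator {x<..y} z :: real)" for z
      using xy by (auto simp: indicator_def)
    ultimately show "AE z in half_line. (\<lambda>n. smooth_indicator x y (h n) z *\<^sub>R g z) \<longlonglongrightarrow> indicator {x<..y} z *\<^sub>R g z"
      by simp
  qed
  moreover have "(LINT z|half_line. indicator {x<..y} z *\<^sub>R g z) = integral {x..y} g"
  proof -
    have gI': "g absolutely_integrable_on {x..y}" using L2 xy by (intro L2_half_line_Icc) auto
    have "(LINT z|half_line. indicator {x<..y} z *\<^sub>R g z) = (LINT z|half_line. indicator {x..y} z *\<^sub>R g z)"
    proof (rule Bochner_Integration.integral_cong_AE)
      have gm: "g \<in> borel_measurable half_line" using L2 by (simp add: L2_half_line_def)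
      show "(\<lambda>z. indicator {x<..y} z *\<^sub>R g z) \<in> borel_measurable half_line"
           "(\<lambda>z. indicator {x..y} z *\<^sub>R g z) \<in> borel_measurable half_line"
        using gm xy by (auto intro!: borel_measurable_scaleR borel_measurable_indicator simp: sets_restrict_space_iff)
      have "AE z in lebesgue. z \<noteq> x" by (rule AE_completion[OF AE_lborel_singleton])
      then have "AE z in half_line. z \<noteq> x" by (subst AE_restrict_space_iff) auto
      then show "AE z in half_line. indicator {x<..y} z *\<^sub>R g z = indicator {x..y} z *\<^sub>R g z"
        by eventually_elim (auto simp: indicator_def)
    qed
    also have "\<dots> = integral {x..y} g"
      by (rule half_line_integral_indicator[OF gI' xy(1)])
    finally show ?thesis .
  qed
  ultimately have lim1: "(\<lambda>n. LINT z|half_line. smooth_indicator x y (h n) z *\<^sub>R g z) \<longlonglongrightarrow> integral {x..y} g" by simp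
  have "(\<lambda>n. (LINT z|half_line. (hat ((z - x) / h n) / h n) *\<^sub>R u z) - (LINT z|half_line. (hat ((z - y) / h n) / h n) *\<^sub>R u z)) \<longlonglongrightarrow> u x - u y"
    unfolding h_def using xy by (intro tendsto_diff hat_average_tendsto u) auto
  moreover have "(LINT z|half_line. (hat ((z - x) / h n) / h n) *\<^sub>R u z) - (LINT z|half_line. (hat ((z - y) / h n) / h n) *\<^sub>R u z)
     = - (LINT z|half_line. smooth_indicator x y (h n) z *\<^sub>R g z)" for n
  proof -
    have int: "integrable half_line (\<lambda>z. (hat ((z - c) / h n) / h n) *\<^sub>R u z)" if "c > 0" for c
    proof -
      have "compact (u ` {c..c + 2 * h n})"
        using that by (intro compact_continuous_image continuous_on_subset[OF u]) auto
      then obtain M where "\<And>z. z \<in> {c..c + 2 * h n} \<Longrightarrow> norm (u z) \<le> M"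
        by (meson bounded_iff compact_imp_bounded imageI)
      then have "norm (u z - u c) \<le> M + norm (u c)" if "c \<le> z" "z \<le> c + 2 * h n" for z
        using that norm_triangle_ineq4[of "u z" "u c"] by (smt (verit) atLeastAtMost_iff)
      then show ?thesis by (intro hat_average(1)[OF u that h(1)])
    qed
    have "(LINT z|half_line. (hat ((z - x) / h n) / h n) *\<^sub>R u z) - (LINT z|half_line. (hat ((z - y) / h n) / h n) *\<^sub>R u z)
      = (LINT z|half_line. (hat ((z - x) / h n) / h n) *\<^sub>R u z - (hat ((z - y) / h n) / h n) *\<^sub>R u z)"
      using xy by (intro Bochner_Integration.integral_diff[symmetric] int) auto
    also have "\<dots> = (LINT z|half_line. deriv (smooth_indicator x y (h n)) z *\<^sub>R u z)"
      using DERIV_imp_deriv[OF smooth_indicator_deriv[OF h(1)]] by (simp add: scaleR_diff_left)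
    also have "\<dots> = - (LINT z|half_line. smooth_indicator x y (h n) z *\<^sub>R g z)"
      using g test_function_smooth_indicator[OF h(1) xy] by (simp add: has_L2_weak_deriv_def)
    finally show ?thesis .
  qed
  ultimately have "(\<lambda>n. - (LINT z|half_line. smooth_indicator x y (h n) z *\<^sub>R g z)) \<longlonglongrightarrow> u x - u y" by simp
  from LIMSEQ_unique[OF this tendsto_minus[OF lim1]] show ?thesis by (simp add: algebra_simps)
qed

text \<open>The intervals generate the Borel sets and are stable under intersection, so the integral
vanishes over every measurable set.\<close>
lemma AE_0_if_Icc_integrals_0:
  fixes h :: "real \<Rightarrow> complex"
  assumes int: "\<And>x y. 0 < x \<Longrightarrow> h absolutely_integrable_on {x..y}"
    and 0: "\<And>x y. 0 < x \<Longrightarrow> x \<le> y \<Longrightarrow> integral {x..y} h = 0"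
  shows "AE x in half_line. h x = 0"
proof -
  have Icc: "AE x in lebesgue_on {a..b}. h x = 0" if ab: "0 < a" for a b
  proof -
    let ?M = "lebesgue_on {a..b}"
    interpret finite_measure ?M by (rule finite_measure_lebesgue_on) auto
    have hM: "integrable ?M h"
      using int[OF ab, of b] by (simp add: integrable_restrict_space set_integrable_def)
    have restr: "{a..b} \<inter> A \<in> sets ?M" if "A \<in> sets borel" for A
      using that by (auto simp: sets_restrict_space)
    have borel: "set_lebesgue_integral ?M ({a..b} \<inter> A) h = 0" if "A \<in> sets borel" for A
      using that
    proof (induction rule: borel_set_induct)
      case empty then show ?case by (simp add: set_lebesgue_integral_def)
    next
      case (interval c d)
      have "set_lebesgue_integral ?M ({a..b} \<inter> {c..d}) h = integral ({a..b} \<inter> {c..d}) h"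
      proof -
        have "set_lebesgue_integral ?M ({a..b} \<inter> {c..d}) h = set_lebesgue_integral lebesgue ({a..b} \<inter> {c..d}) h"
          by (subst set_integral_restrict_space, simp, rule set_lebesgue_integral_cong) (auto simp del: Int_atLeastAtMost)
        also have "\<dots> = integral ({a..b} \<inter> {c..d}) h"
          using int[of "max a c" "min b d"] ab by (intro set_lebesgue_integral_eq_integral(2)) (simp add: Int_atLeastAtMost)
        finally show ?thesis .
      qed
      also have "\<dots> = 0"
        using 0[of "max a c" "min b d"] ab by (cases "max a c \<le> min b d") (auto simp: Int_atLeastAtMost)
      finally show ?case .
    next
      case (compl A)
      have UN: "{a..b} \<inter> A \<union> {a..b} \<inter> - A = {a..b}" by auto
      have "set_lebesgue_integral ?M ({a..b} \<inter> A \<union> {a..b} \<inter> - A) h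
        = set_lebesgue_integral ?M ({a..b} \<inter> A) h + set_lebesgue_integral ?M ({a..b} \<inter> - A) h"
      proof (rule set_integral_Un)
        show "set_integrable ?M ({a..b} \<inter> A) h" "set_integrable ?M ({a..b} \<inter> - A) h"
          unfolding set_integrable_def using compl(1) by (intro integrable_mult_indicator[OF _ hM] restr; simp)+
      qed auto
      moreover have "set_lebesgue_integral ?M {a..b} h = 0"
      proof -
        have "set_lebesgue_integral ?M {a..b} h = (LINT x|?M. h x)"
          unfolding set_lebesgue_integral_def by (rule Bochner_Integration.integral_cong) auto
        also have "\<dots> = integral {a..b} h" by (rule lebesgue_integral_eq_integral[OF hM]) auto
        also have "\<dots> = 0" using 0[OF ab, of b] by (cases "a \<le> b") auto
        finally show ?thesis .
      qed
      ultimately show ?case using compl.IH unfolding UN by simp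
    next
      case (union f)
      have "set_lebesgue_integral ?M (\<Union>i. {a..b} \<inter> f i) h = (\<Sum>i. set_lebesgue_integral ?M ({a..b} \<inter> f i) h)"
      proof (rule lebesgue_integral_countable_add)
        show "{a..b} \<inter> f i \<in> sets ?M" for i by (rule restr[OF union(2)])
        show "({a..b} \<inter> f i) \<inter> ({a..b} \<inter> f j) = {}" if "i \<noteq> j" for i j
          using union(1) that unfolding disjoint_family_on_def by blast
        have "{a..b} \<inter> (\<Union>i. f i) \<in> sets ?M" by (rule restr) (use union(2) in blast)
        then show "set_integrable ?M (\<Union>i. {a..b} \<inter> f i) h"
          unfolding set_integrable_def Int_UN_distrib by (rule integrable_mult_indicator[OF _ hM])
      qed
      then show ?case using union.IH by simp
    qed
    show ?thesis
    proof (rule density_zero[OF hM])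
      fix A assume "A \<in> sets ?M"
      then have A: "A \<subseteq> {a..b}" "A \<in> sets lebesgue" by (auto simp: sets_restrict_space)
      then obtain S N N' where S: "A = S \<union> N" "N \<subseteq> N'" "N' \<in> null_sets lborel" "S \<in> sets lborel"
        using sets_completionE[of A lborel] by blast
      have "AE x in lebesgue. x \<notin> N'" using S(3) by (intro AE_completion AE_not_in)
      then have "AE x in ?M. x \<notin> N'" by (subst AE_restrict_space_iff) auto
      moreover have "AE x in ?M. x \<in> {a..b}" by (auto simp: AE_restrict_space_iff)
      ultimately have "AE x in ?M. x \<in> {a..b} \<inter> S \<longleftrightarrow> x \<in> A"
        by eventually_elim (use S in auto)
      then have "set_lebesgue_integral ?M A h = set_lebesgue_integral ?M ({a..b} \<inter> S) h"
      proof (intro set_integral_cong_set)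
        show "set_borel_measurable ?M A h" "set_borel_measurable ?M ({a..b} \<inter> S) h"
          unfolding set_borel_measurable_def using \<open>A \<in> sets ?M\<close> S(4)
          by (intro borel_measurable_scaleR borel_measurable_indicator borel_measurable_integrable[OF hM] restr; simp)+
      qed
      then show "set_lebesgue_integral ?M A h = 0" using borel S(4) by simp
    qed
  qed
  have "AE x in lebesgue. \<forall>n::nat. x \<in> {1 / (n + 1)..real (n + 1)} \<longrightarrow> h x = 0"
    unfolding AE_all_countable
  proof
    fix n :: nat
    show "AE x in lebesgue. x \<in> {1 / (n + 1)..real (n + 1)} \<longrightarrow> h x = 0"
    proof -
      have "AE x in lebesgue_on {1 / (n + 1)..real (n + 1)}. h x = 0" by (rule Icc) simp
      then show ?thesis by (subst (asm) AE_restrict_space_iff) auto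
    qed
  qed
  then have "AE x in lebesgue. x \<in> {0<..} \<longrightarrow> h x = 0"
  proof eventually_elim
    case (elim x)
    show ?case
    proof
      assume "x \<in> {0<..}"
      then have x: "x > 0" by simp
      obtain n :: nat where n: "max x (1 / x) < real n" using reals_Archimedean2 by blast
      then have "x \<le> real (n + 1)" "1 / x \<le> real (n + 1)" by auto
      then have "x \<in> {1 / (n + 1)..real (n + 1)}" using x by (simp add: field_simps)
      with elim show "h x = 0" by blast
    qed
  qed
  then show ?thesis by (subst AE_restrict_space_iff) auto
qed

lemma weak_deriv_unique:
  fixes u :: "real \<Rightarrow> complex"
  assumes "continuous_on {0..} u" "has_L2_weak_deriv u f" "has_L2_weak_deriv u g"
  shows "AE x in half_line. f x = g x"
proof -
  have L: "L2_half_line f" "L2_half_line g" using assms by (auto simp: has_L2_weak_deriv_def)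
  have "AE x in half_line. f x - g x = 0"
  proof (rule AE_0_if_Icc_integrals_0)
    fix x y :: real assume x: "0 < x"
    show "(\<lambda>x. f x - g x) absolutely_integrable_on {x..y}"
      by (intro set_integral_diff L2_half_line_Icc L x)
    assume "x \<le> y"
    have "integral {x..y} (\<lambda>x. f x - g x) = integral {x..y} f - integral {x..y} g"
      by (intro integral_diff set_lebesgue_integral_eq_integral(1) L2_half_line_Icc L x)
    then show "integral {x..y} (\<lambda>x. f x - g x) = 0"
      using weak_deriv_integral[OF assms(1,2) x \<open>x \<le> y\<close>] weak_deriv_integral[OF assms(1,3) x \<open>x \<le> y\<close>] by simp
  qed
  then show ?thesis by simp
qed

text \<open>Integration by parts on a compact interval that contains the support of the test function.\<close>
lemma has_L2_weak_derivI:
  fixes u :: "real \<Rightarrow> complex"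
  assumes u: "\<And>z. 0 < z \<Longrightarrow> (u has_vector_derivative u' z) (at z)"
    and u': "continuous_on {0<..} u'" and L2: "L2_half_line u'"
  shows "has_L2_weak_deriv u u'"
  unfolding has_L2_weak_deriv_def
proof (intro conjI allI impI L2)
  fix \<phi> :: "real \<Rightarrow> real" assume "test_function \<phi>"
  then obtain K D where K: "compact K" "K \<subseteq> {0<..}" "\<And>x. x \<notin> K \<Longrightarrow> \<phi> x = 0"
    and D: "\<And>x. (\<phi> has_real_derivative D x) (at x)" "continuous_on UNIV D"
    by (auto simp: test_function_def C1_differentiable_on_def has_real_derivative_iff_has_vector_derivative)
  obtain \<alpha> \<beta> where ab: "0 < \<alpha>" "\<alpha> \<le> \<beta>" "K \<subseteq> {\<alpha><..<\<beta>}"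
  proof (cases "K = {}")
    case True then show ?thesis using that[of 1 2] by simp
  next
    case False
    obtain a b where a: "a \<in> K" "\<And>x. x \<in> K \<Longrightarrow> a \<le> x" and b: "b \<in> K" "\<And>x. x \<in> K \<Longrightarrow> x \<le> b"
      using compact_attains_inf[OF K(1) False] compact_attains_sup[OF K(1) False] by blast
    then have "a > 0" using K(2) by auto
    have "K \<subseteq> {a / 2<..<b + 1}"
    proof
      fix x assume "x \<in> K"
      then have "a \<le> x" "x \<le> b" using a b by auto
      then show "x \<in> {a / 2<..<b + 1}" using \<open>a > 0\<close> by auto
    qed
    moreover have "a / 2 \<le> b + 1" using a(2)[OF b(1)] \<open>a > 0\<close> by linarith
    ultimately show ?thesis using that[of "a / 2" "b + 1"] \<open>a > 0\<close> by auto
  qed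
  have \<phi>0: "\<phi> z = 0" if "z \<notin> {\<alpha><..<\<beta>}" for z using K(3) ab(3) that by blast
  have D0: "D z = 0" if "z \<notin> {\<alpha>..\<beta>}" for z
  proof -
    have "(\<phi> has_real_derivative 0) (at z)"
      by (rule has_field_derivative_transform_within_open[of "\<lambda>_. 0" _ _ "- {\<alpha>..\<beta>}"])
         (use that \<phi>0 in \<open>auto simp: open_Compl\<close>)
    then show ?thesis using D(1) DERIV_unique by blast
  qed
  have cu: "continuous_on {\<alpha>..\<beta>} u"
    by (rule continuous_on_vector_derivative[of _ _ u'])
       (use u ab in \<open>auto intro: has_vector_derivative_at_within\<close>)
  have c\<phi>: "continuous_on {\<alpha>..\<beta>} \<phi>"
    using D(1) by (meson DERIV_continuous_on has_field_derivative_at_within)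
  have cD: "continuous_on {\<alpha>..\<beta>} D" by (rule continuous_on_subset[OF D(2)]) simp
  have cu': "continuous_on {\<alpha>..\<beta>} u'" by (rule continuous_on_subset[OF u']) (use ab in auto)
  have L: "(LINT x|half_line. D x *\<^sub>R u x) = integral {\<alpha>..\<beta>} (\<lambda>x. D x *\<^sub>R u x)"
    by (rule half_line_integral_support(2)[OF absolutely_integrable_continuous_real ab(1)])
       (use D0 in \<open>auto intro!: continuous_intros cu cD\<close>)
  have R: "(LINT x|half_line. \<phi> x *\<^sub>R u' x) = integral {\<alpha>..\<beta>} (\<lambda>x. \<phi> x *\<^sub>R u' x)"
    by (rule half_line_integral_support(2)[OF absolutely_integrable_continuous_real ab(1)])
       (use \<phi>0 in \<open>auto intro!: continuous_intros cu' c\<phi>\<close>)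
  have "((\<lambda>x. \<phi> x *\<^sub>R u' x + D x *\<^sub>R u x) has_integral (\<phi> \<beta> *\<^sub>R u \<beta> - \<phi> \<alpha> *\<^sub>R u \<alpha>)) {\<alpha>..\<beta>}"
    using ab D(1) u
    by (intro fundamental_theorem_of_calculus has_vector_derivative_scaleR)
       (auto intro: has_field_derivative_at_within has_vector_derivative_at_within)
  then have "integral {\<alpha>..\<beta>} (\<lambda>x. \<phi> x *\<^sub>R u' x + D x *\<^sub>R u x) = 0" using \<phi>0 by (simp add: integral_unique)
  also have "integral {\<alpha>..\<beta>} (\<lambda>x. \<phi> x *\<^sub>R u' x + D x *\<^sub>R u x)
     = integral {\<alpha>..\<beta>} (\<lambda>x. \<phi> x *\<^sub>R u' x) + integral {\<alpha>..\<beta>} (\<lambda>x. D x *\<^sub>R u x)"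
    by (intro Henstock_Kurzweil_Integration.integral_add integrable_continuous_real continuous_intros cu cu' c\<phi> cD)
  finally show "(LINT x|half_line. deriv \<phi> x *\<^sub>R u x) = - (LINT x|half_line. \<phi> x *\<^sub>R u' x)"
    using L R DERIV_imp_deriv[OF D(1)] by (simp add: add_eq_0_iff)
qed


text \<open>The chain rule inequality for a function v that is merely continuous with
increments bounded by integrals of h. With \<sigma> + \<epsilon> in place of \<sigma> it holds on short intervals, by the
mean value theorem and the continuity of \<sigma> and v. Under concatenation of intervals the left-hand side
is subadditive and the right-hand side additive, so bisection gives it on the whole interval.\<close>
lemma chain_increment_le:
  fixes v h S \<sigma> :: "real \<Rightarrow> real"
  assumes xy: "x \<le> y" and v: "continuous_on {x..y} v" and h: "h absolutely_integrable_on {x..y}"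
    and h0: "\<And>t. 0 \<le> h t"
    and incr: "\<And>s t. x \<le> s \<Longrightarrow> s \<le> t \<Longrightarrow> t \<le> y \<Longrightarrow> \<bar>v t - v s\<bar> \<le> integral {s..t} h"
    and range: "\<And>t. x \<le> t \<Longrightarrow> t \<le> y \<Longrightarrow> v t \<in> {0..B}"
    and S: "\<And>a. a \<in> {0..B} \<Longrightarrow> (S has_real_derivative \<sigma> a) (at a within {0..B})"
    and \<sigma>: "continuous_on {0..B} \<sigma>" and \<sigma>0: "\<And>a. a \<in> {0..B} \<Longrightarrow> 0 \<le> \<sigma> a"
  shows "(\<lambda>t. h t * \<sigma> (v t)) absolutely_integrable_on {x..y}"
    and "\<bar>S (v y) - S (v x)\<bar> \<le> integral {x..y} (\<lambda>t. h t * \<sigma> (v t))"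
proof -
  have c: "continuous_on {x..y} (\<lambda>t. \<sigma> (v t))"
    by (rule continuous_on_compose2[OF \<sigma> v]) (use range in auto)
  have "bounded ((\<lambda>t. \<sigma> (v t)) ` {x..y})"
    by (intro compact_imp_bounded compact_continuous_image c) simp
  then have "(\<lambda>t. \<sigma> (v t) * h t) absolutely_integrable_on {x..y}"
    by (intro absolutely_integrable_bounded_measurable_product_real h continuous_imp_measurable_on_sets_lebesgue c) auto
  then show hs: "(\<lambda>t. h t * \<sigma> (v t)) absolutely_integrable_on {x..y}" by (simp add: mult.commute)
  have Int: "(\<lambda>t. h t * \<sigma> (v t)) integrable_on {s..t}" "h integrable_on {s..t}" if "x \<le> s" "t \<le> y" for s t
    using that set_lebesgue_integral_eq_integral(1)[OF hs] set_lebesgue_integral_eq_integral(1)[OF h]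
    by (auto intro: integrable_on_subinterval)
  have eps: "\<bar>S (v y) - S (v x)\<bar> \<le> integral {x..y} (\<lambda>t. h t * (\<sigma> (v t) + e))" if "e > 0" for e
  proof -
    have Inte: "(\<lambda>t. h t * (\<sigma> (v t) + e)) integrable_on {s..t}" if "x \<le> s" "t \<le> y" for s t
      using integrable_add[OF Int(1)[OF that] integrable_on_mult_left[OF Int(2)[OF that], of e]]
      by (simp add: distrib_left)
    define P where "P s t \<longleftrightarrow> (x \<le> s \<and> t \<le> y \<longrightarrow> \<bar>S (v t) - S (v s)\<bar> \<le> integral {s..t} (\<lambda>t. h t * (\<sigma> (v t) + e)))" for s t
    have "P x y"
    proof (rule Bolzano[OF xy])
      fix a b c assume *: "P a b" "P b c" "a \<le> b" "b \<le> c"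
      show "P a c" unfolding P_def
      proof safe
        assume ac: "x \<le> a" "c \<le> y"
        then have "\<bar>S (v b) - S (v a)\<bar> \<le> integral {a..b} (\<lambda>t. h t * (\<sigma> (v t) + e))"
          "\<bar>S (v c) - S (v b)\<bar> \<le> integral {b..c} (\<lambda>t. h t * (\<sigma> (v t) + e))"
          using * by (auto simp: P_def)
        moreover have "integral {a..b} (\<lambda>t. h t * (\<sigma> (v t) + e)) + integral {b..c} (\<lambda>t. h t * (\<sigma> (v t) + e))
           = integral {a..c} (\<lambda>t. h t * (\<sigma> (v t) + e))"
          by (rule Henstock_Kurzweil_Integration.integral_combine) (use * ac Inte in auto)
        ultimately show "\<bar>S (v c) - S (v a)\<bar> \<le> integral {a..c} (\<lambda>t. h t * (\<sigma> (v t) + e))" by linarith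
      qed
    next
      fix z assume z: "x \<le> z" "z \<le> y"
      have vz: "v z \<in> {0..B}" using range z by simp
      obtain \<eta> where \<eta>: "\<eta> > 0" "\<And>\<xi>. \<xi> \<in> {0..B} \<Longrightarrow> dist \<xi> (v z) < \<eta> \<Longrightarrow> dist (\<sigma> \<xi>) (\<sigma> (v z)) < e / 2"
        using \<sigma> vz \<open>e > 0\<close> unfolding continuous_on_iff by (metis half_gt_zero)
      obtain d where d: "d > 0" "\<And>t. t \<in> {x..y} \<Longrightarrow> dist t z < d \<Longrightarrow> dist (v t) (v z) < \<eta>"
        using v z \<eta>(1) unfolding continuous_on_iff by (metis atLeastAtMost_iff)
      show "\<exists>d>0. \<forall>a b. a \<le> z \<and> z \<le> b \<and> b - a < d \<longrightarrow> P a b"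
      proof (intro exI[of _ d] conjI allI impI d(1))
        fix s t assume st: "s \<le> z \<and> z \<le> t \<and> t - s < d"
        show "P s t" unfolding P_def
        proof safe
          assume xs: "x \<le> s" "t \<le> y"
          have near: "v \<tau> \<in> {0..B} \<inter> ball (v z) \<eta>" if "\<tau> \<in> {s..t}" for \<tau>
          proof -
            have "dist \<tau> z < d" using that st by (auto simp: dist_real_def)
            then show ?thesis using that st xs d(2)[of \<tau>] range[of \<tau>] by (auto simp: dist_commute)
          qed
          have \<sigma>near: "\<bar>\<sigma> \<xi> - \<sigma> (v z)\<bar> < e / 2" if "\<xi> \<in> {0..B} \<inter> ball (v z) \<eta>" for \<xi>
            using \<eta>(2)[of \<xi>] that by (auto simp: dist_commute dist_real_def abs_minus_commute)
          have "norm (S (v t) - S (v s)) \<le> (\<sigma> (v z) + e / 2) * norm (v t - v s)"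
          proof (rule field_differentiable_bound[where S="{0..B} \<inter> ball (v z) \<eta>" and f'=\<sigma>])
            fix \<xi> assume \<xi>: "\<xi> \<in> {0..B} \<inter> ball (v z) \<eta>"
            show "(S has_field_derivative \<sigma> \<xi>) (at \<xi> within {0..B} \<inter> ball (v z) \<eta>)"
              by (rule DERIV_subset[OF S]) (use \<xi> in auto)
            show "norm (\<sigma> \<xi>) \<le> \<sigma> (v z) + e / 2"
            proof -
              have "0 \<le> \<sigma> \<xi>" using \<sigma>0 \<xi> by blast
              then show ?thesis using \<sigma>near[OF \<xi>] unfolding real_norm_def by linarith
            qed
          qed (use near st in \<open>auto intro!: convex_Int\<close>)
          also have "\<dots> \<le> (\<sigma> (v z) + e / 2) * integral {s..t} h"
            using incr[of s t] st xs \<sigma>0[OF vz] \<open>e > 0\<close> by (intro mult_left_mono) auto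
          also have "\<dots> = integral {s..t} (\<lambda>\<tau>. h \<tau> * (\<sigma> (v z) + e / 2))"
            by (simp add: mult.commute)
          also have "\<dots> \<le> integral {s..t} (\<lambda>\<tau>. h \<tau> * (\<sigma> (v \<tau>) + e))"
          proof (rule integral_le)
            show "(\<lambda>\<tau>. h \<tau> * (\<sigma> (v z) + e / 2)) integrable_on {s..t}"
              using Int(2) xs by (intro integrable_on_mult_left) auto
            show "(\<lambda>\<tau>. h \<tau> * (\<sigma> (v \<tau>) + e)) integrable_on {s..t}" using Inte xs by auto
            fix \<tau> assume "\<tau> \<in> {s..t}"
            then show "h \<tau> * (\<sigma> (v z) + e / 2) \<le> h \<tau> * (\<sigma> (v \<tau>) + e)"
              using \<sigma>near[OF near] by (intro mult_left_mono h0) (smt (verit) field_sum_of_halves)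
          qed
          finally show "\<bar>S (v t) - S (v s)\<bar> \<le> integral {s..t} (\<lambda>t. h t * (\<sigma> (v t) + e))" by simp
        qed
      qed
    qed
    then show ?thesis by (simp add: P_def)
  qed
  show "\<bar>S (v y) - S (v x)\<bar> \<le> integral {x..y} (\<lambda>t. h t * \<sigma> (v t))"
  proof (rule field_le_epsilon)
    fix e :: real assume "e > 0"
    define H where "H = integral {x..y} h"
    have "H \<ge> 0" unfolding H_def by (intro integral_nonneg Int h0) auto
    define e' where "e' = e / (H + 1)"
    have e': "e' > 0" "e' * H \<le> e" using \<open>e > 0\<close> \<open>H \<ge> 0\<close> by (auto simp: e'_def field_simps)
    have "\<bar>S (v y) - S (v x)\<bar> \<le> integral {x..y} (\<lambda>t. h t * \<sigma> (v t) + h t * e')"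
      using eps[OF e'(1)] by (simp add: distrib_left)
    also have "\<dots> = integral {x..y} (\<lambda>t. h t * \<sigma> (v t)) + H * e'"
      unfolding H_def by (subst Henstock_Kurzweil_Integration.integral_add) (auto intro!: Int integrable_on_mult_left)
    finally show "\<bar>S (v y) - S (v x)\<bar> \<le> integral {x..y} (\<lambda>t. h t * \<sigma> (v t)) + e" using e' by (simp add: mult.commute)
  qed
qed

context
  fixes u g :: "real \<Rightarrow> complex"
  assumes cont: "continuous_on {0..} u" and L2u: "L2_half_line u" and wd: "has_L2_weak_deriv u g"
begin

lemma L2_weak: "L2_half_line g" using wd by (simp add: has_L2_weak_deriv_def)

lemma norm_increment_le:
  assumes "0 < s" "s \<le> t"
  shows "\<bar>norm (u t) - norm (u s)\<bar> \<le> integral {s..t} (\<lambda>x. norm (g x))"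
proof -
  have "g absolutely_integrable_on {s..t}" using L2_weak assms(1) by (rule L2_half_line_Icc)
  then have i: "g integrable_on {s..t}" "(\<lambda>x. norm (g x)) integrable_on {s..t}" by (auto simp: absolutely_integrable_on_def)
  have "\<bar>norm (u t) - norm (u s)\<bar> \<le> norm (u t - u s)" by (rule norm_triangle_ineq3)
  also have "u t - u s = integral {s..t} g" using weak_deriv_integral[OF cont wd assms] by simp
  also have "norm \<dots> \<le> integral {s..t} (\<lambda>x. norm (g x))"
    by (rule integral_norm_bound_integral[OF i]) simp
  finally show ?thesis .
qed

lemma chain_half_line:
  assumes xy: "0 < x" "x \<le> y" 
    and range: "\<And>t. x \<le> t \<Longrightarrow> t \<le> y \<Longrightarrow> norm (u t) \<le> B"
    and S: "\<And>a. a \<in> {0..B} \<Longrightarrow> (S has_real_derivative \<sigma> a) (at a within {0..B})"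
    and \<sigma>: "continuous_on {0..B} \<sigma>" and \<sigma>0: "\<And>a. a \<in> {0..B} \<Longrightarrow> 0 \<le> \<sigma> a"
  shows "(\<lambda>t. norm (g t) * \<sigma> (norm (u t))) absolutely_integrable_on {x..y}"
    and "\<bar>S (norm (u y)) - S (norm (u x))\<bar> \<le> integral {x..y} (\<lambda>t. norm (g t) * \<sigma> (norm (u t)))"
proof -
  have v: "continuous_on {x..y} (\<lambda>t. norm (u t))"
    using xy by (intro continuous_intros continuous_on_subset[OF cont]) auto
  have h: "(\<lambda>t. norm (g t)) absolutely_integrable_on {x..y}"
    using L2_half_line_Icc[OF L2_weak xy(1)] by (rule absolutely_integrable_norm[unfolded o_def])
  have 1: "\<bar>norm (u t) - norm (u s)\<bar> \<le> integral {s..t} (\<lambda>x. norm (g x))" if "x \<le> s" "s \<le> t" for s t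
    using that xy by (intro norm_increment_le) auto
  have 2: "norm (u t) \<in> {0..B}" if "x \<le> t" "t \<le> y" for t using range that by simp
  note * = chain_increment_le[OF xy(2) v h norm_ge_zero 1 2 S \<sigma> \<sigma>0]
  show "(\<lambda>t. norm (g t) * \<sigma> (norm (u t))) absolutely_integrable_on {x..y}" by (rule *(1))
  show "\<bar>S (norm (u y)) - S (norm (u x))\<bar> \<le> integral {x..y} (\<lambda>t. norm (g t) * \<sigma> (norm (u t)))" by (rule *(2))
qed

lemma continuous_norm: "continuous_on {0..} (\<lambda>t. norm (u t))"
  by (intro continuous_intros cont)

lemma square_increment_le:
  assumes xy: "0 < x" "x \<le> y"
  shows "\<bar>(norm (u y))\<^sup>2 - (norm (u x))\<^sup>2\<bar> \<le> integral {x..y} (\<lambda>t. (norm (u t))\<^sup>2 + (norm (g t))\<^sup>2)"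
proof -
  have "compact ((\<lambda>t. norm (u t)) ` {x..y})"
    using xy by (intro compact_continuous_image continuous_on_subset[OF continuous_norm]) auto
  then obtain B where "\<forall>r \<in> (\<lambda>t. norm (u t)) ` {x..y}. norm r \<le> B"
    using compact_imp_bounded bounded_iff by metis
  then have B: "norm (u t) \<le> B" if "x \<le> t" "t \<le> y" for t using that by force
  have "0 \<le> B" using B[of x] xy norm_ge_zero[of "u x"] by linarith
  note * = chain_half_line[OF xy B, of "\<lambda>a. a\<^sup>2" "\<lambda>a. 2 * a"]
  have d: "((\<lambda>a. a\<^sup>2) has_real_derivative 2 * a) (at a within {0..B})" for a by (auto intro!: derivative_eq_intros)
  have 1: "(\<lambda>t. norm (g t) * (2 * norm (u t))) absolutely_integrable_on {x..y}"
    "\<bar>(norm (u y))\<^sup>2 - (norm (u x))\<^sup>2\<bar> \<le> integral {x..y} (\<lambda>t. norm (g t) * (2 * norm (u t)))"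
    by (rule *; use d in \<open>auto intro!: continuous_intros\<close>)+
  note 1(2)
  also have "integral {x..y} (\<lambda>t. norm (g t) * (2 * norm (u t))) \<le> integral {x..y} (\<lambda>t. (norm (u t))\<^sup>2 + (norm (g t))\<^sup>2)"
  proof (rule integral_le)
    show "(\<lambda>t. norm (g t) * (2 * norm (u t))) integrable_on {x..y}" using 1(1) by (rule set_lebesgue_integral_eq_integral)
    show "(\<lambda>t. (norm (u t))\<^sup>2 + (norm (g t))\<^sup>2) integrable_on {x..y}"
      using L2u L2_weak xy unfolding L2_half_line_def
      by (intro integrable_add set_lebesgue_integral_eq_integral(1) half_line_integrable_Icc) auto
    show "norm (g t) * (2 * norm (u t)) \<le> (norm (u t))\<^sup>2 + (norm (g t))\<^sup>2" for t
      using sum_squares_bound[of "norm (u t)" "norm (g t)"] by (simp add: mult_ac)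
  qed
  finally show ?thesis .
qed


lemma energy_density_integrable: "integrable half_line (\<lambda>t. (norm (u t))\<^sup>2 + (norm (g t))\<^sup>2)"
  using L2u L2_weak by (auto simp: L2_half_line_def)

text \<open>The square of the modulus at y differs from its values on the interval from y to y + 1 by at
most the integral of \<bar>u\<bar>^2 + \<bar>g\<bar>^2 there; averaging over this interval bounds it by twice that
integral, which tends to 0.\<close>
lemma norm_tendsto_0: "((\<lambda>t. norm (u t)) \<longlongrightarrow> 0) at_top"
proof -
  let ?f = "\<lambda>t. (norm (u t))\<^sup>2 + (norm (g t))\<^sup>2"
  define E where "E y = (LINT t|half_line. indicator {y..y + 1} t *\<^sub>R ?f t)" for y :: real
  have "(E \<longlongrightarrow> (LINT t|half_line. 0)) at_top"
    unfolding E_def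
  proof (rule integral_dominated_convergence_at_top[where w="?f"])
    show "(\<lambda>t. indicator {y..y + 1} t *\<^sub>R ?f t) \<in> borel_measurable half_line" for y :: real
      by (intro borel_measurable_scaleR borel_measurable_integrable[OF energy_density_integrable] measurable_restrict_space1 borel_measurable_indicator) auto
    have "((\<lambda>y. indicator {y..y + 1} t *\<^sub>R ?f t) \<longlongrightarrow> 0) at_top" for t
      by (rule tendsto_eventually) (use eventually_gt_at_top[of t] in eventually_elim, auto)
    then show "AE t in half_line. ((\<lambda>y. indicator {y..y + 1} t *\<^sub>R ?f t) \<longlongrightarrow> 0) at_top" by simp
    show "\<forall>\<^sub>F y in at_top. AE t in half_line. norm (indicator {y..y + 1} t *\<^sub>R ?f t) \<le> ?f t"
      by (intro always_eventually allI AE_I2) (auto simp: indicator_def)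
  qed (use energy_density_integrable in auto)
  then have E0: "(E \<longlongrightarrow> 0) at_top" by simp
  have bound: "(norm (u y))\<^sup>2 \<le> 2 * E y" if y: "0 < y" for y
  proof -
    have fI: "?f absolutely_integrable_on {s..t}" if "0 < s" for s t
      by (rule half_line_integrable_Icc[OF energy_density_integrable that])
    then have fi: "?f integrable_on {s..t}" if "0 < s" for s t
      using that set_lebesgue_integral_eq_integral(1) by blast
    have E: "E y = integral {y..y + 1} ?f"
      unfolding E_def by (rule half_line_integral_indicator[OF fI[OF y] y])
    have pt: "(norm (u y))\<^sup>2 \<le> ?f t + E y" if t: "t \<in> {y..y + 1}" for t
    proof -
      have "(norm (u y))\<^sup>2 \<le> (norm (u t))\<^sup>2 + integral {y..t} ?f"
        using square_increment_le[of y t] y t by auto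
      also have "integral {y..t} ?f \<le> integral {y..y + 1} ?f"
        using t y by (intro integral_subset_le fi) auto
      finally show ?thesis unfolding E by (smt (verit) zero_le_power2)
    qed
    have "((\<lambda>t. E y) has_integral E y) {y..y + 1}" using has_integral_const_real[of "E y" y "y + 1"] by simp
    from has_integral_add[OF integrable_integral[OF fi[OF y]] this]
    have sum: "((\<lambda>t. ?f t + E y) has_integral (E y + E y)) {y..y + 1}" unfolding E[symmetric] .
    have "integral {y..y + 1} (\<lambda>t. (norm (u y))\<^sup>2) \<le> integral {y..y + 1} (\<lambda>t. ?f t + E y)"
      by (rule integral_le) (use pt sum in \<open>auto simp: has_integral_integrable\<close>)
    also have "\<dots> = E y + E y" using sum by (rule integral_unique)
    finally show ?thesis by simp
  qed
  have "((\<lambda>y. (norm (u y))\<^sup>2) \<longlongrightarrow> 0) at_top"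
  proof (rule tendsto_sandwich[of "\<lambda>_. 0" _ _ "\<lambda>y. 2 * E y"])
    show "\<forall>\<^sub>F y in at_top. (norm (u y))\<^sup>2 \<le> 2 * E y"
      using eventually_gt_at_top[of 0] by eventually_elim (rule bound)
    show "((\<lambda>y. 2 * E y) \<longlongrightarrow> 0) at_top" using tendsto_mult_left[OF E0, of 2] by simp
  qed auto
  from tendsto_real_sqrt[OF this] show ?thesis by simp
qed

lemma norm_attains_sup: "\<exists>x0\<ge>0. \<forall>t\<ge>0. norm (u t) \<le> norm (u x0)"
proof (cases "\<exists>x1\<ge>0. u x1 \<noteq> 0")
  case True
  then obtain x1 where x1: "x1 \<ge> 0" "norm (u x1) > 0" by auto
  obtain X where X: "\<And>t. t \<ge> X \<Longrightarrow> norm (u t) < norm (u x1)"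
    using order_tendstoD(2)[OF norm_tendsto_0 x1(2)] by (auto simp: eventually_at_top_linorder)
  have "x1 < X" using X[of x1] by force
  have "\<exists>x0\<in>{0..X}. \<forall>t\<in>{0..X}. norm (u t) \<le> norm (u x0)"
    by (rule continuous_attains_sup) (use \<open>x1 < X\<close> x1 in \<open>auto intro: continuous_on_subset[OF continuous_norm]\<close>)
  then obtain x0 where x0: "x0 \<in> {0..X}" "\<And>t. t \<in> {0..X} \<Longrightarrow> norm (u t) \<le> norm (u x0)" by blast
  have "norm (u t) \<le> norm (u x0)" if "t \<ge> 0" for t
  proof (cases "t \<le> X")
    case False
    then have "norm (u t) < norm (u x1)" using X[of t] by simp
    also have "\<dots> \<le> norm (u x0)" using x0(2)[of x1] x1 \<open>x1 < X\<close> by simp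
    finally show ?thesis by simp
  qed (use x0 that in simp)
  then show ?thesis using x0 by auto
qed auto

lemma power_integrable:
  assumes "2 \<le> p"
  shows "integrable half_line (\<lambda>t. norm (u t) powr p)"
proof -
  obtain x0 where x0: "\<And>t. t \<ge> 0 \<Longrightarrow> norm (u t) \<le> norm (u x0)" using norm_attains_sup by blast
  have um: "u \<in> borel_measurable half_line" using L2u by (simp add: L2_half_line_def)
  show ?thesis
  proof (rule half_line_integrable_bound[where g="\<lambda>t. norm (u x0) powr (p - 2) * (norm (u t))\<^sup>2"])
    show "(\<lambda>t. norm (u t) powr p) \<in> borel_measurable half_line" using um by measurable
    show "integrable half_line (\<lambda>t. norm (u x0) powr (p - 2) * (norm (u t))\<^sup>2)"
      using L2u by (simp add: L2_half_line_def)
    fix t :: real assume "0 < t"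
    have "norm (u t) powr p = norm (u t) powr (p - 2) * norm (u t) powr 2" using powr_add[of "norm (u t)" "p - 2" 2] by (simp del: powr_numeral)
    also have "norm (u t) powr 2 = (norm (u t))\<^sup>2" by (cases "u t = 0") (auto simp: powr_numeral)
    also have "norm (u t) powr (p - 2) * (norm (u t))\<^sup>2 \<le> norm (u x0) powr (p - 2) * (norm (u t))\<^sup>2"
      using x0[of t] \<open>0 < t\<close> assms by (intro mult_right_mono powr_mono2) auto
    finally show "norm (norm (u t) powr p) \<le> norm (u x0) powr (p - 2) * (norm (u t))\<^sup>2" by simp
  qed
qed

lemma norm_tendsto_vertex: "((\<lambda>t. norm (u t)) \<longlongrightarrow> norm (u 0)) (at_right 0)"
proof -
  have "((\<lambda>t. norm (u t)) \<longlongrightarrow> norm (u 0)) (at 0 within {0..})"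
    using continuous_norm by (simp add: continuous_on_def)
  then show ?thesis by (rule tendsto_within_subset) auto
qed

text \<open>The primitive S changes from its value at the vertex to its value at x0, and from there to
S 0 = 0 at infinity, since u decays; the integral pays for both changes. The chain rule is available
only away from the vertex, which is reached in the limit.\<close>
lemma calibration_bound:
  assumes B: "\<And>t. 0 \<le> t \<Longrightarrow> norm (u t) \<le> B"
    and S: "\<And>a. a \<in> {0..B} \<Longrightarrow> (S has_real_derivative \<sigma> a) (at a within {0..B})"
    and \<sigma>: "continuous_on {0..B} \<sigma>" and \<sigma>0: "\<And>a. a \<in> {0..B} \<Longrightarrow> 0 \<le> \<sigma> a"
    and S0: "S 0 = 0" and x0: "0 \<le> x0"
    and int: "integrable half_line (\<lambda>t. norm (g t) * \<sigma> (norm (u t)))"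
  shows "2 * S (norm (u x0)) - S (norm (u 0)) \<le> (LINT t|half_line. norm (g t) * \<sigma> (norm (u t)))"
proof -
  let ?f = "\<lambda>t. norm (g t) * \<sigma> (norm (u t))"
  define I where "I = (LINT t|half_line. ?f t)"
  have f0: "?f t \<ge> 0" if "0 \<le> t" for t using \<sigma>0 B that by simp
  have "B \<ge> 0" using B[of 0] norm_ge_zero[of "u 0"] by linarith
  have Scont: "continuous_on {0..B} S" using S by (rule DERIV_continuous_on)
  have SB: "((\<lambda>t. S (norm (u t))) \<longlongrightarrow> S l) F"
    if "((\<lambda>t. norm (u t)) \<longlongrightarrow> l) F" "l \<in> {0..B}" "\<forall>\<^sub>F t in F. 0 \<le> t" for l F
  proof (rule continuous_on_tendsto_compose[OF Scont that(1,2)])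
    show "\<forall>\<^sub>F t in F. norm (u t) \<in> {0..B}" using that(3) by eventually_elim (use B in auto)
  qed
  have SP: "((\<lambda>t. S (norm (u t))) \<longlongrightarrow> S (norm (u 0))) (at_right 0)"
    by (rule SB[OF norm_tendsto_vertex]) (use B in \<open>auto simp: eventually_at_right_less eventually_at_filter\<close>)
  have core: "2 * S (norm (u x1)) - S (norm (u 0)) \<le> I" if x1: "0 < x1" for x1
  proof -
    have 1: "2 * S (norm (u x1)) - S (norm (u x)) - S (norm (u y)) \<le> I" if xy: "0 < x" "x \<le> x1" "x1 \<le> y" for x y
    proof -
      have a: "\<bar>S (norm (u x1)) - S (norm (u x))\<bar> \<le> integral {x..x1} ?f"
        by (rule chain_half_line(2)[OF xy(1,2) _ S \<sigma> \<sigma>0]) (use B xy in auto)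
      have b: "\<bar>S (norm (u y)) - S (norm (u x1))\<bar> \<le> integral {x1..y} ?f"
        by (rule chain_half_line(2)[OF x1 xy(3) _ S \<sigma> \<sigma>0]) (use B xy in auto)
      have fi: "?f integrable_on {x..y}"
        by (rule set_lebesgue_integral_eq_integral(1)[OF half_line_integrable_Icc[OF int xy(1)]])
      have "integral {x..x1} ?f + integral {x1..y} ?f = integral {x..y} ?f"
        by (rule Henstock_Kurzweil_Integration.integral_combine[OF xy(2,3) fi])
      also have "\<dots> \<le> integral {0<..} ?f"
      proof (rule integral_subset_le)
        show "?f integrable_on {0<..}" by (rule integrable_on_lebesgue_on[OF int]) simp
        show "{x..y} \<subseteq> {0<..}" using xy(1) by auto
        show "\<forall>t\<in>{0<..}. 0 \<le> ?f t" using f0 by simp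
      qed (rule fi)
      also have "\<dots> = I" unfolding I_def by (rule half_line_integral[OF int, symmetric])
      finally show ?thesis using a b by linarith
    qed
    have 2: "2 * S (norm (u x1)) - S (norm (u x)) - S 0 \<le> I" if x: "0 < x" "x \<le> x1" for x
    proof (rule tendsto_upperbound)
      show "((\<lambda>y. 2 * S (norm (u x1)) - S (norm (u x)) - S (norm (u y))) \<longlongrightarrow> 2 * S (norm (u x1)) - S (norm (u x)) - S 0) at_top"
        by (intro tendsto_intros SB[OF norm_tendsto_0]) (use \<open>B \<ge> 0\<close> eventually_ge_at_top in auto)
      show "\<forall>\<^sub>F y in at_top. 2 * S (norm (u x1)) - S (norm (u x)) - S (norm (u y)) \<le> I"
        using eventually_ge_at_top[of x1] by eventually_elim (rule 1[OF x])
    qed simp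
    show ?thesis
    proof (rule tendsto_upperbound)
      show "((\<lambda>x. 2 * S (norm (u x1)) - S (norm (u x))) \<longlongrightarrow> 2 * S (norm (u x1)) - S (norm (u 0))) (at_right 0)"
        by (intro tendsto_intros SP)
      have "\<forall>\<^sub>F x in at_right 0. x \<in> {0<..<x1}" by (rule eventually_at_right_real[OF x1])
      then show "\<forall>\<^sub>F x in at_right 0. 2 * S (norm (u x1)) - S (norm (u x)) \<le> I"
        by eventually_elim (use 2 S0 in auto)
    qed simp
  qed
  show ?thesis
  proof (cases "x0 = 0")
    case False
    then show ?thesis using core[of x0] x0 by (simp add: I_def)
  next
    case True
    have "2 * S (norm (u 0)) - S (norm (u 0)) \<le> I"
    proof (rule tendsto_upperbound)
      show "((\<lambda>x. 2 * S (norm (u x)) - S (norm (u 0))) \<longlongrightarrow> 2 * S (norm (u 0)) - S (norm (u 0))) (at_right 0)"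
        by (intro tendsto_intros SP)
      show "\<forall>\<^sub>F x in at_right 0. 2 * S (norm (u x)) - S (norm (u 0)) \<le> I"
        using eventually_at_right_less[of 0] by eventually_elim (rule core)
    qed simp
    then show ?thesis using True by (simp add: I_def)
  qed
qed

text \<open>Gronwall's inequality for H(t), the integral of the modulus from 0 to t: the modulus is at most
\<bar>L\<bar> * H, so H * exp (- \<bar>L\<bar> * t) does not increase.\<close>
lemma vanishes_if_deriv_le:
  assumes u0: "u 0 = 0" and AE: "AE t in half_line. norm (g t) \<le> L * norm (u t)" and t: "0 \<le> t"
  shows "u t = 0"
proof -
  let ?v = "\<lambda>t. norm (u t)"
  have vi: "?v integrable_on {s..t}" if "0 \<le> s" for s t
    using that by (intro integrable_continuous_real continuous_on_subset[OF continuous_norm]) auto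
  have L0: "?v t \<le> ?v s + \<bar>L\<bar> * integral {0..t} ?v" if st: "0 < s" "s \<le> t" for s t
  proof -
    have "?v t - ?v s \<le> integral {s..t} (\<lambda>x. norm (g x))" using norm_increment_le[OF st] by simp
    also have "\<dots> \<le> integral {s..t} (\<lambda>x. \<bar>L\<bar> * ?v x)"
    proof -
      have gi: "(\<lambda>x. norm (g x)) absolutely_integrable_on {s..t}"
        using L2_half_line_Icc[OF L2_weak st(1)] by (rule absolutely_integrable_norm[unfolded o_def])
      have vI: "(\<lambda>x. \<bar>L\<bar> * ?v x) absolutely_integrable_on {s..t}"
        using st by (intro absolutely_integrable_continuous_real continuous_intros continuous_on_subset[OF cont]) auto
      have ae: "AE x in lebesgue. x \<in> {0<..} \<longrightarrow> norm (g x) \<le> L * ?v x"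
        using AE by (subst (asm) AE_restrict_space_iff) auto
      have "(LINT x:{s..t}|lebesgue. norm (g x)) \<le> (LINT x:{s..t}|lebesgue. \<bar>L\<bar> * ?v x)"
      proof (rule set_integral_mono_AE[OF gi vI])
        show "AE x\<in>{s..t} in lebesgue. norm (g x) \<le> \<bar>L\<bar> * ?v x"
          using ae
        proof eventually_elim
          case (elim x)
          show ?case
          proof
            assume "x \<in> {s..t}"
            then have "norm (g x) \<le> L * ?v x" using elim st by auto
            also have "\<dots> \<le> \<bar>L\<bar> * ?v x" by (intro mult_right_mono) auto
            finally show "norm (g x) \<le> \<bar>L\<bar> * ?v x" .
          qed
        qed
      qed
      then show ?thesis unfolding set_lebesgue_integral_eq_integral(2)[OF gi] set_lebesgue_integral_eq_integral(2)[OF vI] .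
    qed
    also have "\<dots> = \<bar>L\<bar> * integral {s..t} ?v" by simp
    also have "\<dots> \<le> \<bar>L\<bar> * integral {0..t} ?v"
      using st vi by (intro mult_left_mono integral_subset_le) auto
    finally show ?thesis by linarith
  qed
  have L1: "?v t \<le> \<bar>L\<bar> * integral {0..t} ?v" if t: "0 < t" for t
  proof (rule tendsto_lowerbound)
    show "((\<lambda>s. ?v s + \<bar>L\<bar> * integral {0..t} ?v) \<longlongrightarrow> \<bar>L\<bar> * integral {0..t} ?v) (at_right 0)"
      using tendsto_add[OF norm_tendsto_vertex tendsto_const] u0 by simp
    have "\<forall>\<^sub>F x in at_right 0. x \<in> {0<..<t}" by (rule eventually_at_right_real[OF t])
    then show "\<forall>\<^sub>F s in at_right 0. ?v t \<le> ?v s + \<bar>L\<bar> * integral {0..t} ?v"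
      by eventually_elim (rule L0, auto)
  qed simp
  define H where "H t = integral {0..t} ?v" for t
  have Hc: "continuous_on {0..t} H" for t
    unfolding H_def by (intro indefinite_integral_continuous_1 vi) simp
  have Hd: "(H has_real_derivative ?v x) (at x)" if "0 < x" "x < t" for x t
  proof -
    have "(H has_real_derivative ?v x) (at x within {0..t})"
      unfolding H_def using that
      by (intro integral_has_real_derivative continuous_on_subset[OF continuous_norm]) auto
    then show ?thesis using at_within_Icc_at[of 0 x t] that by simp
  qed
  have "H t \<le> 0" if t: "0 < t" for t
  proof -
    define K where "K x = H x * exp (- \<bar>L\<bar> * x)" for x
    have "K t \<le> K 0"
    proof (rule DERIV_nonpos_imp_decreasing_open[of 0 t K])
      show "continuous_on {0..t} K" unfolding K_def by (intro continuous_intros Hc)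
      fix x assume x: "0 < x" "x < t"
      have "(K has_real_derivative (?v x - \<bar>L\<bar> * H x) * exp (- \<bar>L\<bar> * x)) (at x)"
        unfolding K_def by (auto intro!: derivative_eq_intros Hd[OF x] simp: algebra_simps)
      moreover have "(?v x - \<bar>L\<bar> * H x) * exp (- \<bar>L\<bar> * x) \<le> 0"
        using L1[OF x(1)] by (intro mult_nonpos_nonneg) (auto simp: H_def)
      ultimately show "\<exists>y. (K has_real_derivative y) (at x) \<and> y \<le> 0" by blast
    qed (use t in simp)
    then have "H t * exp (- \<bar>L\<bar> * t) \<le> 0" by (simp add: K_def H_def)
    then show ?thesis by (simp add: mult_le_0_iff)
  qed
  then have "?v t \<le> 0" if "0 < t" for t
    using L1[OF that] that by (metis H_def abs_ge_zero dual_order.trans mult_nonneg_nonpos)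
  then show ?thesis using t u0 by (cases "t = 0") auto
qed

end

section \<open>A calibrated lower bound for the energy\<close>

text \<open>The calibration belongs to the soliton of maximal amplitude c; its frequency is
2 / p * c powr (p - 2).\<close>
definition calibration :: "real \<Rightarrow> real \<Rightarrow> real \<Rightarrow> real" where
  "calibration p c t = sqrt (2 / p) * c powr (p / 2 + 1) * action p (t / c)"

definition calibration_slope :: "real \<Rightarrow> real \<Rightarrow> real \<Rightarrow> real" where
  "calibration_slope p c t = sqrt (2 / p) * c powr (p / 2) * slope p (t / c)"

text \<open>Up to scaling and the mass term, the value of the calibrated bound for a function with maximal
modulus A and modulus a at the vertex: one half-line climbs from a to A and descends to 0, the N - 1
others descend from a to 0. At a = 0, A = 1 this is the level of the full soliton.\<close>
definition energy_level :: "real \<Rightarrow> real \<Rightarrow> real \<Rightarrow> real \<Rightarrow> real" where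
  "energy_level p N a A =
     sqrt (2 / p) * (2 * action p A + (N - 2) * action p a) - a powr (p / 2 + 1) / (p / 2 + 1)"

text \<open>What the calibrated bound loses; it vanishes only if u moves at the speed prescribed by the
soliton equation.\<close>
definition calibration_defect :: "real \<Rightarrow> real \<Rightarrow> (real \<Rightarrow> complex) \<Rightarrow> real" where
  "calibration_defect p c u =
     (LINT t|half_line. (norm (weak_deriv u t) - calibration_slope p c (norm (u t)))\<^sup>2) / 2"

lemma weak_deriv_H1: "H1_half_line u \<Longrightarrow> has_L2_weak_deriv u (weak_deriv u)"
  unfolding H1_half_line_def weak_deriv_def using someI_ex[of "has_L2_weak_deriv u"] by simp

context
  fixes p :: real
  assumes p: "2 < p"
begin

context
  fixes c :: real
  assumes c: "0 < c"
begin

lemma calibration_deriv: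
  assumes "a \<in> {0..c}"
  shows "(calibration p c has_real_derivative calibration_slope p c a) (at a within {0..c})"
proof -
  have ac: "a / c \<in> {0..1}" using assms c by auto
  have img: "(\<lambda>t. t / c) ` {0..c} \<subseteq> {0..1}" using c by auto
  have "(action p has_real_derivative slope p (a / c)) (at (a / c) within (\<lambda>t. t / c) ` {0..c})"
    using action_deriv_within[OF p, of "a / c"] ac by (auto intro: DERIV_subset[OF _ img])
  then have "((\<lambda>t. action p (t / c)) has_real_derivative slope p (a / c) * (1 / c)) (at a within {0..c})"
    by (rule DERIV_image_chain[unfolded o_def]) (use c in \<open>auto intro!: derivative_eq_intros\<close>)
  then have "((\<lambda>t. sqrt (2 / p) * c powr (p / 2 + 1) * action p (t / c)) has_real_derivative
     sqrt (2 / p) * c powr (p / 2 + 1) * (slope p (a / c) * (1 / c))) (at a within {0..c})"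
    by (rule DERIV_cmult)
  moreover have "c powr (p / 2 + 1) = c powr (p / 2) * c" using c by (simp add: powr_add)
  ultimately show ?thesis using c unfolding calibration_def[abs_def] calibration_slope_def by (simp add: mult.assoc)
qed

lemma continuous_on_calibration_slope: "continuous_on {0..c} (calibration_slope p c)"
  unfolding calibration_slope_def[abs_def] using c
  by (intro continuous_intros continuous_on_compose2[OF continuous_on_slope[OF p]]) auto

lemma calibration_slope_nonneg: "a \<in> {0..c} \<Longrightarrow> 0 \<le> calibration_slope p c a"
  unfolding calibration_slope_def using c p slope_nonneg[OF p, of "a / c"] by simp

lemma calibration_slope_le:
  assumes "0 \<le> a"
  shows "calibration_slope p c a \<le> (sqrt (2 / p) * c powr (p / 2) / c) * a"
proof -
  have "calibration_slope p c a \<le> sqrt (2 / p) * c powr (p / 2) * (a / c)"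
    unfolding calibration_slope_def using c assms p slope_le[OF p, of "a / c"] by (intro mult_left_mono) auto
  then show ?thesis by simp
qed

text \<open>The first integral of the soliton equation with frequency 2 / p * c powr (p - 2); it is what
turns the energy density into a perfect square plus an exact term.\<close>
lemma calibration_slope_sq:
  assumes "a \<in> {0..c}"
  shows "(calibration_slope p c a)\<^sup>2 / 2 = c powr (p - 2) * a\<^sup>2 / p - a powr p / p"
proof (cases "a = 0")
  case True
  then show ?thesis by (simp add: calibration_slope_def slope_def)
next
  case False
  then have a: "a > 0" using assms by auto
  have ac: "a / c \<in> {0..1}" using assms c by auto
  have e1: "(c powr (p / 2))\<^sup>2 = c powr (p - 2) * c\<^sup>2"
  proof -
    have "(c powr (p / 2))\<^sup>2 = c powr p" by (simp add: power2_eq_square powr_add[symmetric])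
    also have "\<dots> = c powr (p - 2 + 2)" by simp
    also have "\<dots> = c powr (p - 2) * c powr 2" by (rule powr_add)
    finally show ?thesis using c by (simp add: powr_numeral)
  qed
  have e2: "c powr (p - 2) * a\<^sup>2 * (a / c) powr (p - 2) = a powr p"
  proof -
    have "a powr p = a powr (p - 2 + 2)" by simp
    also have "\<dots> = a powr (p - 2) * a powr 2" by (rule powr_add)
    finally show ?thesis using a c by (simp add: powr_divide powr_numeral)
  qed
  have "(calibration_slope p c a)\<^sup>2 = (2 / p) * (c powr (p / 2))\<^sup>2 * (slope p (a / c))\<^sup>2"
    using p by (simp add: calibration_slope_def power_mult_distrib)
  also have "(slope p (a / c))\<^sup>2 = a\<^sup>2 / c\<^sup>2 * (1 - (a / c) powr (p - 2))"
    using root_factor_sq[OF p, of "a / c"] ac by (simp add: slope_def power_mult_distrib power_divide)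
  also have "(2 / p) * (c powr (p / 2))\<^sup>2 * (a\<^sup>2 / c\<^sup>2 * (1 - (a / c) powr (p - 2)))
     = (2 / p) * (c powr (p - 2) * a\<^sup>2 - c powr (p - 2) * a\<^sup>2 * (a / c) powr (p - 2))"
  proof -
    have "2 / p * (X * c\<^sup>2) * (Y / c\<^sup>2 * (1 - w)) = 2 / p * (X * Y - X * Y * w)" for X Y w :: real
      using c p by (simp add: field_simps)
    then show ?thesis unfolding e1 .
  qed
  finally show ?thesis unfolding e2 using p by (simp add: field_simps)
qed

text \<open>Expanding the square in the defect gives the energy density minus the exact term, and
calibration_bound estimates the exact term.\<close>
lemma half_line_lower_bound:
  assumes u: "continuous_on {0..} u" "H1_half_line u"
    and le: "\<And>t. 0 \<le> t \<Longrightarrow> norm (u t) \<le> c" and x0: "0 \<le> x0"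
  shows "2 * calibration p c (norm (u x0)) - calibration p c (norm (u 0)) + calibration_defect p c u
     \<le> (LINT t|half_line. (norm (weak_deriv u t))\<^sup>2) / 2
       + c powr (p - 2) / p * (LINT t|half_line. (norm (u t))\<^sup>2)
       - (LINT t|half_line. norm (u t) powr p) / p"
    and "integrable half_line (\<lambda>t. (norm (weak_deriv u t) - calibration_slope p c (norm (u t)))\<^sup>2)"
proof -
  define g where "g = weak_deriv u"
  have wd: "has_L2_weak_deriv u g" unfolding g_def by (rule weak_deriv_H1[OF u(2)])
  have L2: "L2_half_line u" "L2_half_line g" using u wd by (auto simp: H1_half_line_def has_L2_weak_deriv_def)
  let ?s = "\<lambda>t. calibration_slope p c (norm (u t))"
  define L where "L = sqrt (2 / p) * c powr (p / 2) / c"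
  have "L \<ge> 0" using c p by (simp add: L_def)
  have s: "0 \<le> ?s t" "?s t \<le> L * norm (u t)" if "0 \<le> t" for t
    using calibration_slope_nonneg le[OF that] calibration_slope_le[of "norm (u t)"] by (auto simp: L_def)
  have sm: "?s \<in> borel_measurable half_line"
    by (intro continuous_imp_measurable_on_sets_lebesgue continuous_on_compose2[OF continuous_on_calibration_slope]
          continuous_intros continuous_on_subset[OF u(1)]) (use le in auto)
  have gm: "g \<in> borel_measurable half_line" using L2 by (simp add: L2_half_line_def)
  have int1: "integrable half_line (\<lambda>t. norm (g t) * ?s t)"
  proof (rule half_line_integrable_bound[where g="\<lambda>t. L * (norm (g t) * norm (u t))"])
    show "(\<lambda>t. norm (g t) * ?s t) \<in> borel_measurable half_line" using gm sm by measurable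
    show "integrable half_line (\<lambda>t. L * (norm (g t) * norm (u t)))"
      using L2_half_line_mult[OF L2(2,1)] by (rule integrable_mult_right)
    show "norm (norm (g t) * ?s t) \<le> L * (norm (g t) * norm (u t))" if "0 < t" for t
      using s[of t] that mult_left_mono[OF s(2)[of t], of "norm (g t)"] by (simp add: mult_ac)
  qed
  have int2: "integrable half_line (\<lambda>t. (norm (u t))\<^sup>2)" "integrable half_line (\<lambda>t. (norm (g t))\<^sup>2)"
    using L2 by (auto simp: L2_half_line_def)
  have int3: "integrable half_line (\<lambda>t. norm (u t) powr p)"
    using power_integrable[OF u(1) L2(1) wd] p by simp
  have id: "(norm (g t) - ?s t)\<^sup>2 = (norm (g t))\<^sup>2 + 2 * (c powr (p - 2) / p) * (norm (u t))\<^sup>2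
       - 2 / p * norm (u t) powr p - 2 * (norm (g t) * ?s t)" if "0 < t" for t
    using calibration_slope_sq[of "norm (u t)"] le[of t] that by (simp add: power2_diff algebra_simps)
  let ?R = "\<lambda>t. (norm (g t))\<^sup>2 + 2 * (c powr (p - 2) / p) * (norm (u t))\<^sup>2
       - 2 / p * norm (u t) powr p - 2 * (norm (g t) * ?s t)"
  have R: "integrable half_line ?R" using int1 int2 int3 by auto
  have "integrable half_line (\<lambda>t. (norm (g t) - ?s t)\<^sup>2) \<longleftrightarrow> integrable half_line ?R"
    by (rule Bochner_Integration.integrable_cong) (auto simp: id)
  then show "integrable half_line (\<lambda>t. (norm (weak_deriv u t) - ?s t)\<^sup>2)" using R by (simp add: g_def)
  have "calibration_defect p c u = (LINT t|half_line. ?R t) / 2"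
    unfolding calibration_defect_def g_def[symmetric]
    by (intro arg_cong[where f="\<lambda>x. x / 2"] Bochner_Integration.integral_cong) (auto simp: id)
  also have "(LINT t|half_line. ?R t) = (LINT t|half_line. (norm (g t))\<^sup>2)
      + 2 * (c powr (p - 2) / p) * (LINT t|half_line. (norm (u t))\<^sup>2)
      - 2 / p * (LINT t|half_line. norm (u t) powr p) - 2 * (LINT t|half_line. norm (g t) * ?s t)"
    using int1 int2 int3 by simp
  finally have D: "calibration_defect p c u + (LINT t|half_line. norm (g t) * ?s t)
     = (LINT t|half_line. (norm (g t))\<^sup>2) / 2
       + c powr (p - 2) / p * (LINT t|half_line. (norm (u t))\<^sup>2)
       - (LINT t|half_line. norm (u t) powr p) / p"
    by (simp add: field_simps)
  have "2 * calibration p c (norm (u x0)) - calibration p c (norm (u 0)) \<le> (LINT t|half_line. norm (g t) * ?s t)"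
    by (rule calibration_bound[OF u(1) L2(1) wd le calibration_deriv continuous_on_calibration_slope calibration_slope_nonneg _ x0 int1])
       (auto simp: calibration_def p)
  then show "2 * calibration p c (norm (u x0)) - calibration p c (norm (u 0)) + calibration_defect p c u
     \<le> (LINT t|half_line. (norm (weak_deriv u t))\<^sup>2) / 2
       + c powr (p - 2) / p * (LINT t|half_line. (norm (u t))\<^sup>2)
       - (LINT t|half_line. norm (u t) powr p) / p"
    using D unfolding g_def by linarith
qed

text \<open>On the half-line j that carries the maximum the bound is used with the maximum point, on all
others with the vertex itself.\<close>
lemma star_lower_bound:
  assumes u: "u \<in> H1_mass N \<mu>" and j: "j < N" and x0: "0 \<le> x0"
    and le: "\<And>i t. i < N \<Longrightarrow> 0 \<le> t \<Longrightarrow> norm (u i t) \<le> c"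
  shows "c powr (p / 2 + 1) * energy_level p N (norm (u 0 0) / c) (norm (u j x0) / c) - c powr (p - 2) * \<mu> / p
      + (\<Sum>i<N. calibration_defect p c (u i)) \<le> energy N p (p / 2 + 1) u"
proof -
  have N0: "0 < N" using j by simp
  define a where "a = norm (u 0 0)"
  have H1: "continuous_on {0..} (u i)" "H1_half_line (u i)" "norm (u i 0) = a" if "i < N" for i
  proof -
    have "u \<in> H1_star N" using u unfolding H1_mass_def by blast
    then have "continuous_on {0..} (u i) \<and> H1_half_line (u i) \<and> u i 0 = u 0 0"
      using that N0 unfolding H1_star_def by blast
    then show "continuous_on {0..} (u i)" "H1_half_line (u i)" "norm (u i 0) = a" by (auto simp: a_def)
  qed
  have m: "\<mu> = (\<Sum>i<N. LINT t|half_line. (norm (u i t))\<^sup>2)" using u by (simp add: H1_mass_def star_integral_def)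
  define J where "J i = (LINT t|half_line. (norm (weak_deriv (u i) t))\<^sup>2) / 2
       + c powr (p - 2) / p * (LINT t|half_line. (norm (u i t))\<^sup>2)
       - (LINT t|half_line. norm (u i t) powr p) / p" for i
  have J: "2 * calibration p c (norm (u i t)) - calibration p c a + calibration_defect p c (u i) \<le> J i"
    if "i < N" "0 \<le> t" for i t
    using half_line_lower_bound(1)[OF H1(1,2)[OF that(1)] le that(2)] that H1(3)[OF that(1)] by (simp add: J_def)
  have "(\<Sum>i<N. calibration p c a + (if i = j then 2 * calibration p c (norm (u j x0)) - 2 * calibration p c a else 0) + calibration_defect p c (u i))
     \<le> (\<Sum>i<N. J i)"
  proof (rule sum_mono)
    fix i assume "i \<in> {..<N}"
    then show "calibration p c a + (if i = j then 2 * calibration p c (norm (u j x0)) - 2 * calibration p c a else 0) + calibration_defect p c (u i) \<le> J i"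
      using J[of i x0] J[of i 0] H1(3)[of i] x0 by (cases "i = j") auto
  qed
  also have "(\<Sum>i<N. calibration p c a + (if i = j then 2 * calibration p c (norm (u j x0)) - 2 * calibration p c a else 0) + calibration_defect p c (u i))
     = 2 * calibration p c (norm (u j x0)) + (real N - 2) * calibration p c a + (\<Sum>i<N. calibration_defect p c (u i))"
    using j by (simp add: sum.distrib algebra_simps)
  also have "(\<Sum>i<N. J i) = energy N p (p / 2 + 1) u + a powr (p / 2 + 1) / (p / 2 + 1) + c powr (p - 2) * \<mu> / p"
    unfolding J_def energy_def star_integral_def a_def m
    by (simp add: sum.distrib sum_subtractf sum_distrib_left sum_divide_distrib)
  finally have main: "2 * calibration p c (norm (u j x0)) + (real N - 2) * calibration p c a - a powr (p / 2 + 1) / (p / 2 + 1)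
      - c powr (p - 2) * \<mu> / p + (\<Sum>i<N. calibration_defect p c (u i)) \<le> energy N p (p / 2 + 1) u" by linarith
  have "c powr (p / 2 + 1) * (a / c) powr (p / 2 + 1) = a powr (p / 2 + 1)"
    using c by (simp add: powr_mult[symmetric] a_def)
  then have "c powr (p / 2 + 1) * energy_level p N (a / c) (norm (u j x0) / c)
     = 2 * calibration p c (norm (u j x0)) + (real N - 2) * calibration p c a - a powr (p / 2 + 1) / (p / 2 + 1)"
    unfolding energy_level_def calibration_def by (simp add: algebra_simps)
  then show ?thesis using main unfolding a_def by linarith
qed

lemma calibration_defect_nonneg: "0 \<le> calibration_defect p c u"
  by (simp add: calibration_defect_def)

lemma vanishes_if_defect_0:
  assumes u: "continuous_on {0..} u" "H1_half_line u" "u 0 = 0"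
    and le: "\<And>t. 0 \<le> t \<Longrightarrow> norm (u t) \<le> c" and D: "calibration_defect p c u = 0" and t: "0 \<le> t"
  shows "u t = 0"
proof -
  have L2: "L2_half_line u" using u(2) unfolding H1_half_line_def by blast
  have "(LINT t|half_line. (norm (weak_deriv u t) - calibration_slope p c (norm (u t)))\<^sup>2) = 0"
    using D by (simp add: calibration_defect_def)
  then have "AE t in half_line. (norm (weak_deriv u t) - calibration_slope p c (norm (u t)))\<^sup>2 = 0"
    using half_line_lower_bound(2)[OF u(1,2) le order_refl] by (subst (asm) integral_nonneg_eq_0_iff_AE) auto
  then have "AE t in half_line. norm (weak_deriv u t) \<le> (sqrt (2 / p) * c powr (p / 2) / c) * norm (u t)"
    by eventually_elim (use calibration_slope_le norm_ge_zero in \<open>auto simp del: norm_ge_zero\<close>)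
  then show ?thesis
    by (rule vanishes_if_deriv_le[OF u(1) L2 weak_deriv_H1[OF u(2)] u(3) _ t])
qed

end
end

section \<open>The infimum of the energy\<close>

text \<open>From the inequality for exponents at most 1, applied to the inverse exponent.\<close>
lemma Bernoulli_powr:
  fixes y k :: real
  assumes "0 < y" "1 \<le> k"
  shows "1 + k * (y - 1) \<le> y powr k"
proof -
  have "(y powr k) powr (1 / k) \<le> 1 - 1 / k * (1 - y powr k)"
    using assms by (intro powr_le_chord) auto
  then have "y \<le> 1 - (1 - y powr k) / k" using assms by (simp add: powr_powr)
  then show ?thesis using assms by (simp add: field_simps)
qed

context
  fixes p :: real
  assumes p: "2 < p"
begin

lemma tail_mass_pos:
  assumes "0 < a" "a \<le> 1"
  shows "0 < tail_mass p a"
proof -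
  have "tail_mass p 0 < tail_mass p a"
  proof (rule DERIV_pos_imp_increasing_open[of 0 a "tail_mass p"])
    fix x assume x: "0 < x" "x < a"
    show "\<exists>y. (tail_mass p has_real_derivative y) (at x) \<and> 0 < y"
      using x assms by (intro exI[of _ "x / root_factor p x"] conjI tail_mass_deriv[OF p] divide_pos_pos root_factor_pos[OF p]) auto
  qed (use assms in \<open>auto intro: continuous_on_subset[OF continuous_on_tail_mass[OF p]]\<close>)
  then show ?thesis by (simp add: p)
qed

lemma energy_level_mono:
  assumes "0 \<le> A" "A \<le> A'" "A' \<le> 1"
  shows "energy_level p N a A \<le> energy_level p N a A'"
  unfolding energy_level_def using action_mono[OF p assms] p
  by (intro diff_right_mono mult_left_mono) auto

text \<open>The vertex terms drop out at a = 0, and at amplitude 1 the tail mass is a multiple of the action.\<close>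
lemma free_energy_level: "p * ((p / 2 + 1) / (p - 2)) * energy_level p N 0 1 = sqrt (p / 2) * (2 * tail_mass p 1)"
proof -
  have "p * sqrt (2 / p) = 2 * sqrt (p / 2)"
  proof -
    have "sqrt (2 / p) = 1 / sqrt (p / 2)" by (simp add: real_sqrt_divide)
    moreover have "p = 2 * (sqrt (p / 2) * sqrt (p / 2))" using p by simp
    ultimately show ?thesis using p by (metis (no_types, opaque_lifting) divide_eq_eq mult.assoc mult.commute mult_cancel_right2 nonzero_mult_div_cancel_right times_divide_eq_right)
  qed
  then have "sqrt (p / 2) * (2 * X) = (p * sqrt (2 / p)) * X" for X by simp
  moreover have "tail_mass p 1 = (p + 2) / (p - 2) * action p 1" by (simp add: tail_mass_def slope_def p)
  moreover have "p * ((p / 2 + 1) / (p - 2)) * energy_level p N 0 1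
     = (p * sqrt (2 / p)) * ((p + 2) / (p - 2) * action p 1)"
    using p by (simp add: energy_level_def field_simps)
  ultimately show ?thesis by (simp only:)
qed

context
  fixes N s :: real
  assumes N: "2 \<le> N" and s: "s = vertex_amplitude p N"
begin

lemma s_bounds: "0 < s" "s < 1"
  unfolding s using vertex_amplitude_pos[OF p, of N] vertex_amplitude_less_1[OF p, of N] N by auto

text \<open>The nonlinear Kirchhoff condition for N equal decreasing pieces.\<close>
lemma slope_vertex_amplitude: "N * sqrt (2 / p) * slope p s = s powr (p / 2)"
proof -
  have "s powr (p / 2) = s powr (1 + (p - 2) / 2)" by (simp add: field_simps)
  also have "\<dots> = s * sqrt (s powr (p - 2))"
    using s_bounds by (simp add: powr_add powr_half_sqrt_powr)
  also have "s powr (p - 2) = 2 * N\<^sup>2 / (2 * N\<^sup>2 + p)" using vertex_amplitude_powr[OF p, of N] N s by simp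
  also have "\<dots> = N\<^sup>2 * (2 / p) * (p / (2 * N\<^sup>2 + p))" using p N by simp
  also have "sqrt \<dots> = N * sqrt (2 / p) * root_factor p s"
  proof -
    have "sqrt (N\<^sup>2 * (2 / p) * X) = N * sqrt (2 / p) * sqrt X" for X
    proof -
      have "sqrt (N\<^sup>2 * (2 / p) * X) = sqrt (N\<^sup>2) * sqrt (2 / p) * sqrt X" by (simp only: real_sqrt_mult)
      then show ?thesis using N by simp
    qed
    moreover have "0 < N" using N by simp
    ultimately show ?thesis unfolding s root_factor_vertex[OF p \<open>0 < N\<close>] by blast
  qed
  finally show ?thesis by (simp add: slope_def)
qed

text \<open>The level of the symmetric state is proportional to its mass, with the same factor as for the
full soliton. The Kirchhoff condition eliminates the vertex term.\<close>
lemma vertex_energy_level: "p * ((p / 2 + 1) / (p - 2)) * energy_level p N s s = sqrt (p / 2) * (N * tail_mass p s)"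
proof -
  define Q where "Q = sqrt (2 / p)"
  have Q: "Q > 0" "p * Q\<^sup>2 = 2" using p by (auto simp: Q_def)
  have Qi: "sqrt (p / 2) = 1 / Q" by (simp add: Q_def real_sqrt_divide)
  define X where "X = s powr (p / 2)"
  have X: "s powr (p / 2 + 1) = X * s" using s_bounds by (simp add: X_def powr_add)
  have "p * ((p / 2 + 1) / (p - 2)) * energy_level p N s s
     = p * ((p / 2 + 1) / (p - 2)) * (Q * (N * action p s) - X * s / (p / 2 + 1))"
    unfolding energy_level_def X Q_def by (simp add: algebra_simps)
  also have "\<dots> = (p * Q * N * (p / 2 + 1) * action p s - p * X * s) / (p - 2)"
  proof -
    have "p * (K / d) * (Q * (N * a) - Y / K) = (p * Q * N * K * a - p * Y) / d" if "K \<noteq> 0" for K d a Y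
      using that by (cases "d = 0") (auto simp: field_simps)
    from this[of "p / 2 + 1" "p - 2" "action p s" "X * s"] p show ?thesis by (simp only: mult.assoc)
  qed
  also have "p * Q = 2 / Q" using Q by (simp add: field_simps power2_eq_square)
  also have "p * X * s = 2 / Q * (N * s * slope p s)"
  proof -
    have "p * X * s = p * Q * (N * slope p s) * s" using slope_vertex_amplitude by (simp add: X_def Q_def mult_ac)
    also have "p * Q = 2 / Q" using Q by (simp add: field_simps power2_eq_square)
    finally show ?thesis by (simp add: mult_ac)
  qed
  also have "(2 / Q * N * (p / 2 + 1) * action p s - 2 / Q * (N * s * slope p s)) / (p - 2) = 1 / Q * (N * tail_mass p s)"
    using p Q by (simp add: tail_mass_def field_simps)
  finally show ?thesis by (simp add: Qi)
qed

lemma free_energy_level_pos: "0 < energy_level p N 0 1"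
  using action_pos[OF p, of 1] p by (simp add: energy_level_def)

lemma vertex_energy_level_pos: "0 < energy_level p N s s"
proof -
  have "0 < p * ((p / 2 + 1) / (p - 2)) * energy_level p N s s"
    unfolding vertex_energy_level using tail_mass_pos[of s] s_bounds N p by (intro mult_pos_pos) auto
  moreover have "0 < p * ((p / 2 + 1) / (p - 2))" using p by simp
  ultimately show ?thesis by (metis zero_less_mult_pos)
qed

lemma energy_level_le_iff:
  "energy_level p N s s \<le> energy_level p N 0 1 \<longleftrightarrow> N * tail_mass p s \<le> 2 * tail_mass p 1"
proof -
  define K where "K = p * ((p / 2 + 1) / (p - 2))"
  have K: "K > 0" using p by (simp add: K_def)
  have "energy_level p N s s \<le> energy_level p N 0 1 \<longleftrightarrow> K * energy_level p N s s \<le> K * energy_level p N 0 1"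
    using K by simp
  also have "\<dots> \<longleftrightarrow> sqrt (p / 2) * (N * tail_mass p s) \<le> sqrt (p / 2) * (2 * tail_mass p 1)"
    unfolding K_def vertex_energy_level free_energy_level ..
  also have "\<dots> \<longleftrightarrow> N * tail_mass p s \<le> 2 * tail_mass p 1" using p by (subst mult_le_cancel_left_pos) auto
  finally show ?thesis .
qed

text \<open>The bracket b in the derivative of the level with respect to a decreases, so the level changes from
increasing to decreasing at most once. So between 0 and s it cannot lie below both endpoint values.\<close>
lemma energy_level_dichotomy:
  assumes a: "0 < a" "a \<le> s"
  shows "energy_level p N 0 1 < energy_level p N a 1 \<or> energy_level p N s 1 \<le> energy_level p N a 1"
proof -
  let ?f = "\<lambda>a. energy_level p N a 1"
  define b where "b x = sqrt (2 / p) * (N - 2) * root_factor p x - x powr (p / 2 - 1)" for x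
  have f: "(?f has_real_derivative x * b x) (at x)" if x: "0 < x" "x < 1" for x
  proof -
    have "((\<lambda>a. a powr (p / 2 + 1)) has_real_derivative (p / 2 + 1) * x powr (p / 2 + 1 - 1)) (at x)"
      by (rule has_real_derivative_powr[OF x(1)])
    then have 1: "((\<lambda>a. a powr (p / 2 + 1) / (p / 2 + 1)) has_real_derivative (p / 2 + 1) * x powr (p / 2) / (p / 2 + 1)) (at x)"
      using DERIV_cdivide by fastforce
    have 2: "(?f has_real_derivative sqrt (2 / p) * (0 + (N - 2) * slope p x) - (p / 2 + 1) * x powr (p / 2) / (p / 2 + 1)) (at x)"
      unfolding energy_level_def
      by (intro DERIV_diff DERIV_cmult DERIV_add DERIV_const action_deriv[OF p x] 1)
    have "x powr (p / 2) = x * x powr (p / 2 - 1)" using x powr_mult_base[of x "p / 2 - 1"] by simp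
    moreover have "(p / 2 + 1) * x powr (p / 2) / (p / 2 + 1) = x powr (p / 2)" using p by simp
    ultimately have "sqrt (2 / p) * (0 + (N - 2) * slope p x) - (p / 2 + 1) * x powr (p / 2) / (p / 2 + 1) = x * b x"
      unfolding b_def slope_def by (simp only:) (simp add: algebra_simps)
    then show ?thesis using 2 by simp
  qed
  have cont: "continuous_on {0..1} ?f"
    unfolding energy_level_def using p
    by (intro continuous_intros continuous_on_action[OF p] continuous_on_powr') auto
  have b: "b y < b x" if "0 < x" "x < y" "y \<le> 1" for x y
  proof -
    have "root_factor p y \<le> root_factor p x"
      unfolding root_factor_def using that p by (intro real_sqrt_le_mono diff_left_mono powr_mono2) auto
    then have "sqrt (2 / p) * (N - 2) * root_factor p y \<le> sqrt (2 / p) * (N - 2) * root_factor p x"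
      using N p by (intro mult_left_mono) auto
    moreover have "x powr (p / 2 - 1) < y powr (p / 2 - 1)" using that p by (intro powr_less_mono2) auto
    ultimately show ?thesis unfolding b_def by linarith
  qed
  show ?thesis
  proof (cases "0 \<le> b a")
    case True
    have "?f 0 < ?f a"
    proof (rule DERIV_pos_imp_increasing_open[of 0 a ?f])
      fix x assume x: "0 < x" "x < a"
      have "0 < x * b x" using b[OF x] True a s_bounds x by simp
      then show "\<exists>y. (?f has_real_derivative y) (at x) \<and> 0 < y" using f[of x] x a s_bounds by auto
    qed (use a s_bounds in \<open>auto intro: continuous_on_subset[OF cont]\<close>)
    then show ?thesis ..
  next
    case False
    have "?f s \<le> ?f a"
    proof (rule DERIV_nonpos_imp_decreasing_open[of a s ?f])
      fix x assume x: "a < x" "x < s"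
      have "x * b x \<le> 0" using b[OF a(1) x(1)] False x a s_bounds by (intro mult_nonneg_nonpos) auto
      then show "\<exists>y. (?f has_real_derivative y) (at x) \<and> y \<le> 0" using f[of x] x a s_bounds by auto
    qed (use a s_bounds in \<open>auto intro: continuous_on_subset[OF cont]\<close>)
    then show ?thesis ..
  qed
qed

text \<open>If a / A is at least s, the scale c = a / s puts the vertex value at s, and monotonicity in the
maximum compares with the symmetric state. Otherwise c = A puts the maximum at 1, and the dichotomy
compares with the full soliton or again with the symmetric state. The last two conclusions serve
to exclude minimisers when the full soliton has the smaller level.\<close>
lemma energy_level_scale_choice:
  assumes a: "0 \<le> a" "a \<le> A" "0 < A"
  obtains c where "A \<le> c"
    "min (energy_level p N 0 1) (energy_level p N s s) \<le> energy_level p N (a / c) (A / c)"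
    "energy_level p N 0 1 < energy_level p N s s \<Longrightarrow> 0 < a \<Longrightarrow> energy_level p N 0 1 < energy_level p N (a / c) (A / c)"
    "a = 0 \<Longrightarrow> c = A"
proof (cases "s \<le> a / A")
  case True
  then have a0: "0 < a" using s_bounds a by (cases "a = 0") auto
  have sA: "s * A \<le> a" using True a by (simp add: field_simps)
  have "energy_level p N s s \<le> energy_level p N s (s * A / a)"
    using sA a0 a s_bounds by (intro energy_level_mono) (auto simp: field_simps mult_left_mono)
  moreover have "a / (a / s) = s" "A / (a / s) = s * A / a" using a0 s_bounds by auto
  moreover have "A \<le> a / s" using sA s_bounds by (simp add: field_simps)
  ultimately have "A \<le> a / s" "energy_level p N s s \<le> energy_level p N (a / (a / s)) (A / (a / s))" by metis+
  then show ?thesis using a0 by (intro that[of "a / s"]) linarith+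
next
  case False
  have s1: "energy_level p N s s \<le> energy_level p N s 1" using s_bounds by (intro energy_level_mono) auto
  show ?thesis
  proof (cases "a = 0")
    case True
    then show ?thesis using a by (intro that[of A]) auto
  next
    case a0: False
    then have "energy_level p N 0 1 < energy_level p N (a / A) 1 \<or> energy_level p N s 1 \<le> energy_level p N (a / A) 1"
      using a False by (intro energy_level_dichotomy) auto
    then show ?thesis using a a0 s1 by (intro that[of A]) auto
  qed
qed

end
end

context
  fixes p :: real and N :: nat
  assumes p: "2 < p" "p < 6" and N: "2 \<le> N"
begin

text \<open>With this normalisation of the mass, the right-hand side as a function of c has its minimum at
c = 1, by Bernoulli's inequality for c powr (p - 2).\<close>
lemma scaled_level_ge:
  assumes c: "0 < c" and C: "0 \<le> C"
  shows "C * (1 - (p / 2 + 1) / (p - 2))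
     \<le> c powr (p / 2 + 1) * C - c powr (p - 2) * (p * ((p / 2 + 1) / (p - 2)) * C) / p"
proof -
  define k where "k = (p / 2 + 1) / (p - 2)"
  have k: "1 \<le> k" using p by (simp add: k_def field_simps)
  have "(c powr (p - 2)) powr k = c powr (p / 2 + 1)" using p by (simp add: powr_powr k_def)
  then have "1 + k * (c powr (p - 2) - 1) \<le> c powr (p / 2 + 1)"
    using Bernoulli_powr[of "c powr (p - 2)" k] c k by simp
  then have "C * (1 + k * (c powr (p - 2) - 1)) \<le> C * c powr (p / 2 + 1)" using C by (rule mult_left_mono)
  then show ?thesis using p unfolding k_def[symmetric] by (simp add: algebra_simps)
qed

lemma H1_mass_profile:
  assumes u: "u \<in> H1_mass N \<mu>" and \<mu>: "0 < \<mu>"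
  obtains j x0 where "j < N" "0 \<le> x0" "0 < norm (u j x0)"
    "\<And>i t. i < N \<Longrightarrow> 0 \<le> t \<Longrightarrow> norm (u i t) \<le> norm (u j x0)"
proof -
  have H1: "continuous_on {0..} (u i)" "H1_half_line (u i)" if "i < N" for i
  proof -
    have "u \<in> H1_star N" using u unfolding H1_mass_def by blast
    then show "continuous_on {0..} (u i)" "H1_half_line (u i)" using that unfolding H1_star_def by blast+
  qed
  have "\<exists>x0\<ge>0. \<forall>t\<ge>0. norm (u i t) \<le> norm (u i x0)" if "i < N" for i
    using norm_attains_sup[OF H1(1) _ weak_deriv_H1[OF H1(2)]] H1(2)[OF that] that
    unfolding H1_half_line_def by blast
  then obtain X where X: "\<And>i. i < N \<Longrightarrow> 0 \<le> X i" "\<And>i t. i < N \<Longrightarrow> 0 \<le> t \<Longrightarrow> norm (u i t) \<le> norm (u i (X i))"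
    by metis
  let ?M = "(\<lambda>i. norm (u i (X i))) ` {..<N}"
  have "finite ?M" "?M \<noteq> {}" using N by (auto simp: lessThan_empty_iff)
  then have "Max ?M \<in> ?M" by (rule Max_in)
  then obtain j where j: "j < N" "Max ?M = norm (u j (X j))" by blast
  have j2: "norm (u i (X i)) \<le> norm (u j (X j))" if "i < N" for i
    unfolding j(2)[symmetric] using that by (intro Max_ge) auto
  have le: "norm (u i t) \<le> norm (u j (X j))" if "i < N" "0 \<le> t" for i t
    using X(2)[OF that] j2[OF that(1)] by linarith
  have "norm (u j (X j)) \<noteq> 0"
  proof
    assume "norm (u j (X j)) = 0"
    then have 0: "u i t = 0" if "i < N" "0 \<le> t" for i t using le[OF that] by simp
    have "(LINT t|half_line. (norm (u i t))\<^sup>2) = (LINT t|half_line. 0)" if "i < N" for i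
      by (rule Bochner_Integration.integral_cong) (use 0 that in auto)
    then have "star_integral N (\<lambda>i x. (norm (u i x))\<^sup>2) = 0" by (simp add: star_integral_def)
    then show False using u \<mu> by (simp add: H1_mass_def)
  qed
  then show ?thesis using that[of j "X j"] j(1) X(1) le by auto
qed

text \<open>The mass is normalised such that the candidate of smaller level has unit amplitude c = 1. The
strict inequality covers competitors with u(0) = 0, for which the level alone gives no gap: there the
calibration defect is positive.\<close>
lemma energy_lower_bound:
  defines "s \<equiv> vertex_amplitude p (real N)"
  defines "C \<equiv> min (energy_level p N 0 1) (energy_level p N s s)" and "k \<equiv> (p / 2 + 1) / (p - 2)"
  assumes u: "u \<in> H1_mass N (p * k * C)"
  shows "C * (1 - k) \<le> energy N p (p / 2 + 1) u"
    and "energy_level p N 0 1 < energy_level p N s s \<Longrightarrow> C * (1 - k) < energy N p (p / 2 + 1) u"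
proof -
  have N2: "2 \<le> real N" using N by simp
  have C0: "0 < C" unfolding C_def s_def using free_energy_level_pos[OF p(1) N2 refl] vertex_energy_level_pos[OF p(1) N2 refl] by simp
  have "0 < p * k * C" using C0 p by (simp add: k_def)
  from H1_mass_profile[OF u this] obtain j x0 where jx: "j < N" "0 \<le> x0" "0 < norm (u j x0)"
    and le: "\<And>i t. i < N \<Longrightarrow> 0 \<le> t \<Longrightarrow> norm (u i t) \<le> norm (u j x0)" by blast
  define a A where "a = norm (u 0 0)" and "A = norm (u j x0)"
  have aA: "0 \<le> a" "a \<le> A" "0 < A" using le[of 0 0] jx N by (auto simp: a_def A_def)
  obtain c where c: "A \<le> c" "C \<le> energy_level p N (a / c) (A / c)"
    "energy_level p N 0 1 < energy_level p N s s \<Longrightarrow> 0 < a \<Longrightarrow> energy_level p N 0 1 < energy_level p N (a / c) (A / c)"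
    "a = 0 \<Longrightarrow> c = A"
    using energy_level_scale_choice[OF p(1) N2 s_def[THEN meta_eq_to_obj_eq] aA] unfolding C_def by metis
  have c0: "0 < c" using c aA by simp
  have lec: "norm (u i t) \<le> c" if "i < N" "0 \<le> t" for i t using le[OF that] c(1) by (simp add: A_def)
  define D where "D = (\<Sum>i<N. calibration_defect p c (u i))"
  have D: "0 \<le> D" unfolding D_def by (intro sum_nonneg calibration_defect_nonneg[OF p(1) c0])
  have main: "c powr (p / 2 + 1) * energy_level p N (a / c) (A / c) - c powr (p - 2) * (p * k * C) / p + D
      \<le> energy N p (p / 2 + 1) u"
    using star_lower_bound[OF p(1) c0 u jx(1,2) lec] by (simp add: a_def A_def D_def)
  have sc: "C * (1 - k) \<le> c powr (p / 2 + 1) * C - c powr (p - 2) * (p * k * C) / p"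
    using scaled_level_ge[OF c0, of C] C0 by (simp add: k_def)
  have m: "c powr (p / 2 + 1) * C \<le> c powr (p / 2 + 1) * energy_level p N (a / c) (A / c)"
    using c(2) by (intro mult_left_mono) auto
  show "C * (1 - k) \<le> energy N p (p / 2 + 1) u" using main sc m D by linarith
  assume less: "energy_level p N 0 1 < energy_level p N s s"
  show "C * (1 - k) < energy N p (p / 2 + 1) u"
  proof (cases "a = 0")
    case False
    then have "C < energy_level p N (a / c) (A / c)" using c(3)[OF less] aA less by (simp add: C_def)
    then have "c powr (p / 2 + 1) * C < c powr (p / 2 + 1) * energy_level p N (a / c) (A / c)"
      using c0 by (intro mult_strict_left_mono) auto
    then show ?thesis using main sc D by linarith
  next
    case True
    \<comment> \<open>otherwise the modulus on half-line j would start at 0 and could never reach its maximum\<close>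
    have "D \<noteq> 0"
    proof
      assume "D = 0"
      then have Dj: "calibration_defect p c (u j) = 0"
        using jx(1) unfolding D_def by (subst (asm) sum_nonneg_eq_0_iff) (auto simp: calibration_defect_nonneg[OF p(1) c0])
      have uH: "u \<in> H1_star N" using u unfolding H1_mass_def by blast
      then have Hj: "continuous_on {0..} (u j)" "H1_half_line (u j)" using jx(1) unfolding H1_star_def by blast+
      have "0 < N" using N by simp
      then have "u j 0 = u 0 0" using uH jx(1) unfolding H1_star_def by blast
      then have "u j 0 = 0" using True by (simp add: a_def)
      from vanishes_if_defect_0[OF p(1) c0 Hj this lec[OF jx(1)] Dj jx(2)]
      have "u j x0 = 0" by simp
      then show False using jx(3) by simp
    qed
    then show ?thesis using main sc m D by linarith
  qed
qed

end

section \<open>Solitons as competitors\<close>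

lemma half_line_FTC:
  fixes f F :: "real \<Rightarrow> real"
  assumes f: "continuous_on UNIV f" "\<And>x. 0 \<le> f x" and F: "\<And>x. (F has_real_derivative f x) (at x)"
    and T: "(F \<longlongrightarrow> T) at_top"
  shows "integrable half_line f" "(LINT x|half_line. f x) = T - F 0"
proof -
  have fb: "f \<in> borel_measurable borel" using f(1) by (rule borel_measurable_continuous_onI)
  have "F 0 \<le> F x" if "0 \<le> x" for x
    using that F f(2) by (intro DERIV_nonneg_imp_nondecreasing[of 0 x F]) auto
  then have "F 0 \<le> T"
    by (intro tendsto_lowerbound[OF T]) (auto intro!: eventually_mono[OF eventually_ge_at_top[of 0]])
  have fm: "f \<in> borel_measurable half_line"
    using fb by (intro measurable_restrict_space1 measurable_completion) simp
  have "(\<integral>\<^sup>+x. f x \<partial>half_line) = (\<integral>\<^sup>+x. ennreal (f x) * indicator {0<..} x \<partial>lebesgue)"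
    by (subst nn_integral_restrict_space) auto
  also have "\<dots> = (\<integral>\<^sup>+x. ennreal (f x) * indicator {0..} x \<partial>lebesgue)"
  proof (rule nn_integral_cong_AE)
    have "AE x in lebesgue. x \<noteq> (0::real)" by (rule AE_completion[OF AE_lborel_singleton])
    then show "AE x in lebesgue. ennreal (f x) * indicator {0<..} x = ennreal (f x) * indicator {0..} x"
      by eventually_elim (auto simp: indicator_def)
  qed
  also have "\<dots> = (\<integral>\<^sup>+x. ennreal (f x) * indicator {0..} x \<partial>lborel)"
    by (rule nn_integral_completion)
  also have "\<dots> = ennreal (T - F 0)"
    by (rule nn_integral_FTC_atLeast[OF fb F f(2) T])
  finally have "(\<integral>\<^sup>+x. f x \<partial>half_line) = ennreal (T - F 0)" .
  then have "integrable half_line f \<and> (LINT x|half_line. f x) = T - F 0"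
    using f(2) \<open>F 0 \<le> T\<close> by (subst (asm) nn_integral_eq_integrable[OF fm]) auto
  then show "integrable half_line f" "(LINT x|half_line. f x) = T - F 0" by auto
qed

text \<open>The form in which primitives of the soliton are used: every piece of a soliton is a rescaled and
shifted one.\<close>
lemma half_line_FTC_affine:
  fixes f F :: "real \<Rightarrow> real"
  assumes f: "continuous_on UNIV f" "\<And>x. 0 \<le> f x" and F: "\<And>x. (F has_real_derivative f x) (at x)"
    and T: "(F \<longlongrightarrow> T) at_top" and d: "0 < d"
  shows "integrable half_line (\<lambda>x. f (d * x + y))" "(LINT x|half_line. f (d * x + y)) = (T - F y) / d"
proof -
  have 1: "continuous_on UNIV (\<lambda>x. f (d * x + y))"
    by (intro continuous_on_compose2[OF f(1)] continuous_intros) auto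
  have 2: "((\<lambda>x. F (d * x + y) / d) has_real_derivative f (d * x + y)) (at x)" for x
  proof -
    have "((\<lambda>x. d * x + y) has_real_derivative d) (at x)" by (auto intro!: derivative_eq_intros)
    from DERIV_cdivide[OF DERIV_chain2[OF F this], of d] show ?thesis using d by simp
  qed
  have "filterlim (\<lambda>x. y + d * x) at_top at_top"
    by (rule filterlim_tendsto_add_at_top[OF tendsto_const filterlim_tendsto_pos_mult_at_top[OF tendsto_const d filterlim_ident]])
  then have "filterlim (\<lambda>x. d * x + y) at_top at_top" by (simp add: add.commute)
  then have 3: "((\<lambda>x. F (d * x + y) / d) \<longlongrightarrow> T / d) at_top"
    using d by (intro tendsto_divide filterlim_compose[OF T] tendsto_const) auto
  show "integrable half_line (\<lambda>x. f (d * x + y))" "(LINT x|half_line. f (d * x + y)) = (T - F y) / d"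
    using half_line_FTC[OF 1 f(2) 2 3] by (auto simp: diff_divide_distrib)
qed

definition decay_rate :: "real \<Rightarrow> real" where
  "decay_rate p = (p - 2) / 2 * sqrt (2 / p)"

definition soliton :: "real \<Rightarrow> real \<Rightarrow> real" where
  "soliton p x = cosh (decay_rate p * x) powr (- (2 / (p - 2)))"

definition kink :: "real \<Rightarrow> real \<Rightarrow> real" where
  "kink p x = tanh (decay_rate p * x)"

text \<open>The odd primitive of soliton^2 * kink^2. On the positive axis it is a function of the amplitude
alone; the sign extends it to the increasing side of the soliton.\<close>
definition kinetic_primitive :: "real \<Rightarrow> real \<Rightarrow> real" where
  "kinetic_primitive p x = sgn x * (sqrt (p / 2) * (action p 1 - action p (soliton p x)))"

text \<open>The odd primitive of soliton^2, expressed through the kinetic one by the scaling identity behind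
tail_mass.\<close>
definition mass_primitive :: "real \<Rightarrow> real \<Rightarrow> real" where
  "mass_primitive p x = ((p + 2) * kinetic_primitive p x + 2 * sqrt (p / 2) * ((soliton p x)\<^sup>2 * kink p x)) / (p - 2)"

definition soliton_piece :: "real \<Rightarrow> real \<Rightarrow> real \<Rightarrow> real \<Rightarrow> complex" where
  "soliton_piece p c y x = of_real (c * soliton p (c powr (p / 2 - 1) * x + y))"

context
  fixes p :: real
  assumes p: "2 < p"
begin

lemma decay_rate_pos: "0 < decay_rate p" using p by (simp add: decay_rate_def)

lemma sqrt_p: "sqrt (p / 2) * sqrt (2 / p) = 1" "sqrt (2 / p) * sqrt (2 / p) = 2 / p" "2 / p * sqrt (p / 2) = sqrt (2 / p)"
proof -
  have "p / 2 * (2 / p) = 1" using p by simp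
  then show 1: "sqrt (p / 2) * sqrt (2 / p) = 1" unfolding real_sqrt_mult[symmetric] by (simp only: real_sqrt_one)
  show 2: "sqrt (2 / p) * sqrt (2 / p) = 2 / p" using p by (intro real_sqrt_mult_self[THEN trans]) simp
  have "2 / p * sqrt (p / 2) = (sqrt (2 / p) * sqrt (2 / p)) * sqrt (p / 2)" by (simp only: 2)
  also have "\<dots> = sqrt (2 / p) * (sqrt (p / 2) * sqrt (2 / p))" by (simp only: mult_ac)
  finally show "2 / p * sqrt (p / 2) = sqrt (2 / p)" by (simp only: 1 mult_1_right)
qed

lemma soliton_pos: "0 < soliton p x" by (simp add: soliton_def)

lemma soliton_le_1: "soliton p x \<le> 1"
proof -
  have "cosh (decay_rate p * x) powr (- (2 / (p - 2))) \<le> 1 powr (- (2 / (p - 2)))"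
    using p cosh_real_ge_1 by (intro powr_mono2') auto
  then show ?thesis by (simp add: soliton_def)
qed

lemma soliton_0 [simp]: "soliton p 0 = 1" by (simp add: soliton_def)
lemma soliton_minus [simp]: "soliton p (- x) = soliton p x" by (simp add: soliton_def)
lemma kink_minus [simp]: "kink p (- x) = - kink p x" by (simp add: kink_def)

lemma soliton_powr: "soliton p x powr (p - 2) = 1 - (kink p x)\<^sup>2"
proof -
  have "soliton p x powr (p - 2) = cosh (decay_rate p * x) powr (- 2)"
  proof -
    have "- (2 / (p - 2)) * (p - 2) = - 2" using p by (simp add: field_simps)
    then show ?thesis unfolding soliton_def powr_powr by (simp only:)
  qed
  also have "\<dots> = inverse ((cosh (decay_rate p * x))\<^sup>2)"
    using powr_realpow[of "cosh (decay_rate p * x)" 2] by (simp add: powr_minus)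
  also have "\<dots> = 1 - (kink p x)\<^sup>2"
  proof -
    have "inverse C = 1 - S / C" if "C = S + 1" "C \<noteq> 0" for C S :: real
      using that by (simp add: field_simps)
    from this[OF cosh_square_eq[of "decay_rate p * x"]] show ?thesis
      by (simp add: kink_def tanh_def power_divide)
  qed
  finally show ?thesis .
qed

lemma soliton_deriv: "(soliton p has_real_derivative - sqrt (2 / p) * kink p x * soliton p x) (at x)"
proof -
  let ?c = "cosh (decay_rate p * x)"
  have "((\<lambda>x. cosh (decay_rate p * x)) has_real_derivative sinh (decay_rate p * x) * decay_rate p) (at x)"
    by (auto intro!: derivative_eq_intros)
  then have "((\<lambda>x. cosh (decay_rate p * x) powr (- (2 / (p - 2)))) has_real_derivative
     - (2 / (p - 2)) * ?c powr (- (2 / (p - 2)) - 1) * (sinh (decay_rate p * x) * decay_rate p)) (at x)"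
  proof -
    assume *: "((\<lambda>x. cosh (decay_rate p * x)) has_real_derivative sinh (decay_rate p * x) * decay_rate p) (at x)"
    have "((\<lambda>z. z powr r) has_real_derivative r * ?c powr (r - 1)) (at ?c)" for r
      by (rule has_real_derivative_powr) simp
    from DERIV_chain2[OF this *] show ?thesis .
  qed
  moreover have "- (2 / (p - 2)) * ?c powr (- (2 / (p - 2)) - 1) * (sinh (decay_rate p * x) * decay_rate p)
     = - sqrt (2 / p) * kink p x * soliton p x"
  proof -
    have "?c powr (- (2 / (p - 2)) - 1) = soliton p x / ?c"
      by (simp add: soliton_def powr_diff)
    moreover have "2 / (p - 2) * decay_rate p = sqrt (2 / p)" using p by (simp add: decay_rate_def)
    moreover have "sinh (decay_rate p * x) / ?c = kink p x" by (simp add: kink_def tanh_def)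
    moreover have "- B * (F / C) * (T * R) = - (B * R) * (T / C) * F" for B F C T R :: real by simp
    ultimately show ?thesis by (simp only:)
  qed
  ultimately show ?thesis by (simp add: soliton_def[abs_def])
qed

lemma kink_deriv: "(kink p has_real_derivative decay_rate p * (1 - (kink p x)\<^sup>2)) (at x)"
  unfolding kink_def[abs_def] by (auto intro!: derivative_eq_intros)

lemma continuous_on_soliton: "continuous_on S (soliton p)"
  by (rule DERIV_continuous_on[OF has_field_derivative_at_within[OF soliton_deriv]])
lemma continuous_on_kink: "continuous_on S (kink p)"
  by (rule DERIV_continuous_on[OF has_field_derivative_at_within[OF kink_deriv]])

lemma slope_soliton: "slope p (soliton p x) = soliton p x * \<bar>kink p x\<bar>"
  by (simp add: slope_def root_factor_def soliton_powr)

lemma kink_nonneg: "0 \<le> x \<Longrightarrow> 0 \<le> kink p x"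
  using decay_rate_pos by (simp add: kink_def)

text \<open>The function h below is differentiable everywhere, because the range of the soliton lies in the
interval where the action has one-sided derivatives; at the maximum of the soliton h vanishes together with
its derivative, so multiplication by the sign does no harm.\<close>
lemma kinetic_primitive_deriv:
  "(kinetic_primitive p has_real_derivative (soliton p x)\<^sup>2 * (kink p x)\<^sup>2) (at x)"
proof -
  define h where "h x = sqrt (p / 2) * (action p 1 - action p (soliton p x))" for x
  have img: "range (soliton p) \<subseteq> {0..1}" by (auto intro: less_imp_le[OF soliton_pos] soliton_le_1)
  have h: "(h has_real_derivative (soliton p x)\<^sup>2 * kink p x * \<bar>kink p x\<bar>) (at x)" for x
  proof -
    have "(action p has_real_derivative slope p (soliton p x)) (at (soliton p x) within range (soliton p))"
      using action_deriv_within[OF p, of "soliton p x"] soliton_pos[of x] soliton_le_1[of x]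
      by (intro DERIV_subset[OF _ img]) auto
    then have "((action p \<circ> soliton p) has_real_derivative slope p (soliton p x) * (- sqrt (2 / p) * kink p x * soliton p x)) (at x)"
      by (rule DERIV_image_chain[OF _ soliton_deriv])
    then have "(h has_real_derivative sqrt (p / 2) * (0 - slope p (soliton p x) * (- sqrt (2 / p) * kink p x * soliton p x))) (at x)"
      unfolding h_def o_def by (intro DERIV_cmult DERIV_diff DERIV_const)
    also have "sqrt (p / 2) * (0 - slope p (soliton p x) * (- sqrt (2 / p) * kink p x * soliton p x))
       = (sqrt (p / 2) * sqrt (2 / p)) * ((soliton p x)\<^sup>2 * kink p x * \<bar>kink p x\<bar>)"
      by (simp add: slope_soliton power2_eq_square)
    finally show ?thesis unfolding sqrt_p by simp
  qed
  have kp: "kinetic_primitive p x = sgn x * h x" for x by (simp add: kinetic_primitive_def h_def)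
  consider "x > 0" | "x < 0" | "x = 0" by linarith
  then show ?thesis
  proof cases
    case 1
    then have "(soliton p x)\<^sup>2 * kink p x * \<bar>kink p x\<bar> = (soliton p x)\<^sup>2 * (kink p x)\<^sup>2"
      using kink_nonneg[of x] by (simp add: power2_eq_square)
    with h[of x] have "(h has_real_derivative (soliton p x)\<^sup>2 * (kink p x)\<^sup>2) (at x)" by simp
    then show ?thesis
      by (rule has_field_derivative_transform_within_open[of _ _ _ "{0<..}"]) (use 1 in \<open>auto simp: kp\<close>)
  next
    case 2
    then have "- ((soliton p x)\<^sup>2 * kink p x * \<bar>kink p x\<bar>) = (soliton p x)\<^sup>2 * (kink p x)\<^sup>2"
      using kink_nonneg[of "- x"] by (simp add: power2_eq_square)
    with DERIV_minus[OF h[of x]] have "((\<lambda>x. - h x) has_real_derivative (soliton p x)\<^sup>2 * (kink p x)\<^sup>2) (at x)" by simp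
    then show ?thesis
      by (rule has_field_derivative_transform_within_open[of _ _ _ "{..<0}"]) (use 2 in \<open>auto simp: kp\<close>)
  next
    case 3
    have h0: "h 0 = 0" by (simp add: h_def)
    have "(\<lambda>t. h t / t) \<midarrow>0\<rightarrow> 0" using h[of 0] by (simp add: DERIV_def h0 kink_def)
    then have "(\<lambda>t. kinetic_primitive p t / t) \<midarrow>0\<rightarrow> 0"
      by (rule tendsto_0_le[where K=1]) (auto simp: kp abs_mult sgn_real_def)
    then show ?thesis using 3 by (simp add: DERIV_def kp h0 kink_def)
  qed
qed

lemma mass_primitive_deriv:
  "(mass_primitive p has_real_derivative (soliton p x)\<^sup>2) (at x)"
proof -
  let ?f = "soliton p x" and ?k = "kink p x"
  have 1: "((\<lambda>x. (soliton p x)\<^sup>2) has_real_derivative - 2 * sqrt (2 / p) * ?k * ?f\<^sup>2) (at x)"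
    by (rule DERIV_cong[OF DERIV_power[OF soliton_deriv, of 2]]) (simp add: power2_eq_square)
  have "(mass_primitive p has_real_derivative
     ((p + 2) * (?f\<^sup>2 * ?k\<^sup>2) + 2 * sqrt (p / 2) * ((- 2 * sqrt (2 / p) * ?k * ?f\<^sup>2) * ?k + (decay_rate p * (1 - ?k\<^sup>2)) * ?f\<^sup>2)) / (p - 2)) (at x)"
    unfolding mass_primitive_def[abs_def]
    by (intro DERIV_cdivide DERIV_add DERIV_cmult DERIV_mult kinetic_primitive_deriv 1 kink_deriv)
  also have "2 * sqrt (p / 2) * ((- 2 * sqrt (2 / p) * ?k * ?f\<^sup>2) * ?k + (decay_rate p * (1 - ?k\<^sup>2)) * ?f\<^sup>2)
     = (sqrt (p / 2) * sqrt (2 / p)) * (- 4 * (?f\<^sup>2 * ?k\<^sup>2) + (p - 2) * ((1 - ?k\<^sup>2) * ?f\<^sup>2))"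
  proof -
    have "2 * q * ((- 2 * r * k * F) * k + ((p - 2) / 2 * r * (1 - k\<^sup>2)) * F)
       = (q * r) * (- 4 * (F * k\<^sup>2) + (p - 2) * ((1 - k\<^sup>2) * F))" for q r k F :: real
      by (simp add: field_simps power2_eq_square)
    then show ?thesis unfolding decay_rate_def .
  qed
  also have "((p + 2) * (?f\<^sup>2 * ?k\<^sup>2) + (sqrt (p / 2) * sqrt (2 / p)) * (- 4 * (?f\<^sup>2 * ?k\<^sup>2) + (p - 2) * ((1 - ?k\<^sup>2) * ?f\<^sup>2))) / (p - 2) = ?f\<^sup>2"
    unfolding sqrt_p using p by (simp add: field_simps)
  finally show ?thesis .
qed

lemma soliton_tendsto_0: "(soliton p \<longlongrightarrow> 0) at_top"
proof -
  have d: "decay_rate p > 0" by (rule decay_rate_pos)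
  have e: "2 / (p - 2) > 0" using p by simp
  have "((\<lambda>x. cosh (decay_rate p * x) powr (- (2 / (p - 2)))) \<longlongrightarrow> 0) at_top"
  proof (rule tendsto_neg_powr)
    have "filterlim (\<lambda>x. decay_rate p * x) at_top at_top"
      by (rule filterlim_tendsto_pos_mult_at_top[OF tendsto_const d filterlim_ident])
    then show "filterlim (\<lambda>x. cosh (decay_rate p * x)) at_top at_top"
      by (rule filterlim_compose[OF cosh_real_at_top])
  qed (use e in simp)
  then show ?thesis by (simp add: soliton_def[abs_def])
qed

lemma soliton_attains:
  assumes "0 < a" "a \<le> 1"
  obtains y where "0 \<le> y" "soliton p y = a"
proof -
  obtain X where X: "\<And>x. x \<ge> X \<Longrightarrow> soliton p x < a"
    using order_tendstoD(2)[OF soliton_tendsto_0 assms(1)] by (auto simp: eventually_at_top_linorder)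
  have "\<exists>y. 0 \<le> y \<and> y \<le> max 0 X \<and> soliton p y = a"
    by (rule IVT2') (use X[of "max 0 X"] assms continuous_on_soliton in auto)
  then show ?thesis using that by blast
qed

lemma kink_bound: "\<bar>kink p x\<bar> \<le> 1"
  by (simp add: kink_def abs_le_iff less_imp_le tanh_real_lt_1 tanh_real_gt_neg1 minus_le_iff)

lemma kinetic_primitive_tendsto: "(kinetic_primitive p \<longlongrightarrow> sqrt (p / 2) * action p 1) at_top"
proof -
  have "((\<lambda>x. action p (soliton p x)) \<longlongrightarrow> action p 0) at_top"
    by (rule continuous_on_tendsto_compose[OF continuous_on_action[OF p] soliton_tendsto_0])
       (auto intro!: always_eventually soliton_le_1 less_imp_le[OF soliton_pos])
  then have "((\<lambda>x. sqrt (p / 2) * (action p 1 - action p (soliton p x))) \<longlongrightarrow> sqrt (p / 2) * (action p 1 - 0)) at_top"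
    by (intro tendsto_intros) (simp add: action_0[OF p])
  moreover have "\<forall>\<^sub>F x in at_top. sqrt (p / 2) * (action p 1 - action p (soliton p x)) = kinetic_primitive p x"
    using eventually_gt_at_top[of 0] by eventually_elim (simp add: kinetic_primitive_def)
  ultimately show ?thesis by (simp add: filterlim_cong[OF refl refl])
qed

lemma mass_primitive_tendsto: "(mass_primitive p \<longlongrightarrow> sqrt (p / 2) * tail_mass p 1) at_top"
proof -
  have "((\<lambda>x. (soliton p x)\<^sup>2 * kink p x) \<longlongrightarrow> 0) at_top"
  proof (rule tendsto_0_le[where K=1])
    show "((\<lambda>x. (soliton p x)\<^sup>2) \<longlongrightarrow> 0) at_top" using tendsto_power[OF soliton_tendsto_0, of 2] by simp
    show "\<forall>\<^sub>F x in at_top. norm ((soliton p x)\<^sup>2 * kink p x) \<le> norm ((soliton p x)\<^sup>2) * 1"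
      using kink_bound by (intro always_eventually allI) (auto simp: abs_mult intro!: mult_left_le)
  qed
  then have "(mass_primitive p \<longlongrightarrow> ((p + 2) * (sqrt (p / 2) * action p 1) + 2 * sqrt (p / 2) * 0) / (p - 2)) at_top"
    unfolding mass_primitive_def[abs_def] using p
    by (intro tendsto_intros kinetic_primitive_tendsto) auto
  moreover have "((p + 2) * (sqrt (p / 2) * action p 1) + 2 * sqrt (p / 2) * 0) / (p - 2) = sqrt (p / 2) * tail_mass p 1"
    by (simp add: tail_mass_def slope_def p)
  ultimately show ?thesis by simp
qed

lemma kinetic_primitive_minus: "kinetic_primitive p (- x) = - kinetic_primitive p x"
  by (simp add: kinetic_primitive_def)
lemma mass_primitive_minus: "mass_primitive p (- x) = - mass_primitive p x"
proof -
  have "(p + 2) * - X + 2 * sqrt (p / 2) * (Y * - Z) = - ((p + 2) * X + 2 * sqrt (p / 2) * (Y * Z))" for X Y Z :: real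
    by (simp add: algebra_simps)
  then show ?thesis unfolding mass_primitive_def kinetic_primitive_minus soliton_minus kink_minus minus_divide_left by (simp only:)
qed

lemma kinetic_primitive_tail:
  assumes "0 \<le> y"
  shows "sqrt (p / 2) * action p 1 - kinetic_primitive p y = sqrt (p / 2) * action p (soliton p y)"
  using assms by (cases "y = 0") (auto simp: kinetic_primitive_def algebra_simps)

lemma mass_primitive_tail:
  assumes "0 \<le> y"
  shows "sqrt (p / 2) * tail_mass p 1 - mass_primitive p y = sqrt (p / 2) * tail_mass p (soliton p y)"
proof -
  define Q where "Q = sqrt (p / 2)"
  have k: "kinetic_primitive p y = Q * action p 1 - Q * action p (soliton p y)"
    using kinetic_primitive_tail[OF assms] by (simp add: Q_def)
  have s: "(soliton p y)\<^sup>2 * kink p y = soliton p y * slope p (soliton p y)"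
    using kink_nonneg[OF assms] by (simp add: slope_soliton power2_eq_square)
  have "Q * (P * a1 / d) - (P * (Q * a1 - Q * a) + 2 * Q * Y) / d = Q * ((P * a - 2 * Y) / d)"
    if "d \<noteq> 0" for P a1 a d Y
    using that by (simp add: field_simps)
  moreover have "tail_mass p 1 = (p + 2) * action p 1 / (p - 2)" by (simp add: tail_mass_def slope_def p)
  ultimately show ?thesis unfolding mass_primitive_def Q_def[symmetric] k s tail_mass_def[of p "soliton p y"]
    using p by (simp only: mult.assoc)
qed

context
  fixes c :: real
  assumes c: "0 < c"
begin

text \<open>All integrals reduce to the two primitives, since the modulus to the power p is
soliton^2 - soliton^2 * kink^2 up to a constant.\<close>
lemma soliton_piece_integrals:
  fixes y :: real
  defines "K \<equiv> sqrt (p / 2) * action p 1 - kinetic_primitive p y"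
    and "M \<equiv> sqrt (p / 2) * tail_mass p 1 - mass_primitive p y"
  shows "continuous_on {0..} (soliton_piece p c y)" "H1_half_line (soliton_piece p c y)"
    and "(LINT x|half_line. (norm (soliton_piece p c y x))\<^sup>2) = c powr (3 - p / 2) * M"
    and "(LINT x|half_line. (norm (weak_deriv (soliton_piece p c y) x))\<^sup>2) = c powr (p / 2 + 1) * (2 / p * K)"
    and "(LINT x|half_line. norm (soliton_piece p c y x) powr p) = c powr (p / 2 + 1) * (M - K)"
proof -
  define d where "d = c powr (p / 2 - 1)"
  have d: "d > 0" using c by (simp add: d_def)
  have u: "soliton_piece p c y x = of_real (c * soliton p (d * x + y))" for x by (simp add: soliton_piece_def d_def)
  let ?g = "\<lambda>x. complex_of_real (- c * d * sqrt (2 / p) * kink p (d * x + y) * soliton p (d * x + y))"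
  have d2: "c\<^sup>2 / d = c powr (3 - p / 2)" "c\<^sup>2 * d = c powr (p / 2 + 1)" "c powr p / d = c powr (p / 2 + 1)"
  proof -
    have c2: "c\<^sup>2 = c powr 2" using c by simp
    have "c\<^sup>2 / d = c powr (2 - (p / 2 - 1))" unfolding c2 d_def by (rule powr_diff[symmetric])
    then show "c\<^sup>2 / d = c powr (3 - p / 2)" by (simp add: algebra_simps)
    have "c\<^sup>2 * d = c powr (2 + (p / 2 - 1))" unfolding c2 d_def by (rule powr_add[symmetric])
    then show "c\<^sup>2 * d = c powr (p / 2 + 1)" by (simp add: algebra_simps)
    have "c powr p / d = c powr (p - (p / 2 - 1))" unfolding d_def by (rule powr_diff[symmetric])
    also have "p - (p / 2 - 1) = p / 2 + 1" by (simp add: field_simps)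
    finally show "c powr p / d = c powr (p / 2 + 1)" .
  qed
  have f0: "continuous_on UNIV (\<lambda>x. (soliton p x)\<^sup>2)" "continuous_on UNIV (\<lambda>x. (soliton p x)\<^sup>2 * (kink p x)\<^sup>2)"
    by (intro continuous_intros continuous_on_soliton continuous_on_kink)+
  have sh: "continuous_on UNIV (\<lambda>x. d * x + y)" by (intro continuous_intros)
  note mass = half_line_FTC_affine[OF f0(1) _ mass_primitive_deriv mass_primitive_tendsto d, of y]
  note kin = half_line_FTC_affine[OF f0(2) _ kinetic_primitive_deriv kinetic_primitive_tendsto d, of y]
  have nu: "(norm (soliton_piece p c y x))\<^sup>2 = c\<^sup>2 * (soliton p (d * x + y))\<^sup>2" for x
    by (simp add: u norm_mult power_mult_distrib)
  have ng: "(norm (?g x))\<^sup>2 = c\<^sup>2 * d\<^sup>2 * (2 / p) * ((soliton p (d * x + y))\<^sup>2 * (kink p (d * x + y))\<^sup>2)" for x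
  proof -
    have "(norm (?g x))\<^sup>2 = (- c * d * sqrt (2 / p) * kink p (d * x + y) * soliton p (d * x + y))\<^sup>2"
      by (simp only: norm_of_real power2_abs)
    also have "\<dots> = c\<^sup>2 * d\<^sup>2 * (sqrt (2 / p) * sqrt (2 / p)) * ((soliton p (d * x + y))\<^sup>2 * (kink p (d * x + y))\<^sup>2)"
      by (simp only: power2_eq_square mult_ac minus_mult_minus mult_minus_left mult_minus_right)
    finally show ?thesis unfolding sqrt_p .
  qed
  have contu: "continuous_on S (soliton_piece p c y)" for S
    unfolding soliton_piece_def by (intro continuous_intros continuous_on_compose2[OF continuous_on_soliton[of UNIV]]) auto
  show "continuous_on {0..} (soliton_piece p c y)" by (rule contu)
  have contg: "continuous_on S ?g" for S
    by (intro continuous_intros continuous_on_compose2[OF continuous_on_soliton[of UNIV]] continuous_on_compose2[OF continuous_on_kink[of UNIV]]) auto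
  have meas: "f \<in> borel_measurable half_line" if "continuous_on {0<..} f" for f :: "real \<Rightarrow> complex"
    using that by (intro continuous_imp_measurable_on_sets_lebesgue) auto
  have L2u: "L2_half_line (soliton_piece p c y)" unfolding L2_half_line_def nu
    using meas[OF contu] mass(1) by (intro conjI integrable_mult_right) auto
  have L2g: "L2_half_line ?g" unfolding L2_half_line_def ng
    using meas[OF contg] kin(1) by (intro conjI integrable_mult_right) auto
  have wd: "has_L2_weak_deriv (soliton_piece p c y) ?g"
  proof (rule has_L2_weak_derivI[OF _ contg L2g])
    fix z :: real
    have "((\<lambda>x. d * x + y) has_real_derivative d) (at z)" by (auto intro!: derivative_eq_intros)
    from DERIV_cmult[OF DERIV_chain2[OF soliton_deriv this], of c]
    have "((\<lambda>x. c * soliton p (d * x + y)) has_real_derivative - c * d * sqrt (2 / p) * kink p (d * z + y) * soliton p (d * z + y)) (at z)"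
      by (simp add: mult_ac)
    then show "(soliton_piece p c y has_vector_derivative ?g z) (at z)"
      unfolding u[abs_def] by (intro has_vector_derivative_of_real) (simp add: has_real_derivative_iff_has_vector_derivative)
  qed
  show H1: "H1_half_line (soliton_piece p c y)" unfolding H1_half_line_def using L2u wd by blast
  show "(LINT x|half_line. (norm (soliton_piece p c y x))\<^sup>2) = c powr (3 - p / 2) * M"
    unfolding nu using mass by (simp add: M_def d2(1)[symmetric])
  have "(LINT x|half_line. (norm (weak_deriv (soliton_piece p c y) x))\<^sup>2) = (LINT x|half_line. (norm (?g x))\<^sup>2)"
  proof (rule Bochner_Integration.integral_cong_AE)
    have "has_L2_weak_deriv (soliton_piece p c y) (weak_deriv (soliton_piece p c y))" by (rule weak_deriv_H1[OF H1])
    then have "L2_half_line (weak_deriv (soliton_piece p c y))" by (simp add: has_L2_weak_deriv_def)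
    then show "(\<lambda>x. (norm (weak_deriv (soliton_piece p c y) x))\<^sup>2) \<in> borel_measurable half_line"
      "(\<lambda>x. (norm (?g x))\<^sup>2) \<in> borel_measurable half_line"
      using L2g unfolding L2_half_line_def by (blast intro: borel_measurable_integrable)+
    show "AE x in half_line. (norm (weak_deriv (soliton_piece p c y) x))\<^sup>2 = (norm (?g x))\<^sup>2"
      using weak_deriv_unique[OF contu weak_deriv_H1[OF H1] wd] by eventually_elim simp
  qed
  also have "\<dots> = c\<^sup>2 * d\<^sup>2 * (2 / p) * (K / d)"
    unfolding ng using kin by (simp add: K_def)
  also have "\<dots> = c\<^sup>2 * d * (2 / p * K)" using d by (simp add: power2_eq_square)
  finally show "(LINT x|half_line. (norm (weak_deriv (soliton_piece p c y) x))\<^sup>2) = c powr (p / 2 + 1) * (2 / p * K)"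
    by (simp only: d2)
  have np: "norm (soliton_piece p c y x) powr p = c powr p * ((soliton p (d * x + y))\<^sup>2 - (soliton p (d * x + y))\<^sup>2 * (kink p (d * x + y))\<^sup>2)" for x
  proof -
    let ?f = "soliton p (d * x + y)"
    have "norm (soliton_piece p c y x) = c * ?f" using c soliton_pos[of "d * x + y"] by (simp add: u norm_mult)
    then have "norm (soliton_piece p c y x) powr p = c powr p * ?f powr (2 + (p - 2))"
      using c soliton_pos[of "d * x + y"] by (simp add: powr_mult)
    also have "?f powr (2 + (p - 2)) = ?f powr 2 * ?f powr (p - 2)" by (rule powr_add)
    also have "?f powr 2 = ?f\<^sup>2" using powr_realpow[of ?f 2] soliton_pos[of "d * x + y"] by simp
    finally show ?thesis unfolding soliton_powr by (simp add: right_diff_distrib)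
  qed
  have "(LINT x|half_line. norm (soliton_piece p c y x) powr p) = c powr p * (M / d - K / d)"
    unfolding np using kin mass by (simp add: K_def M_def)
  also have "\<dots> = c powr p / d * (M - K)" by (simp add: diff_divide_distrib[symmetric])
  finally show "(LINT x|half_line. norm (soliton_piece p c y x) powr p) = c powr (p / 2 + 1) * (M - K)"
    by (simp only: d2)
qed

text \<open>Pieces with a common vertex value b may be shifted to different sides of the maximum of the
soliton.\<close>
lemma soliton_star:
  fixes y :: "nat \<Rightarrow> real"
  assumes N: "0 < N" and b: "\<And>i. i < N \<Longrightarrow> soliton p (y i) = b"
  defines "u \<equiv> \<lambda>i. soliton_piece p c (y i)"
    and "K \<equiv> (\<Sum>i<N. sqrt (p / 2) * action p 1 - kinetic_primitive p (y i))"
    and "M \<equiv> (\<Sum>i<N. sqrt (p / 2) * tail_mass p 1 - mass_primitive p (y i))"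
  shows "u \<in> H1_mass N (c powr (3 - p / 2) * M)"
    and "energy N p (p / 2 + 1) u = c powr (p / 2 + 1) * (2 / p * K - M / p - b powr (p / 2 + 1) / (p / 2 + 1))"
proof -
  have u0: "u i 0 = of_real (c * b)" if "i < N" for i using b[OF that] by (simp add: u_def soliton_piece_def)
  have "u \<in> H1_star N" unfolding H1_star_def mem_Collect_eq
    using soliton_piece_integrals(1,2) u0 by (intro conjI allI impI) (auto simp: u_def)
  moreover have "star_integral N (\<lambda>i x. (norm (u i x))\<^sup>2) = c powr (3 - p / 2) * M"
    unfolding star_integral_def u_def M_def soliton_piece_integrals(3) by (rule sum_distrib_left[symmetric])
  ultimately show "u \<in> H1_mass N (c powr (3 - p / 2) * M)" by (simp add: H1_mass_def)
  have b0: "0 < b" using b[OF N] soliton_pos[of "y 0"] by simp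
  have "norm (u 0 0) powr (p / 2 + 1) = c powr (p / 2 + 1) * b powr (p / 2 + 1)"
    using u0[OF N] c b0 by (simp add: norm_mult powr_mult)
  moreover have "star_integral N (\<lambda>i x. (norm (weak_deriv (u i) x))\<^sup>2) = c powr (p / 2 + 1) * (2 / p * K)"
    unfolding star_integral_def u_def K_def soliton_piece_integrals(4) by (simp only: sum_distrib_left)
  moreover have "star_integral N (\<lambda>i x. norm (u i x) powr p) = c powr (p / 2 + 1) * (M - K)"
    unfolding star_integral_def u_def K_def M_def soliton_piece_integrals(5) by (simp only: sum_subtractf[symmetric] sum_distrib_left)
  ultimately have "energy N p (p / 2 + 1) u = 1 / 2 * (c powr (p / 2 + 1) * (2 / p * K)) - 1 / p * (c powr (p / 2 + 1) * (M - K))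
     - 1 / (p / 2 + 1) * (c powr (p / 2 + 1) * b powr (p / 2 + 1))" unfolding energy_def by simp
  also have "\<dots> = c powr (p / 2 + 1) * (2 / p * K - M / p - b powr (p / 2 + 1) / (p / 2 + 1))"
    by (simp add: algebra_simps diff_divide_distrib)
  finally show "energy N p (p / 2 + 1) u = c powr (p / 2 + 1) * (2 / p * K - M / p - b powr (p / 2 + 1) / (p / 2 + 1))" .
qed

end
end

section \<open>Existence of ground states and the critical number\<close>

lemma ground_stateI:
  assumes "u \<in> H1_mass N \<mu>" "\<And>v. v \<in> H1_mass N \<mu> \<Longrightarrow> energy N p q u \<le> energy N p q v"
  shows "ground_state N p q \<mu> u"
  unfolding ground_state_def
proof (intro conjI assms(1) antisym)
  show "ereal (energy N p q u) \<le> (INF v\<in>H1_mass N \<mu>. ereal (energy N p q v))"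
    by (rule INF_greatest) (use assms(2) in simp)
  show "(INF v\<in>H1_mass N \<mu>. ereal (energy N p q v)) \<le> ereal (energy N p q u)"
    by (rule INF_lower[OF assms(1)])
qed

lemma ground_state_le:
  assumes "ground_state N p q \<mu> u" "v \<in> H1_mass N \<mu>"
  shows "energy N p q u \<le> energy N p q v"
proof -
  have "ereal (energy N p q u) \<le> ereal (energy N p q v)"
    using assms INF_lower[OF assms(2), of "\<lambda>v. ereal (energy N p q v)"] unfolding ground_state_def by simp
  then show ?thesis by simp
qed

context
  fixes p :: real and N :: nat
  assumes p: "2 < p" "p < 6" and N: "2 \<le> N"
begin

text \<open>The symmetric state attains the lower bound, because its level is the smaller one.\<close>
lemma ground_state_exists:
  defines "s \<equiv> vertex_amplitude p (real N)"
  assumes le: "real N * tail_mass p s \<le> 2 * tail_mass p 1"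
  shows "\<exists>\<mu>>0. \<exists>u. ground_state N p (p / 2 + 1) \<mu> u"
proof -
  have N2: "2 \<le> real N" using N by simp
  define C where "C = energy_level p N s s"
  define k where "k = (p / 2 + 1) / (p - 2)"
  have s: "0 < s" "s < 1" using s_bounds[OF p(1) N2 refl] by (auto simp: s_def)
  have C: "0 < C" using vertex_energy_level_pos[OF p(1) N2 refl] by (simp add: C_def s_def)
  have minC: "min (energy_level p N 0 1) (energy_level p N s s) = C"
    using energy_level_le_iff[OF p(1) N2 refl] le by (simp add: C_def s_def min_def)
  obtain y where y: "0 \<le> y" "soliton p y = s" using soliton_attains[OF p(1) s(1)] s by auto
  define u where "u = (\<lambda>i::nat. soliton_piece p 1 y)"
  have M: "(\<Sum>i<N. sqrt (p / 2) * tail_mass p 1 - mass_primitive p y) = p * k * C"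
    using vertex_energy_level[OF p(1) N2 refl] unfolding mass_primitive_tail[OF p(1) y(1)] y(2)
    by (simp add: C_def k_def s_def)
  have K: "(\<Sum>i<N. sqrt (p / 2) * action p 1 - kinetic_primitive p y) = N * (sqrt (p / 2) * action p s)"
    unfolding kinetic_primitive_tail[OF p(1) y(1)] y(2) by simp
  have N0: "0 < N" using N by simp
  note st = soliton_star[OF p(1) zero_less_one N0, of "\<lambda>_. y" s, OF y(2)]
  have u: "u \<in> H1_mass N (p * k * C)" using st(1) unfolding M u_def by simp
  have "energy N p (p / 2 + 1) u = 2 / p * (N * (sqrt (p / 2) * action p s)) - p * k * C / p - s powr (p / 2 + 1) / (p / 2 + 1)"
    using st(2) unfolding M K u_def by simp
  also have "2 / p * (N * (sqrt (p / 2) * action p s)) = N * ((2 / p * sqrt (p / 2)) * action p s)" by simp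
  also have "\<dots> = N * (sqrt (2 / p) * action p s)" unfolding sqrt_p[OF p(1)] ..
  also have "N * (sqrt (2 / p) * action p s) - p * k * C / p - s powr (p / 2 + 1) / (p / 2 + 1) = C * (1 - k)"
  proof -
    have "C = N * (sqrt (2 / p) * action p s) - s powr (p / 2 + 1) / (p / 2 + 1)"
      by (simp add: C_def energy_level_def algebra_simps)
    moreover have "p * k * C / p = k * C" using p by simp
    moreover have "C * (1 - k) = C - k * C" by (simp add: algebra_simps)
    ultimately show ?thesis by linarith
  qed
  finally have E: "energy N p (p / 2 + 1) u = C * (1 - k)" .
  have "ground_state N p (p / 2 + 1) (p * k * C) u"
  proof (rule ground_stateI[OF u])
    fix v assume "v \<in> H1_mass N (p * k * C)"
    then show "energy N p (p / 2 + 1) u \<le> energy N p (p / 2 + 1) v"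
      using energy_lower_bound(1)[OF p N, of v] minC unfolding E s_def k_def by simp
  qed
  moreover have "0 < p * k * C" using p C by (simp add: k_def)
  ultimately show ?thesis by blast
qed

text \<open>The competitors carry a soliton with its maximum at distance of the order of t from the
vertex on one half-line, and the matching tails on the others. Their excess mass is removed by a
factor c that tends to 1 as t grows, so their energies tend to the lower bound, which no function
attains.\<close>
lemma ground_state_not_exists:
  defines "s \<equiv> vertex_amplitude p (real N)"
  assumes less: "2 * tail_mass p 1 < real N * tail_mass p s"
  shows "\<exists>\<mu>>0. \<not> (\<exists>u. ground_state N p (p / 2 + 1) \<mu> u)"
proof -
  have N2: "2 \<le> real N" using N by simp
  have N0: "0 < N" using N by simp
  define C where "C = energy_level p N 0 1"
  define k where "k = (p / 2 + 1) / (p - 2)"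
  define \<mu> where "\<mu> = p * k * C"
  have C: "0 < C" using free_energy_level_pos[OF p(1) N2 refl] by (simp add: C_def)
  have \<mu>: "0 < \<mu>" using p C by (simp add: k_def \<mu>_def)
  have lt: "energy_level p N 0 1 < energy_level p N s s"
    using energy_level_le_iff[OF p(1) N2 refl] less by (simp add: s_def not_le[symmetric])
  then have minC: "min (energy_level p N 0 1) (energy_level p N s s) = C" by (simp add: C_def)
  \<comment> \<open>on half-line 0 the soliton is shifted outwards, so that its maximum lies in the interior\<close>
  define y where "y t i = (if i = 0 then - t else t)" for t :: real and i :: nat
  define M where "M t = (\<Sum>i<N. sqrt (p / 2) * tail_mass p 1 - mass_primitive p (y t i))" for t
  define K where "K t = (\<Sum>i<N. sqrt (p / 2) * action p 1 - kinetic_primitive p (y t i))" for t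
  have "\<not> (\<exists>u. ground_state N p (p / 2 + 1) \<mu> u)"
  proof
    assume "\<exists>u. ground_state N p (p / 2 + 1) \<mu> u"
    then obtain u where u: "ground_state N p (p / 2 + 1) \<mu> u" by blast
    then have "u \<in> H1_mass N \<mu>" by (simp add: ground_state_def)
    then have gt: "C * (1 - k) < energy N p (p / 2 + 1) u"
      using energy_lower_bound(2)[OF p N, of u] minC lt unfolding \<mu>_def k_def s_def by simp
    have split: "(\<Sum>i<N. L - F (y t i)) = (L - F (- t)) + (real N - 1) * (L - F t)" for L t and F :: "real \<Rightarrow> real"
    proof -
      have "(\<Sum>i<N. L - F (y t i)) = (L - F (y t 0)) + (\<Sum>i\<in>{..<N} - {0}. L - F (y t i))"
        using N0 by (intro sum.remove) auto
      also have "(\<Sum>i\<in>{..<N} - {0}. L - F (y t i)) = (\<Sum>i\<in>{..<N} - {0}. L - F t)"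
        by (rule sum.cong) (auto simp: y_def)
      also have "\<dots> = (real N - 1) * (L - F t)" using N0 by (simp add: of_nat_diff)
      finally show ?thesis by (simp add: y_def)
    qed
    define mL kL where "mL = sqrt (p / 2) * tail_mass p 1" and "kL = sqrt (p / 2) * action p 1"
    have Mlim: "(M \<longlongrightarrow> (mL - (- mL)) + (real N - 1) * (mL - mL)) at_top"
      unfolding M_def split mass_primitive_minus[OF p(1)] mL_def
      by (intro tendsto_intros mass_primitive_tendsto p)
    have Klim: "(K \<longlongrightarrow> (kL - (- kL)) + (real N - 1) * (kL - kL)) at_top"
      unfolding K_def split kinetic_primitive_minus[OF p(1)] kL_def
      by (intro tendsto_intros kinetic_primitive_tendsto p)
    have M\<mu>: "(mL - (- mL)) + (real N - 1) * (mL - mL) = \<mu>"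
      using free_energy_level[OF p(1), of N] by (simp add: \<mu>_def k_def C_def mL_def)
    have KC: "2 / p * ((kL - (- kL)) + (real N - 1) * (kL - kL)) = C"
    proof -
      have "2 / p * ((kL - (- kL)) + (real N - 1) * (kL - kL)) = (2 / p * sqrt (p / 2)) * (2 * action p 1)"
        by (simp add: kL_def)
      also have "\<dots> = C" unfolding sqrt_p[OF p(1)] using p by (simp add: C_def energy_level_def)
      finally show ?thesis .
    qed
    note Mlim = Mlim[unfolded M\<mu>]
    define c where "c t = (\<mu> / M t) powr (1 / (3 - p / 2))" for t
    define Ef where "Ef t = c t powr (p / 2 + 1) * (2 / p * K t - M t / p - soliton p t powr (p / 2 + 1) / (p / 2 + 1))" for t
    have "((\<lambda>t. \<mu> / M t) \<longlongrightarrow> \<mu> / \<mu>) at_top" using \<mu> by (intro tendsto_divide tendsto_const Mlim) simp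
    then have clim: "(c \<longlongrightarrow> 1) at_top"
      unfolding c_def using \<mu> tendsto_powr[of "\<lambda>t. \<mu> / M t" 1 at_top "\<lambda>_. 1 / (3 - p / 2)" "1 / (3 - p / 2)"] by simp
    have bl: "((\<lambda>t. soliton p t powr (p / 2 + 1)) \<longlongrightarrow> 0) at_top"
      by (rule tendsto_zero_powrI[OF soliton_tendsto_0[OF p(1)] tendsto_const])
         (use p soliton_pos[OF p(1)] less_imp_le in \<open>auto intro!: always_eventually less_imp_le[OF soliton_pos[OF p(1)]]\<close>)
    have "(Ef \<longlongrightarrow> 1 powr (p / 2 + 1) * (2 / p * ((kL - (- kL)) + (real N - 1) * (kL - kL)) - \<mu> / p - 0 / (p / 2 + 1))) at_top"
      unfolding Ef_def using p by (intro tendsto_intros clim Klim Mlim bl) auto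
    then have "(Ef \<longlongrightarrow> C * (1 - k)) at_top" unfolding KC using p by (simp add: \<mu>_def algebra_simps)
    then have "\<forall>\<^sub>F t in at_top. Ef t < energy N p (p / 2 + 1) u" by (rule order_tendstoD(2)[OF _ gt])
    moreover have "\<forall>\<^sub>F t in at_top. 0 < M t" by (rule order_tendstoD(1)[OF Mlim \<mu>])
    ultimately have "\<forall>\<^sub>F t in at_top. Ef t < energy N p (p / 2 + 1) u \<and> 0 < M t" by (rule eventually_conj)
    then obtain t where t: "Ef t < energy N p (p / 2 + 1) u" "0 < M t"
      using eventually_happens'[OF trivial_limit_at_top_linorder] by (metis (mono_tags, lifting))
    have c0: "0 < c t" using t \<mu> by (simp add: c_def)
    have "c t powr (3 - p / 2) * M t = \<mu>" using t \<mu> p by (simp add: c_def powr_powr)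
    moreover have "soliton p (y t i) = soliton p t" for i by (simp add: y_def soliton_minus[OF p(1)])
    note st = soliton_star[OF p(1) c0 N0, of "y t" "soliton p t", OF this]
    ultimately have "(\<lambda>i. soliton_piece p (c t) (y t i)) \<in> H1_mass N \<mu>"
      "energy N p (p / 2 + 1) (\<lambda>i. soliton_piece p (c t) (y t i)) = Ef t"
      using st by (simp_all add: M_def K_def Ef_def)
    then show False using ground_state_le[OF u] t(1) by fastforce
  qed
  then show ?thesis using \<mu> by blast
qed

lemma le_critical_number:
  assumes "critical_number p n" "real N * tail_mass p (vertex_amplitude p N) \<le> 2 * tail_mass p 1"
  shows "N \<le> n"
proof (rule ccontr)
  assume "\<not> N \<le> n"
  moreover have "1 \<le> N" using N by simp
  ultimately show False using assms(1) ground_state_exists[OF assms(2)] unfolding critical_number_def by (meson not_le)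
qed

lemma critical_number_less:
  assumes "critical_number p n" "2 * tail_mass p 1 < real N * tail_mass p (vertex_amplitude p N)"
  shows "n < N"
proof (rule ccontr)
  assume "\<not> n < N"
  moreover have "1 \<le> N" using N by simp
  ultimately show False using assms(1) ground_state_not_exists[OF assms(2)] unfolding critical_number_def by (meson not_less)
qed

end

lemma critical_number_eq_3:
  assumes p: "3 \<le> p" "p < 6" and n: "critical_number p n"
  shows "n = 3"
proof -
  have p2: "2 < p" using p by simp
  have "3 * tail_mass p (vertex_amplitude p 3) \<le> 2 * tail_mass p 1"
    using three_half_lines_small[OF p2 p(1)] three_half_lines_large[OF _ p(2)] by (cases "p \<le> 4") auto
  then have "3 \<le> n" using le_critical_number[OF p2 p(2) _ n, of 3] by simp
  moreover have "n < 4" using critical_number_less[OF p2 p(2) _ n, of 4] four_half_lines_exceed[OF p2 p] by simp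
  ultimately show ?thesis by simp
qed

theorem proposition1p3:
  fixes Np :: "real \<Rightarrow> nat"
  assumes "\<And>p. p \<in> {2<..<6} \<Longrightarrow> critical_number p (Np p)"
  shows "filterlim Np at_top (at_right 2) \<and>
         (\<forall>p\<in>{4..<6}. Np p \<in> {2, 3, 4}) \<and>
         (\<exists>\<delta>>0. \<forall>p\<in>{4 - \<delta><..<4 + \<delta>} \<union> {6 - \<delta><..<6}. Np p = 3)"
proof -
  have eq3: "Np p = 3" if "3 \<le> p" "p < 6" for p
    using critical_number_eq_3[OF that assms[of p]] that by simp
  have "filterlim Np at_top (at_right 2)"
    unfolding filterlim_at_top
  proof
    fix Z :: nat
    define N where "N = max 2 Z"
    have N: "2 \<le> N" "0 < real N" by (auto simp: N_def)
    have "\<forall>\<^sub>F p::real in at_right 2. p \<in> {2<..<6}" by (rule eventually_at_right_real) simp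
    with eventually_many_half_lines[OF N(2)] show "\<forall>\<^sub>F p in at_right 2. Z \<le> Np p"
    proof eventually_elim
      case (elim p)
      then have "N \<le> Np p" using le_critical_number[OF _ _ N(1) assms[of p]] by simp
      then show ?case by (simp add: N_def)
    qed
  qed
  moreover have "\<forall>p\<in>{4..<6}. Np p \<in> {2, 3, 4}" using eq3 by simp
  moreover have "\<exists>\<delta>>0. \<forall>p\<in>{4 - \<delta><..<4 + \<delta>} \<union> {6 - \<delta><..<6}. Np p = 3"
    by (rule exI[of _ 1]) (auto intro!: eq3)
  ultimately show ?thesis by blast
qed

end
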